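(* Let $\pi:\mathbb{L}\to M$ be a bundle of Lie algebras with fiber $\mathfrak{k}$, and fix a Lie connection $\nabla$ on $\mathbb{L}$. If $\mathfrak{k}$ is perfect or centerfree, then a linear map $D:\Gamma(\mathbb{L})\to\Gamma(\mathbb{L})$ is a derivation of $\Gamma(\mathbb{L})$ if and only if there are sections $\mathcal{Y}\in\Gamma(TM\otimes\operatorname{Cent}(\mathbb{L}))$ and $D_0\in\Gamma(\operatorname{Der}(\mathbb{L}))$ such that $D=\nabla_{\mathcal{Y}}+i(D_0)$; and this decomposition is unique.
   Context: All vector spaces and linear maps are over $\mathbb{K}\in\{\mathbb{R},\mathbb{C}\}$ (the tensor product with $TM$ is over $\mathbb{R}$). A manifold is smooth, finite-dimensional over $\mathbb{R}$, Hausdorff, paracompact and connected. A Lie algebra $\mathfrak{g}$ is perfect if $[\mathfrak{g},\mathfrak{g}]=\mathfrak{g}$, and centerfree if its center is $0$. $\operatorname{Der}(\mathfrak{g})$ is the Lie algebra of derivations of $\mathfrak{g}$, and the centroid is $\operatorname{Cent}(\mathfrak{g})=\{f\in\operatorname{End}(\mathfrak{g}): f[x,y]=[x,f(y)]\ \forall x,y\in\mathfrak{g}\}$. Let $\mathfrak{k}$ be a finite-dimensional Lie algebra over $\mathbb{K}$. A bundle of Lie algebras $\pi:\mathbb{L}\to M$ with fiber $\mathfrak{k}$ is a smooth vector bundle with fiber $\mathfrak{k}$ over a manifold $M$ together with a bundle atlas whose transition maps take values in $\operatorname{Aut}(\mathfrak{k})$; each fiber $\mathbb{L}_x$ carries the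 Lie bracket for which bundle charts restrict to Lie algebra isomorphisms $\mathbb{L}_x\to\mathfrak{k}$. $\Gamma(\mathbb{L})$ is the Lie algebra of smooth sections with pointwise bracket. $\operatorname{Der}(\mathbb{L})$ and $\operatorname{Cent}(\mathbb{L})$ are the smooth subbundles of $\operatorname{Hom}(\mathbb{L},\mathbb{L})$ (fibers $\operatorname{End}(\mathbb{L}_x)$) with fibers $\operatorname{Der}(\mathbb{L}_x)$ and $\operatorname{Cent}(\mathbb{L}_x)$. A covariant derivative of $\mathbb{L}$ is a linear map $\nabla:\Gamma(TM)\to\operatorname{End}(\Gamma(\mathbb{L}))$, $X\mapsto\nabla_X$, with $\nabla_X(aA)=(X.a)A+a\nabla_XA$ for $a\in C^\infty(M,\mathbb{K})$ and $\nabla_{aX+bY}A=a\nabla_XA+b\nabla_YA$ for $a,b\in C^\infty(M,\mathbb{R})$, for all $X,Y\in\Gamma(TM)$, $A\in\Gamma(\mathbb{L})$. It is a Lie connection if $\nabla_X[A,B]=[\nabla_XA,B]+[A,\nabla_XB]$ for all $X\in\Gamma(TM)$ and $A,B\in\Gamma(\mathbb{L})$. A Lie connection $\nabla$ is extended to a linear map $\nabla:\Gamma(TM\otimes\operatorname{Cent}(\mathbb{L}))\to\operatorname{Der}(\Gamma(\mathbb{L}))$, $\mathcal{Y}\mapsto\nabla_{\mathcal{Y}}$, as follows: if $(U,\xi)$ is a chart of $M$ with coordinate vector fields $\partial_{\xi_1},\dots,\partial_{\xi_m}$ and $\mathcal{Y}|_U=\sum_{j=1}^m\partial_{\xi_j}\otimes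 S^j$ with (unique) sections $S^j$ of $\operatorname{Cent}(\mathbb{L})$ over $U$, then $(\nabla_{\mathcal{Y}})|_U=\sum_{j=1}^m S^j\circ\nabla_{\partial_{\xi_j}}$ (this is independent of the chart). For $D_0\in\Gamma(\operatorname{Der}(\mathbb{L}))$, $i(D_0):\Gamma(\mathbb{L})\to\Gamma(\mathbb{L})$ is given by $(i(D_0)X)_x=D_0(x)(X_x)$. *)

theory Defs
  imports "HOL-Analysis.Analysis"
begin

text \<open>
  The ground field \<open>\<bbbK>\<close> is a type \<open>'k\<close> of sort \<open>{real_normed_field, euclidean_space}\<close>, that is, a
  finite-dimensional normed field extension of the reals.  Both \<^typ>\<open>real\<close> and \<^typ>\<open>complex\<close> are
  instances, and by Gelfand-Mazur there are no others up to isomorphism.  ``Smooth'' always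
  refers to real derivatives.

  The model space \<open>\<real>\<^sup>m\<close> is a type \<open>'e\<close> of sort \<open>real_inner\<close> with a finite orthonormal basis.  The
  class \<open>euclidean_space\<close> is not used here because it would exclude \<open>m = 0\<close>.
\<close>

subsection \<open>Smooth manifolds\<close>

primrec Ck_on :: "nat \<Rightarrow> 'a::real_normed_vector set \<Rightarrow> ('a \<Rightarrow> 'b::real_normed_vector) \<Rightarrow> bool" where
  "Ck_on 0 S f \<longleftrightarrow> continuous_on S f"
| "Ck_on (Suc n) S f \<longleftrightarrow>
     (\<forall>x\<in>S. f differentiable (at x)) \<and> (\<forall>v. Ck_on n S (\<lambda>x. frechet_derivative f (at x) v))"

definition smooth_on :: "'a::real_normed_vector set \<Rightarrow> ('a \<Rightarrow> 'b::real_normed_vector) \<Rightarrow> bool" where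
  "smooth_on S f \<longleftrightarrow> (\<forall>n. Ck_on n S f)"

definition paracompact_type :: "'m::topological_space itself \<Rightarrow> bool" where
  "paracompact_type _ \<longleftrightarrow>
     (\<forall>\<U>::'m set set. (\<forall>U\<in>\<U>. open U) \<and> \<Union>\<U> = UNIV \<longrightarrow>
        (\<exists>\<V>. (\<forall>V\<in>\<V>. open V) \<and> \<Union>\<V> = UNIV \<and> (\<forall>V\<in>\<V>. \<exists>U\<in>\<U>. V \<subseteq> U) \<and>
             locally_finite_in euclidean \<V>))"

text \<open>
  The manifold is the whole type \<open>'m\<close>; \<open>frame\<close> is the standard basis of the model space, so that
  the coordinates of a chart \<open>(U, \<xi>)\<close> are the functions \<open>\<xi> x \<bullet> e\<close> for \<open>e \<in> frame M\<close>.
  The atlas is not required to be maximal.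
\<close>

record ('m, 'e) manifold_data =
  frame :: "'e set"
  charts :: "('m set \<times> ('m \<Rightarrow> 'e)) set"

definition smooth_manifold :: "('m::t2_space, 'e::real_inner) manifold_data \<Rightarrow> bool" where
  "smooth_manifold M \<longleftrightarrow>
     connected (UNIV :: 'm set) \<and> paracompact_type TYPE('m) \<and>
     finite (frame M) \<and> span (frame M) = UNIV \<and>
     (\<forall>e\<in>frame M. \<forall>e'\<in>frame M. e \<bullet> e' = (if e = e' then 1 else 0)) \<and>
     (\<Union>(U, \<xi>)\<in>charts M. U) = UNIV \<and>
     (\<forall>(U, \<xi>)\<in>charts M. open U \<and> open (\<xi> ` U) \<and> homeomorphism U (\<xi> ` U) \<xi> (inv_into U \<xi>)) \<and>
     (\<forall>(U, \<xi>)\<in>charts M. \<forall>(V, \<eta>)\<in>charts M. smooth_on (\<xi> ` (U \<inter> V)) (\<eta> \<circ> inv_into U \<xi>))"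

definition smooth_fun_on ::
    "('m, 'e::real_inner) manifold_data \<Rightarrow> 'm set \<Rightarrow> ('m \<Rightarrow> 'b::real_normed_vector) \<Rightarrow> bool" where
  "smooth_fun_on M W f \<longleftrightarrow> (\<forall>(U, \<xi>)\<in>charts M. smooth_on (\<xi> ` (U \<inter> W)) (f \<circ> inv_into U \<xi>))"

text \<open>
  The tangent space at \<open>x\<close> consists of the point derivations of \<open>C\<^sup>\<infinity>(M, \<real>)\<close> at \<open>x\<close>; they are extended
  by \<open>0\<close> to functions that are not smooth, so that equality in HOL is equality of tangent vectors.
\<close>

type_synonym 'm tvec = "('m \<Rightarrow> real) \<Rightarrow> real"

definition tangent_space :: "('m, 'e::real_inner) manifold_data \<Rightarrow> 'm \<Rightarrow> 'm tvec set" where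
  "tangent_space M x = {v.
     (\<forall>f. \<not> smooth_fun_on M UNIV f \<longrightarrow> v f = 0) \<and>
     (\<forall>f g. smooth_fun_on M UNIV f \<longrightarrow> smooth_fun_on M UNIV g \<longrightarrow>
        v (\<lambda>y. f y + g y) = v f + v g \<and>
        v (\<lambda>y. f y * g y) = v f * g x + f x * v g) \<and>
     (\<forall>f c. smooth_fun_on M UNIV f \<longrightarrow> v (\<lambda>y. c * f y) = c * v f)}"

text \<open>The coordinate vector field of the chart \<open>(U, \<xi>)\<close> in direction \<open>e\<close>, meaningful at \<open>x \<in> U\<close>.\<close>

definition coord_field ::
    "('m, 'e::real_inner) manifold_data \<Rightarrow> 'm set \<Rightarrow> ('m \<Rightarrow> 'e) \<Rightarrow> 'e \<Rightarrow> 'm \<Rightarrow> 'm tvec" where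
  "coord_field M U \<xi> e x = (\<lambda>f. if smooth_fun_on M UNIV f
     then frechet_derivative (f \<circ> inv_into U \<xi>) (at (\<xi> x)) e else 0)"

definition vector_fields :: "('m, 'e::real_inner) manifold_data \<Rightarrow> ('m \<Rightarrow> 'm tvec) set" where
  "vector_fields M = {X. (\<forall>x. X x \<in> tangent_space M x) \<and>
     (\<forall>(U, \<xi>)\<in>charts M. \<exists>c. (\<forall>e\<in>frame M. smooth_fun_on M U (c e)) \<and>
        (\<forall>x\<in>U. X x = (\<lambda>f. \<Sum>e\<in>frame M. c e x * coord_field M U \<xi> e x f)))}"

text \<open>\<open>X.a\<close> for \<open>\<bbbK>\<close>-valued \<open>a\<close>: a vector field acts on the real components of \<open>a\<close>.\<close>

definition vf_act :: "('m \<Rightarrow> 'm tvec) \<Rightarrow> ('m \<Rightarrow> 'k::euclidean_space) \<Rightarrow> 'm \<Rightarrow> 'k" where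
  "vf_act X a x = (\<Sum>b\<in>Basis. X x (\<lambda>y. a y \<bullet> b) *\<^sub>R b)"


subsection \<open>Finite-dimensional Lie algebras\<close>

record ('k, 'f) lie_algebra_data =
  scl :: "'k \<Rightarrow> 'f \<Rightarrow> 'f"
  brk :: "'f \<Rightarrow> 'f \<Rightarrow> 'f"

definition findim_lie_algebra :: "('k::field, 'f::ab_group_add) lie_algebra_data \<Rightarrow> bool" where
  "findim_lie_algebra G \<longleftrightarrow>
     (\<exists>B. finite_dimensional_vector_space (scl G) B) \<and>
     (\<forall>x. Vector_Spaces.linear (scl G) (scl G) (\<lambda>y. brk G x y)) \<and>
     (\<forall>y. Vector_Spaces.linear (scl G) (scl G) (\<lambda>x. brk G x y)) \<and>
     (\<forall>x. brk G x x = 0) \<and>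
     (\<forall>x y z. brk G x (brk G y z) + brk G y (brk G z x) + brk G z (brk G x y) = 0)"

definition perfect_lie :: "('k::field, 'f::ab_group_add) lie_algebra_data \<Rightarrow> bool" where
  "perfect_lie G \<longleftrightarrow> module.span (scl G) {brk G x y | x y. True} = UNIV"

definition centerfree_lie :: "('k::field, 'f::ab_group_add) lie_algebra_data \<Rightarrow> bool" where
  "centerfree_lie G \<longleftrightarrow> {z. \<forall>x. brk G z x = 0} = {0}"

definition lie_aut :: "('k::field, 'f::ab_group_add) lie_algebra_data \<Rightarrow> ('f \<Rightarrow> 'f) set" where
  "lie_aut G = {g. bij g \<and> Vector_Spaces.linear (scl G) (scl G) g \<and>
     (\<forall>x y. g (brk G x y) = brk G (g x) (g y))}"


subsection \<open>Bundles of Lie algebras\<close>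

text \<open>
  The total space is the whole type \<open>'l\<close>.  A bundle chart \<open>(U, \<psi>)\<close> stands for the trivialization
  \<open>p \<mapsto> (bproj p, \<psi> p)\<close> of the part of the total space over \<open>U\<close>.  As usual, a bundle atlas with smooth
  transition maps determines the topology and the smooth structure of the total space (the ones
  for which the trivializations are diffeomorphisms), so these are not separate data.
\<close>

record ('m, 'e, 'k, 'f, 'l) lie_bundle_data =
  base :: "('m, 'e) manifold_data"
  fiber :: "('k, 'f) lie_algebra_data"
  bproj :: "'l \<Rightarrow> 'm"
  bcharts :: "('m set \<times> ('l \<Rightarrow> 'f)) set"

text \<open>
  The fiber carries no norm; a map into it is smooth if all its coordinates, i.e. its compositions
  with linear functionals, are smooth.
\<close>

definition smooth_fib_on :: "('m, 'e::real_inner, 'k::{real_normed_field,euclidean_space},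
    'f::ab_group_add, 'l) lie_bundle_data \<Rightarrow> 'm set \<Rightarrow> ('m \<Rightarrow> 'f) \<Rightarrow> bool" where
  "smooth_fib_on L W s \<longleftrightarrow> (\<forall>l::'f \<Rightarrow> 'k. Vector_Spaces.linear (scl (fiber L)) (*) l \<longrightarrow>
     smooth_fun_on (base L) W (\<lambda>x. l (s x)))"

definition fib :: "('m, 'e, 'k, 'f, 'l) lie_bundle_data \<Rightarrow> 'm \<Rightarrow> 'l set" where
  "fib L x = {p. bproj L p = x}"

definition lie_bundle :: "('m::t2_space, 'e::real_inner, 'k::{real_normed_field,euclidean_space},
    'f::ab_group_add, 'l) lie_bundle_data \<Rightarrow> bool" where
  "lie_bundle L \<longleftrightarrow>
     smooth_manifold (base L) \<and> findim_lie_algebra (fiber L) \<and>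
     (\<Union>(U, \<psi>)\<in>bcharts L. U) = UNIV \<and>
     (\<forall>(U, \<psi>)\<in>bcharts L. open U \<and> (\<forall>x\<in>U. bij_betw \<psi> (fib L x) UNIV)) \<and>
     (\<forall>(U, \<psi>)\<in>bcharts L. \<forall>(V, \<theta>)\<in>bcharts L.
        (\<forall>x\<in>U \<inter> V. \<theta> \<circ> inv_into (fib L x) \<psi> \<in> lie_aut (fiber L)) \<and>
        (\<forall>w. smooth_fib_on L (U \<inter> V) (\<lambda>x. \<theta> (inv_into (fib L x) \<psi> w))))"

text \<open>
  The Lie algebra structure of the fiber over \<open>x\<close> is transported along a bundle chart at \<open>x\<close>; the
  choice of the chart does not matter because transition maps are automorphisms.
\<close>

definition triv :: "('m, 'e, 'k, 'f, 'l) lie_bundle_data \<Rightarrow> 'm \<Rightarrow> 'l \<Rightarrow> 'f" where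
  "triv L x = (SOME \<psi>. \<exists>U. (U, \<psi>) \<in> bcharts L \<and> x \<in> U)"

definition untriv :: "('m, 'e, 'k, 'f, 'l) lie_bundle_data \<Rightarrow> 'm \<Rightarrow> 'f \<Rightarrow> 'l" where
  "untriv L x = inv_into (fib L x) (triv L x)"

definition fadd :: "('m, 'e, 'k, 'f::ab_group_add, 'l) lie_bundle_data \<Rightarrow> 'm \<Rightarrow> 'l \<Rightarrow> 'l \<Rightarrow> 'l" where
  "fadd L x p q = untriv L x (triv L x p + triv L x q)"

definition fsum :: "('m, 'e, 'k, 'f::ab_group_add, 'l) lie_bundle_data \<Rightarrow> 'm \<Rightarrow>
    ('i \<Rightarrow> 'l) \<Rightarrow> 'i set \<Rightarrow> 'l" where
  "fsum L x p I = untriv L x (\<Sum>i\<in>I. triv L x (p i))"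

definition fscl :: "('m, 'e, 'k, 'f, 'l) lie_bundle_data \<Rightarrow> 'm \<Rightarrow> 'k \<Rightarrow> 'l \<Rightarrow> 'l" where
  "fscl L x c p = untriv L x (scl (fiber L) c (triv L x p))"

definition fbrk :: "('m, 'e, 'k, 'f, 'l) lie_bundle_data \<Rightarrow> 'm \<Rightarrow> 'l \<Rightarrow> 'l \<Rightarrow> 'l" where
  "fbrk L x p q = untriv L x (brk (fiber L) (triv L x p) (triv L x q))"

definition sections :: "('m, 'e::real_inner, 'k::{real_normed_field,euclidean_space},
    'f::ab_group_add, 'l) lie_bundle_data \<Rightarrow> ('m \<Rightarrow> 'l) set" where
  "sections L = {A. (\<forall>x. A x \<in> fib L x) \<and>
     (\<forall>(U, \<psi>)\<in>bcharts L. smooth_fib_on L U (\<lambda>x. \<psi> (A x)))}"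

text \<open>Pointwise operations on sections; the scalar is a function on the base.\<close>

definition sadd :: "('m, 'e, 'k, 'f::ab_group_add, 'l) lie_bundle_data \<Rightarrow>
    ('m \<Rightarrow> 'l) \<Rightarrow> ('m \<Rightarrow> 'l) \<Rightarrow> 'm \<Rightarrow> 'l" where
  "sadd L A B = (\<lambda>x. fadd L x (A x) (B x))"

definition sscl :: "('m, 'e, 'k, 'f, 'l) lie_bundle_data \<Rightarrow>
    ('m \<Rightarrow> 'k) \<Rightarrow> ('m \<Rightarrow> 'l) \<Rightarrow> 'm \<Rightarrow> 'l" where
  "sscl L a A = (\<lambda>x. fscl L x (a x) (A x))"

definition sbrk :: "('m, 'e, 'k, 'f, 'l) lie_bundle_data \<Rightarrow>
    ('m \<Rightarrow> 'l) \<Rightarrow> ('m \<Rightarrow> 'l) \<Rightarrow> 'm \<Rightarrow> 'l" where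
  "sbrk L A B = (\<lambda>x. fbrk L x (A x) (B x))"

text \<open>\<open>\<bbbK>\<close>-linear endomorphisms of \<open>\<Gamma>(\<bbbL>)\<close>, and derivations among them.\<close>

definition linear_op :: "('m, 'e::real_inner, 'k::{real_normed_field,euclidean_space},
    'f::ab_group_add, 'l) lie_bundle_data \<Rightarrow> (('m \<Rightarrow> 'l) \<Rightarrow> 'm \<Rightarrow> 'l) \<Rightarrow> bool" where
  "linear_op L D \<longleftrightarrow>
     (\<forall>A\<in>sections L. D A \<in> sections L) \<and>
     (\<forall>A\<in>sections L. \<forall>B\<in>sections L. D (sadd L A B) = sadd L (D A) (D B)) \<and>
     (\<forall>c. \<forall>A\<in>sections L. D (sscl L (\<lambda>_. c) A) = sscl L (\<lambda>_. c) (D A))"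

definition derivation_op :: "('m, 'e::real_inner, 'k::{real_normed_field,euclidean_space},
    'f::ab_group_add, 'l) lie_bundle_data \<Rightarrow> (('m \<Rightarrow> 'l) \<Rightarrow> 'm \<Rightarrow> 'l) \<Rightarrow> bool" where
  "derivation_op L D \<longleftrightarrow> linear_op L D \<and>
     (\<forall>A\<in>sections L. \<forall>B\<in>sections L.
        D (sbrk L A B) = sadd L (sbrk L (D A) B) (sbrk L A (D B)))"


subsection \<open>The bundles \<open>Der(\<bbbL>)\<close>, \<open>Cent(\<bbbL>)\<close> and \<open>TM \<otimes> Cent(\<bbbL>)\<close>\<close>

definition End_fib :: "('m, 'e, 'k, 'f::ab_group_add, 'l) lie_bundle_data \<Rightarrow> 'm \<Rightarrow> ('l \<Rightarrow> 'l) set" where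
  "End_fib L x = {f \<in> fib L x \<rightarrow>\<^sub>E fib L x.
     (\<forall>p\<in>fib L x. \<forall>q\<in>fib L x. f (fadd L x p q) = fadd L x (f p) (f q)) \<and>
     (\<forall>c. \<forall>p\<in>fib L x. f (fscl L x c p) = fscl L x c (f p))}"

definition Der_fib :: "('m, 'e, 'k, 'f::ab_group_add, 'l) lie_bundle_data \<Rightarrow> 'm \<Rightarrow> ('l \<Rightarrow> 'l) set" where
  "Der_fib L x = {f \<in> End_fib L x. \<forall>p\<in>fib L x. \<forall>q\<in>fib L x.
     f (fbrk L x p q) = fadd L x (fbrk L x (f p) q) (fbrk L x p (f q))}"

definition Cent_fib :: "('m, 'e, 'k, 'f::ab_group_add, 'l) lie_bundle_data \<Rightarrow> 'm \<Rightarrow> ('l \<Rightarrow> 'l) set" where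
  "Cent_fib L x = {f \<in> End_fib L x. \<forall>p\<in>fib L x. \<forall>q\<in>fib L x.
     f (fbrk L x p q) = fbrk L x p (f q)}"

text \<open>Smooth sections of \<open>Hom(\<bbbL>, \<bbbL>)\<close> over \<open>W\<close>: in bundle charts, the matrix entries are smooth.\<close>

definition hom_sections_on :: "('m, 'e::real_inner, 'k::{real_normed_field,euclidean_space},
    'f::ab_group_add, 'l) lie_bundle_data \<Rightarrow> 'm set \<Rightarrow> ('m \<Rightarrow> 'l \<Rightarrow> 'l) set" where
  "hom_sections_on L W = {S. (\<forall>x\<in>W. S x \<in> End_fib L x) \<and>
     (\<forall>(U, \<psi>)\<in>bcharts L. \<forall>w. smooth_fib_on L (U \<inter> W) (\<lambda>x. \<psi> (S x (inv_into (fib L x) \<psi> w))))}"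

definition Der_sections :: "('m, 'e::real_inner, 'k::{real_normed_field,euclidean_space},
    'f::ab_group_add, 'l) lie_bundle_data \<Rightarrow> ('m \<Rightarrow> 'l \<Rightarrow> 'l) set" where
  "Der_sections L = {S \<in> hom_sections_on L UNIV. \<forall>x. S x \<in> Der_fib L x}"

definition Cent_sections_on :: "('m, 'e::real_inner, 'k::{real_normed_field,euclidean_space},
    'f::ab_group_add, 'l) lie_bundle_data \<Rightarrow> 'm set \<Rightarrow> ('m \<Rightarrow> 'l \<Rightarrow> 'l) set" where
  "Cent_sections_on L W = {S \<in> hom_sections_on L W. \<forall>x\<in>W. S x \<in> Cent_fib L x}"

definition iop :: "('m \<Rightarrow> 'l \<Rightarrow> 'l) \<Rightarrow> ('m \<Rightarrow> 'l) \<Rightarrow> 'm \<Rightarrow> 'l" where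
  "iop D0 A = (\<lambda>x. D0 x (A x))"

text \<open>
  The real tensor product of \<open>V = T\<^sub>xM\<close> and \<open>C = Cent(\<bbbL>\<^sub>x)\<close>: the elementary tensor \<open>v \<otimes> S\<close> is evaluation at
  \<open>(v, S)\<close> on the real bilinear forms on \<open>V \<times> C\<close>, and the tensor product is the span of the
  elementary tensors.  This is the algebraic tensor product because bilinear forms separate tensors.
  Tensors are extended by \<open>0\<close> to maps that are not bilinear on \<open>V \<times> C\<close>.
\<close>

type_synonym ('m, 'l) form = "'m tvec \<Rightarrow> ('l \<Rightarrow> 'l) \<Rightarrow> real"

definition bilinear_form :: "('m, 'e::real_inner, 'k::{real_normed_field,euclidean_space},
    'f::ab_group_add, 'l) lie_bundle_data \<Rightarrow> 'm \<Rightarrow> ('m, 'l) form \<Rightarrow> bool" where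
  "bilinear_form L x \<beta> \<longleftrightarrow>
     (\<forall>v\<in>tangent_space (base L) x. \<forall>w\<in>tangent_space (base L) x. \<forall>S\<in>Cent_fib L x.
        \<beta> (\<lambda>f. v f + w f) S = \<beta> v S + \<beta> w S) \<and>
     (\<forall>r. \<forall>v\<in>tangent_space (base L) x. \<forall>S\<in>Cent_fib L x.
        \<beta> (\<lambda>f. r * v f) S = r * \<beta> v S) \<and>
     (\<forall>v\<in>tangent_space (base L) x. \<forall>S\<in>Cent_fib L x. \<forall>S'\<in>Cent_fib L x.
        \<beta> v (\<lambda>p\<in>fib L x. fadd L x (S p) (S' p)) = \<beta> v S + \<beta> v S') \<and>
     (\<forall>r. \<forall>v\<in>tangent_space (base L) x. \<forall>S\<in>Cent_fib L x.
        \<beta> v (\<lambda>p\<in>fib L x. fscl L x (of_real r) (S p)) = r * \<beta> v S)"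

definition tens :: "('m, 'e::real_inner, 'k::{real_normed_field,euclidean_space},
    'f::ab_group_add, 'l) lie_bundle_data \<Rightarrow> 'm \<Rightarrow> 'm tvec \<Rightarrow> ('l \<Rightarrow> 'l) \<Rightarrow> ('m, 'l) form \<Rightarrow> real" where
  "tens L x v S = (\<lambda>\<beta>. if bilinear_form L x \<beta> then \<beta> v S else 0)"

definition tensor_fib :: "('m, 'e::real_inner, 'k::{real_normed_field,euclidean_space},
    'f::ab_group_add, 'l) lie_bundle_data \<Rightarrow> 'm \<Rightarrow> (('m, 'l) form \<Rightarrow> real) set" where
  "tensor_fib L x = {t. \<exists>(n::nat) v S.
     (\<forall>i<n. v i \<in> tangent_space (base L) x \<and> S i \<in> Cent_fib L x) \<and>
     t = (\<lambda>\<beta>. \<Sum>i<n. tens L x (v i) (S i) \<beta>)}"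

text \<open>\<open>Y|\<^sub>U = \<Sum>\<^sub>e \<partial>\<^sub>e \<otimes> S\<^sup>e\<close> with smooth sections \<open>S\<^sup>e\<close> of \<open>Cent(\<bbbL>)\<close> over \<open>U\<close>.\<close>

definition local_components :: "('m, 'e::real_inner, 'k::{real_normed_field,euclidean_space},
    'f::ab_group_add, 'l) lie_bundle_data \<Rightarrow> 'm set \<Rightarrow> ('m \<Rightarrow> 'e) \<Rightarrow>
    ('m \<Rightarrow> ('m, 'l) form \<Rightarrow> real) \<Rightarrow> ('e \<Rightarrow> 'm \<Rightarrow> 'l \<Rightarrow> 'l) \<Rightarrow> bool" where
  "local_components L U \<xi> Y S \<longleftrightarrow>
     (\<forall>e\<in>frame (base L). S e \<in> Cent_sections_on L U) \<and>
     (\<forall>x\<in>U. Y x = (\<lambda>\<beta>. \<Sum>e\<in>frame (base L). tens L x (coord_field (base L) U \<xi> e x) (S e x) \<beta>))"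

definition tensor_sections :: "('m, 'e::real_inner, 'k::{real_normed_field,euclidean_space},
    'f::ab_group_add, 'l) lie_bundle_data \<Rightarrow> ('m \<Rightarrow> ('m, 'l) form \<Rightarrow> real) set" where
  "tensor_sections L = {Y. (\<forall>x. Y x \<in> tensor_fib L x) \<and>
     (\<forall>(U, \<xi>)\<in>charts (base L). \<exists>S. local_components L U \<xi> Y S)}"


subsection \<open>Lie connections\<close>

definition covariant_derivative :: "('m, 'e::real_inner, 'k::{real_normed_field,euclidean_space},
    'f::ab_group_add, 'l) lie_bundle_data \<Rightarrow>
    (('m \<Rightarrow> 'm tvec) \<Rightarrow> ('m \<Rightarrow> 'l) \<Rightarrow> 'm \<Rightarrow> 'l) \<Rightarrow> bool" where
  "covariant_derivative L nabla \<longleftrightarrow>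
     (\<forall>X\<in>vector_fields (base L). linear_op L (nabla X)) \<and>
     (\<forall>X\<in>vector_fields (base L). \<forall>A\<in>sections L. \<forall>a. smooth_fun_on (base L) UNIV a \<longrightarrow>
        nabla X (sscl L a A) = sadd L (sscl L (vf_act X a) A) (sscl L a (nabla X A))) \<and>
     (\<forall>X\<in>vector_fields (base L). \<forall>Y\<in>vector_fields (base L). \<forall>A\<in>sections L. \<forall>a b.
        smooth_fun_on (base L) UNIV a \<longrightarrow> smooth_fun_on (base L) UNIV b \<longrightarrow>
        nabla (\<lambda>x f. a x * X x f + b x * Y x f) A =
          sadd L (sscl L (\<lambda>x. of_real (a x)) (nabla X A)) (sscl L (\<lambda>x. of_real (b x)) (nabla Y A)))"

definition lie_connection :: "('m, 'e::real_inner, 'k::{real_normed_field,euclidean_space},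
    'f::ab_group_add, 'l) lie_bundle_data \<Rightarrow>
    (('m \<Rightarrow> 'm tvec) \<Rightarrow> ('m \<Rightarrow> 'l) \<Rightarrow> 'm \<Rightarrow> 'l) \<Rightarrow> bool" where
  "lie_connection L nabla \<longleftrightarrow> covariant_derivative L nabla \<and>
     (\<forall>X\<in>vector_fields (base L). \<forall>A\<in>sections L. \<forall>B\<in>sections L.
        nabla X (sbrk L A B) = sadd L (sbrk L (nabla X A) B) (sbrk L A (nabla X B)))"

text \<open>
  Covariant derivative at \<open>x\<close> along a vector field \<open>X\<close> that is only given near \<open>x\<close> (such as a
  coordinate vector field): replace \<open>X\<close> by a global vector field that agrees with it near \<open>x\<close>.
\<close>

definition local_nabla :: "('m::topological_space, 'e::real_inner, 'k, 'f, 'l) lie_bundle_data \<Rightarrow>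
    (('m \<Rightarrow> 'm tvec) \<Rightarrow> ('m \<Rightarrow> 'l) \<Rightarrow> 'm \<Rightarrow> 'l) \<Rightarrow>
    ('m \<Rightarrow> 'm tvec) \<Rightarrow> ('m \<Rightarrow> 'l) \<Rightarrow> 'm \<Rightarrow> 'l" where
  "local_nabla L nabla X A x =
     nabla (SOME X'. X' \<in> vector_fields (base L) \<and> (\<forall>\<^sub>F y in nhds x. X' y = X y)) A x"

text \<open>The extension of \<open>\<nabla>\<close> to \<open>\<Gamma>(TM \<otimes> Cent(\<bbbL>))\<close>; the value is independent of the chart \<open>(U, \<xi>)\<close>.\<close>

definition nabla_ext :: "('m::topological_space, 'e::real_inner,
    'k::{real_normed_field,euclidean_space}, 'f::ab_group_add, 'l) lie_bundle_data \<Rightarrow>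
    (('m \<Rightarrow> 'm tvec) \<Rightarrow> ('m \<Rightarrow> 'l) \<Rightarrow> 'm \<Rightarrow> 'l) \<Rightarrow>
    ('m \<Rightarrow> ('m, 'l) form \<Rightarrow> real) \<Rightarrow> ('m \<Rightarrow> 'l) \<Rightarrow> 'm \<Rightarrow> 'l" where
  "nabla_ext L nabla Y A x = (THE p. \<exists>U \<xi> S. (U, \<xi>) \<in> charts (base L) \<and> x \<in> U \<and>
     local_components L U \<xi> Y S \<and>
     p = fsum L x (\<lambda>e. S e x (local_nabla L nabla (coord_field (base L) U \<xi> e) A x))
           (frame (base L)))"

end

theory Submission
  imports Defs
begin

text \<open>
  For a derivation \<open>D\<close> of \<open>\<Gamma>(\<bbbL>)\<close> and a smooth function \<open>a\<close>, the commutator \<open>\<delta>\<^sub>a = [D, a]\<close> lies in the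
  centroid of \<open>\<Gamma>(\<bbbL>)\<close>.  Elements of the centroid are linear over smooth functions, hence sections
  of \<open>Cent(\<bbbL>)\<close>: if \<open>\<kk>\<close> is centerfree this is immediate, and if \<open>\<kk>\<close> is perfect it holds on brackets,
  hence everywhere, because \<open>\<Gamma>(\<bbbL>)\<close> is then perfect.  The latter is the hard point: every section
  must be a finite sum of brackets although \<open>M\<close> need not be compact, so \<open>M\<close> has to be covered by
  finitely many open sets over which \<open>\<bbbL>\<close> is trivial; this uses that \<open>M\<close> has finite covering
  dimension.  Now \<open>a \<mapsto> \<delta>\<^sub>a\<close> is a derivation, so by Hadamard's lemma \<open>\<delta>\<^sub>a = \<Sum>\<^sub>j (\<partial>\<^sub>j a) S\<^sup>j\<close> where \<open>S\<^sup>j\<close> is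
  \<open>\<delta>\<close> of the \<open>j\<close>-th coordinate.  The \<open>S\<^sup>j\<close> are the components of \<open>\<Y>\<close>, and \<open>D - \<nabla>\<^sub>\<Y>\<close> commutes with all
  functions, so it is a section of \<open>Der(\<bbbL>)\<close>.  Conversely \<open>D = \<nabla>\<^sub>\<Y> + i(D\<^sub>0)\<close> forces these values of
  the \<open>S\<^sup>j\<close>, which gives uniqueness.
\<close>

section \<open>Calculus of smooth functions\<close>

text \<open>The Leibniz rule for \<open>a \<mapsto> delta D a\<close> needs each
  \<open>delta D a\<close> to be linear over functions, and so does the fact that its value at a
  point depends on the section at that point only; this is where perfect or centerfree enters.
  Hadamard's lemma is applied once, to tangent vectors taken as point derivations: for fixed
  \<open>A\<close> and \<open>x\<close>, every real component of a linear functional of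
  \<open>delta D f A x\<close> is a point derivation in the real function \<open>f\<close>, so the
  expansion of tangent vectors in coordinate fields carries over to \<open>delta\<close>. With an
  ordinary partition of unity a section might become an infinite sum of brackets. Over a disjoint
  union of small pieces, however, one bracket serves all pieces at once, so only the number of
  colours counts: 2^m for the parities of grid cells in dimension m, times 4 for the residues of
  layers.\<close>

lemma Ck_on_SucD: "Ck_on (Suc n) S f \<Longrightarrow> Ck_on n S f"
proof (induction n arbitrary: f)
  case 0
  then show ?case
    by (auto intro!: continuous_at_imp_continuous_on differentiable_imp_continuous_within)
next
  case (Suc n)
  from Suc.prems have "\<forall>x\<in>S. f differentiable (at x)"
    and "\<forall>v. Ck_on (Suc n) S (\<lambda>x. frechet_derivative f (at x) v)"
    using Ck_on.simps(2)[of "Suc n" S f] by blast+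
  then show ?case using Suc.IH Ck_on.simps(2)[of n S f] by blast
qed

lemma Ck_on_subset: "Ck_on n S f \<Longrightarrow> T \<subseteq> S \<Longrightarrow> Ck_on n T f"
  by (induction n arbitrary: f) (auto intro: continuous_on_subset)

text \<open>Derivatives at a point of \<open>S\<close> only see a neighbourhood of that point, so
  openness of \<open>S\<close> lets agreement on \<open>S\<close> pass to all derivatives.\<close>

lemma Ck_on_cong:
  assumes "open S" "\<And>x. x \<in> S \<Longrightarrow> f x = g x" "Ck_on n S f"
  shows "Ck_on n S g"
  using assms(2,3)
proof (induction n arbitrary: f g)
  case 0
  have "continuous_on S f \<longleftrightarrow> continuous_on S g"
    by (rule continuous_on_cong[OF refl]) (rule 0(1))
  with 0(2) show ?case by (simp only: Ck_on.simps)
next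
  case (Suc n)
  have d: "(g has_derivative frechet_derivative f (at x)) (at x)" if "x \<in> S" for x
  proof (rule has_derivative_transform_within_open)
    show "(f has_derivative frechet_derivative f (at x)) (at x)"
      using Suc.prems(2) that by (simp add: frechet_derivative_works)
  qed (use assms(1) that Suc.prems(1) in blast)+
  then have "frechet_derivative g (at x) = frechet_derivative f (at x)" if "x \<in> S" for x
    using that frechet_derivative_at by metis
  moreover have "Ck_on n S (\<lambda>x. frechet_derivative f (at x) v)" for v
    using Suc.prems by simp
  ultimately have "Ck_on n S (\<lambda>x. frechet_derivative g (at x) v)" for v
    using Suc.IH[of "\<lambda>x. frechet_derivative f (at x) v" "\<lambda>x. frechet_derivative g (at x) v"] by simp
  then show ?case using d by (auto simp: differentiable_def)
qed

text \<open>Frees later smoothness proofs from \<open>frechet_derivative\<close>: on an open set any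
  explicit derivative may take its place.\<close>

lemma Ck_on_SucI:
  assumes "open S" "\<And>x. x \<in> S \<Longrightarrow> (f has_derivative f' x) (at x)"
    and "\<And>v. Ck_on n S (\<lambda>x. f' x v)"
  shows "Ck_on (Suc n) S f"
proof -
  have "frechet_derivative f (at x) = f' x" if "x \<in> S" for x
    using assms(2)[OF that] frechet_derivative_at by metis
  then have "Ck_on n S (\<lambda>x. frechet_derivative f (at x) v)" for v
    using Ck_on_cong[OF assms(1), of "\<lambda>x. f' x v"] assms(3) by simp
  then show ?thesis using assms(2) by (auto simp: differentiable_def)
qed

lemma Ck_on_SucE:
  assumes "Ck_on (Suc n) S f"
  obtains f' where "\<And>x. x \<in> S \<Longrightarrow> (f has_derivative f' x) (at x)"
    and "\<And>v. Ck_on n S (\<lambda>x. f' x v)"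
  using assms that[of "\<lambda>x. frechet_derivative f (at x)"] by (auto simp: frechet_derivative_works)

lemma Ck_on_UN:
  assumes "\<And>i. i \<in> I \<Longrightarrow> open (S i)" "\<And>i. i \<in> I \<Longrightarrow> Ck_on n (S i) f"
  shows "Ck_on n (\<Union>i\<in>I. S i) f"
  using assms(2)
proof (induction n arbitrary: f)
  case 0
  then show ?case using assms(1) by (auto intro: continuous_on_open_UN)
qed auto

lemma Ck_on_const: "Ck_on n S (\<lambda>_. c)"
  by (induction n arbitrary: c) auto

lemma Ck_on_bounded_linear_comp:
  assumes "bounded_linear h" "open S" "Ck_on n S f"
  shows "Ck_on n S (\<lambda>x. h (f x))"
  using assms(3)
proof (induction n arbitrary: f)
  case 0
  then show ?case using assms(1) by (auto intro: bounded_linear.continuous_on)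
next
  case (Suc n)
  from Suc.prems obtain f' where f': "\<And>x. x \<in> S \<Longrightarrow> (f has_derivative f' x) (at x)"
    "\<And>v. Ck_on n S (\<lambda>x. f' x v)" by (rule Ck_on_SucE) blast
  show ?case
    using assms(2) bounded_linear.has_derivative[OF assms(1) f'(1)] Suc.IH[OF f'(2)]
    by (rule Ck_on_SucI)
qed

lemma Ck_on_id: "open S \<Longrightarrow> Ck_on n S (\<lambda>x. x)"
proof (cases n)
  case (Suc k)
  assume "open S"
  then show ?thesis unfolding Suc
    by (rule Ck_on_SucI[where f' = "\<lambda>x v. v"]) (auto simp: Ck_on_const)
qed auto

lemma Ck_on_add:
  assumes "open S" "Ck_on n S f" "Ck_on n S g"
  shows "Ck_on n S (\<lambda>x. f x + g x)"
  using assms(2,3)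
proof (induction n arbitrary: f g)
  case 0
  then show ?case by (auto intro: continuous_intros)
next
  case (Suc n)
  from Suc.prems(1) obtain f' where f': "\<And>x. x \<in> S \<Longrightarrow> (f has_derivative f' x) (at x)"
    "\<And>v. Ck_on n S (\<lambda>x. f' x v)" by (rule Ck_on_SucE) blast
  from Suc.prems(2) obtain g' where g': "\<And>x. x \<in> S \<Longrightarrow> (g has_derivative g' x) (at x)"
    "\<And>v. Ck_on n S (\<lambda>x. g' x v)" by (rule Ck_on_SucE) blast
  show ?case
    using assms(1) has_derivative_add[OF f'(1) g'(1)] Suc.IH[OF f'(2) g'(2)]
    by (rule Ck_on_SucI)
qed

lemma Ck_on_bilinear:
  assumes "bounded_bilinear h" "open S" "Ck_on n S f" "Ck_on n S g"
  shows "Ck_on n S (\<lambda>x. h (f x) (g x))"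
  using assms(3,4)
proof (induction n arbitrary: f g)
  case 0
  then show ?case using assms(1) by (auto intro: bounded_bilinear.continuous_on)
next
  case (Suc n)
  from Suc.prems(1) obtain f' where f': "\<And>x. x \<in> S \<Longrightarrow> (f has_derivative f' x) (at x)"
    "\<And>v. Ck_on n S (\<lambda>x. f' x v)" by (rule Ck_on_SucE) blast
  from Suc.prems(2) obtain g' where g': "\<And>x. x \<in> S \<Longrightarrow> (g has_derivative g' x) (at x)"
    "\<And>v. Ck_on n S (\<lambda>x. g' x v)" by (rule Ck_on_SucE) blast
  show ?case
    using assms(2) bounded_bilinear.FDERIV[OF assms(1) f'(1) g'(1)]
  proof (rule Ck_on_SucI)
    show "Ck_on n S (\<lambda>x. h (f x) (g' x v) + h (f' x v) (g x))" for v
      using Suc.prems[THEN Ck_on_SucD] f'(2) g'(2) by (intro Ck_on_add assms(2) Suc.IH)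
  qed
qed

lemma Ck_on_sum:
  assumes "open S" "\<And>i. i \<in> I \<Longrightarrow> Ck_on n S (f i)"
  shows "Ck_on n S (\<lambda>x. \<Sum>i\<in>I. f i x)"
  using assms(2)
  by (induction I rule: infinite_finite_induct)
    (auto simp: Ck_on_const intro: Ck_on_add[OF assms(1)])

text \<open>Plays the part of \<open>Basis\<close> in the model space, which is not of class
  \<open>euclidean_space\<close>.\<close>

definition orthonormal_frame :: "'a::real_inner set \<Rightarrow> bool" where
  "orthonormal_frame E \<longleftrightarrow> finite E \<and> span E = UNIV \<and>
     (\<forall>e\<in>E. \<forall>e'\<in>E. e \<bullet> e' = (if e = e' then 1 else 0))"

text \<open>The remainder is orthogonal to every frame vector, hence to their span, hence to
  itself.\<close>

lemma orthonormal_frame_expand: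
  assumes "orthonormal_frame E"
  shows "x = (\<Sum>e\<in>E. (x \<bullet> e) *\<^sub>R e)"
proof -
  define y where "y = x - (\<Sum>e\<in>E. (x \<bullet> e) *\<^sub>R e)"
  have fin: "finite E" using assms by (simp add: orthonormal_frame_def)
  have "orthogonal y e" if "e \<in> E" for e
  proof -
    have "(\<Sum>e'\<in>E. (x \<bullet> e') *\<^sub>R e') \<bullet> e = (\<Sum>e'\<in>E. if e' = e then x \<bullet> e' else 0)"
      unfolding inner_sum_left using that assms
      by (intro sum.cong) (auto simp: orthonormal_frame_def)
    also have "\<dots> = x \<bullet> e" using that fin by simp
    finally show ?thesis by (simp add: y_def orthogonal_def inner_diff_left)
  qed
  moreover have "y \<in> span E" using assms by (simp add: orthonormal_frame_def)
  ultimately have "orthogonal y y" using orthogonal_to_span by blast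
  then show ?thesis by (simp add: y_def orthogonal_self)
qed

lemma linear_frame_expand:
  assumes "orthonormal_frame E" "linear f"
  shows "f x = (\<Sum>e\<in>E. (x \<bullet> e) *\<^sub>R f e)"
proof -
  have "f x = f (\<Sum>e\<in>E. (x \<bullet> e) *\<^sub>R e)"
    using orthonormal_frame_expand[OF assms(1), of x] by simp
  also have "\<dots> = (\<Sum>e\<in>E. (x \<bullet> e) *\<^sub>R f e)"
    using assms(2) by (simp add: linear_sum linear_scale)
  finally show ?thesis .
qed

text \<open>The chain rule gives the derivative \<open>f' (g x) (g' x v)\<close>, in which
  \<open>f'\<close> acts on a moving vector, while \<open>Ck_on\<close> controls \<open>f'\<close>
  in fixed directions only. Expanding the moving vector in the frame leaves the functions
  \<open>\<lambda>z. f' z e\<close>, to which the induction hypothesis applies.\<close>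

lemma Ck_on_compose:
  fixes E :: "'b::real_inner set" and f :: "'b::real_inner \<Rightarrow> 'c::real_normed_vector"
  assumes "orthonormal_frame E" "open S" "open T" "g ` S \<subseteq> T" "Ck_on n S g" "Ck_on n T f"
  shows "Ck_on n S (\<lambda>x. f (g x))"
  using assms(5,6)
proof (induction n arbitrary: f)
  case 0
  then show ?case using assms(4) by (auto intro: continuous_on_compose2)
next
  case (Suc n)
  from Suc.prems(1) obtain g' where g': "\<And>x. x \<in> S \<Longrightarrow> (g has_derivative g' x) (at x)"
    "\<And>v. Ck_on n S (\<lambda>x. g' x v)" by (rule Ck_on_SucE) blast
  from Suc.prems(2) obtain f' where f': "\<And>x. x \<in> T \<Longrightarrow> (f has_derivative f' x) (at x)"
    "\<And>v. Ck_on n T (\<lambda>x. f' x v)" by (rule Ck_on_SucE) blast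
  have "((\<lambda>x. f (g x)) has_derivative (\<lambda>v. \<Sum>e\<in>E. (g' x v \<bullet> e) *\<^sub>R f' (g x) e)) (at x)"
    if x: "x \<in> S" for x
  proof -
    have T: "g x \<in> T" using x assms(4) by blast
    have "linear (f' (g x))" using f'(1)[OF T] has_derivative_linear by blast
    then have "f' (g x) (g' x v) = (\<Sum>e\<in>E. (g' x v \<bullet> e) *\<^sub>R f' (g x) e)" for v
      using linear_frame_expand[OF assms(1)] by blast
    moreover have "((\<lambda>x. f (g x)) has_derivative (\<lambda>v. f' (g x) (g' x v))) (at x)"
      using has_derivative_compose[OF g'(1)[OF x], of f "f' (g x)"] f'(1)[OF T] by simp
    ultimately show ?thesis by simp
  qed
  with assms(2) show ?case
  proof (rule Ck_on_SucI)
    fix v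
    have "Ck_on n S g" using Suc.prems Ck_on_SucD by blast
    then have "Ck_on n S (\<lambda>x. f' (g x) e)" for e
      using Suc.IH f'(2) by blast
    moreover have "Ck_on n S (\<lambda>x. g' x v \<bullet> e)" for e
      using Ck_on_bounded_linear_comp[OF bounded_linear_inner_left assms(2) g'(2)] by blast
    ultimately show "Ck_on n S (\<lambda>x. \<Sum>e\<in>E. (g' x v \<bullet> e) *\<^sub>R f' (g x) e)"
      by (intro Ck_on_sum Ck_on_bilinear[OF bounded_bilinear_scaleR] assms(2))
  qed
qed

lemma Ck_on_inverse: "Ck_on n {x::real. x \<noteq> 0} inverse"
proof (induction n)
  case 0
  then show ?case by (auto intro!: continuous_intros)
next
  case (Suc n)
  have op: "open {x::real. x \<noteq> 0}"
    by (simp add: open_Collect_neq)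
  have "(inverse has_derivative (\<lambda>v. - v * (inverse x * inverse x))) (at x)"
    if "x \<in> {x::real. x \<noteq> 0}" for x
    using that has_derivative_inverse'[of x UNIV] by (simp add: mult_ac)
  with op show ?case
  proof (rule Ck_on_SucI)
    show "Ck_on n {x. x \<noteq> 0} (\<lambda>x. - v * (inverse x * inverse x))" for v :: real
      by (intro Ck_on_bilinear[OF bounded_bilinear_mult op] Ck_on_const Suc.IH)
  qed
qed


text \<open>Smoothness of the germ at a point: closure properties become pointwise statements, and
  no common domain has to be carried through them.\<close>

definition smooth_near :: "('a::real_normed_vector \<Rightarrow> 'b::real_normed_vector) \<Rightarrow> 'a \<Rightarrow> bool" where
  "smooth_near f x \<longleftrightarrow> (\<exists>S. open S \<and> x \<in> S \<and> smooth_on S f)"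

lemma smooth_on_iff_smooth_near:
  assumes "open S"
  shows "smooth_on S f \<longleftrightarrow> (\<forall>x\<in>S. smooth_near f x)"
proof
  assume "\<forall>x\<in>S. smooth_near f x"
  then obtain N where N: "\<And>x. x \<in> S \<Longrightarrow> open (N x) \<and> x \<in> N x \<and> smooth_on (N x) f"
    unfolding smooth_near_def by metis
  then have "Ck_on n (\<Union>x\<in>S. N x) f" for n
    by (intro Ck_on_UN) (auto simp: smooth_on_def)
  moreover have "S \<subseteq> (\<Union>x\<in>S. N x)" using N by auto
  ultimately show "smooth_on S f" unfolding smooth_on_def using Ck_on_subset by blast
qed (use assms in \<open>auto simp: smooth_near_def\<close>)

lemma smooth_near_cong:
  assumes "smooth_near f x" "open S" "x \<in> S" "\<And>y. y \<in> S \<Longrightarrow> f y = g y"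
  shows "smooth_near g x"
proof -
  from assms(1) obtain T where "open T" "x \<in> T" "smooth_on T f" by (auto simp: smooth_near_def)
  then have "smooth_on (T \<inter> S) g"
    using Ck_on_cong[of "T \<inter> S" f g] Ck_on_subset[of _ T f "T \<inter> S"] assms
    by (auto simp: smooth_on_def)
  then show ?thesis using \<open>open T\<close> \<open>x \<in> T\<close> assms unfolding smooth_near_def by blast
qed

lemma smooth_near_common:
  assumes "smooth_near f x" "smooth_near g x"
  obtains S where "open S" "x \<in> S" "smooth_on S f" "smooth_on S g"
proof -
  from assms obtain S T where "open S" "x \<in> S" "smooth_on S f" "open T" "x \<in> T" "smooth_on T g"
    by (auto simp: smooth_near_def)
  then show ?thesis
    using that[of "S \<inter> T"] Ck_on_subset[of _ S f "S \<inter> T"] Ck_on_subset[of _ T g "S \<inter> T"]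
    by (simp add: smooth_on_def open_Int)
qed

lemma smooth_near_const: "smooth_near (\<lambda>_. c) x"
  unfolding smooth_near_def smooth_on_def using Ck_on_const by blast

lemma smooth_near_id: "smooth_near (\<lambda>x. x) x"
  unfolding smooth_near_def smooth_on_def using Ck_on_id[OF open_UNIV] by blast

lemma smooth_near_bounded_linear:
  assumes "bounded_linear h" "smooth_near f x"
  shows "smooth_near (\<lambda>x. h (f x)) x"
  using assms Ck_on_bounded_linear_comp unfolding smooth_near_def smooth_on_def by blast

lemma smooth_near_bilinear:
  assumes "bounded_bilinear h" "smooth_near f x" "smooth_near g x"
  shows "smooth_near (\<lambda>x. h (f x) (g x)) x"
proof -
  from assms(2,3) obtain S where "open S" "x \<in> S" "smooth_on S f" "smooth_on S g"
    by (rule smooth_near_common)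
  then show ?thesis unfolding smooth_near_def smooth_on_def
    by (intro exI[of _ S] conjI allI Ck_on_bilinear[OF assms(1)]) auto
qed

lemma smooth_near_add:
  assumes "smooth_near f x" "smooth_near g x"
  shows "smooth_near (\<lambda>x. f x + g x) x"
proof -
  from assms obtain S where "open S" "x \<in> S" "smooth_on S f" "smooth_on S g"
    by (rule smooth_near_common)
  then show ?thesis unfolding smooth_near_def smooth_on_def
    by (intro exI[of _ S] conjI allI Ck_on_add) auto
qed

lemma smooth_near_imp_differentiable: "smooth_near f x \<Longrightarrow> f differentiable (at x)"
  unfolding smooth_near_def smooth_on_def using Ck_on.simps(2) by blast

lemma smooth_near_derivative:
  "smooth_near f x \<Longrightarrow> smooth_near (\<lambda>y. frechet_derivative f (at y) v) x"
  unfolding smooth_near_def smooth_on_def using Ck_on.simps(2) by blast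

lemma smooth_near_compose:
  fixes E :: "'b::real_inner set" and f :: "'b::real_inner \<Rightarrow> 'c::real_normed_vector"
  assumes "orthonormal_frame E" "smooth_near g x" "smooth_near f (g x)"
  shows "smooth_near (\<lambda>x. f (g x)) x"
proof -
  from assms(2) obtain S where S: "open S" "x \<in> S" "\<And>n. Ck_on n S g"
    by (auto simp: smooth_near_def smooth_on_def)
  from assms(3) obtain T where T: "open T" "g x \<in> T" "\<And>n. Ck_on n T f"
    by (auto simp: smooth_near_def smooth_on_def)
  have "continuous_on S g" using S(3)[of 0] by simp
  then have op: "open (S \<inter> g -` T)" using S(1) T(1) by (simp add: continuous_open_preimage)
  have "Ck_on n (S \<inter> g -` T) (\<lambda>x. f (g x))" for n
  proof (rule Ck_on_compose[OF assms(1) op T(1) _ _ T(3)])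
    show "Ck_on n (S \<inter> g -` T) g" by (rule Ck_on_subset[OF S(3)]) simp
  qed auto
  then show ?thesis unfolding smooth_near_def smooth_on_def
    using op S(2) T(2) by (intro exI[of _ "S \<inter> g -` T"]) simp
qed

lemma orthonormal_frame_one: "orthonormal_frame {1::real}"
  unfolding orthonormal_frame_def by (auto simp: span_singleton image_iff)

lemma smooth_near_inverse:
  fixes g :: "'a::real_normed_vector \<Rightarrow> real"
  assumes "smooth_near g x" "g x \<noteq> 0"
  shows "smooth_near (\<lambda>x. inverse (g x)) x"
proof (rule smooth_near_compose[OF orthonormal_frame_one assms(1), where f = inverse])
  show "smooth_near inverse (g x)"
    unfolding smooth_near_def smooth_on_def using Ck_on_inverse assms(2)
    by (intro exI[of _ "{x. x \<noteq> 0}"]) (auto simp: open_Collect_neq)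
qed


subsection \<open>Bump functions\<close>

text \<open>Bumps are built from \<open>flat_exp 0\<close>. The factor \<open>inverse t ^ k\<close>
  is there because the family is closed under differentiation up to linear combinations, so that one
  induction for all \<open>k\<close> at once gives smoothness.\<close>

definition flat_exp :: "nat \<Rightarrow> real \<Rightarrow> real" where
  "flat_exp k t = (if 0 < t then inverse t ^ k * exp (- inverse t) else 0)"

lemma flat_exp_tendsto: "(flat_exp k \<longlongrightarrow> 0) (at 0)"
proof (rule filterlim_split_at)
  have "((\<lambda>t::real. 0::real) \<longlongrightarrow> 0) (at_left 0)" by simp
  then show "(flat_exp k \<longlongrightarrow> 0) (at_left 0)"
    by (rule filterlim_cong[THEN iffD1, rotated -1])
      (auto simp: flat_exp_def eventually_at_filter)
  have "((\<lambda>t. inverse t ^ k / exp (inverse t)) \<longlongrightarrow> 0) (at_right (0::real))"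
    using filterlim_compose[OF tendsto_power_div_exp_0 filterlim_inverse_at_top_right] .
  then show "(flat_exp k \<longlongrightarrow> 0) (at_right 0)"
    by (rule filterlim_cong[THEN iffD1, rotated -1])
      (auto simp: flat_exp_def eventually_at_filter exp_minus field_simps)
qed

lemma flat_exp_has_derivative:
  "(flat_exp k has_real_derivative (flat_exp (k + 2) t - real k * flat_exp (k + 1) t)) (at t)"
proof (cases t "0::real" rule: linorder_cases)
  case less
  have "((\<lambda>_. 0) has_real_derivative 0) (at t)" by simp
  then have "(flat_exp k has_real_derivative 0) (at t)"
    by (rule DERIV_cong_ev[THEN iffD1, rotated -1, OF _ refl _ refl])
      (use less eventually_nhds_in_open[of "{..<0}" t] in \<open>auto simp: flat_exp_def elim: eventually_mono\<close>)
  then show ?thesis using less by (simp add: flat_exp_def)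
next
  case equal
  \<comment> \<open>The difference quotient of \<open>flat_exp k\<close> at 0 is
    \<open>flat_exp (k + 1)\<close>.\<close>
  have "((\<lambda>h. flat_exp (k + 1) h) \<longlongrightarrow> 0) (at 0)" by (rule flat_exp_tendsto)
  moreover have "(\<lambda>h. flat_exp (k + 1) h) = (\<lambda>h. (flat_exp k (0 + h) - flat_exp k 0) / h)"
    by (auto simp: flat_exp_def field_simps)
  ultimately show ?thesis using equal by (simp add: DERIV_def flat_exp_def)
next
  case greater
  have "((\<lambda>t. inverse t ^ k) has_real_derivative - real k * inverse t ^ (k + 1)) (at t)"
  proof (induction k)
    case (Suc k)
    have "((\<lambda>t. inverse t * inverse t ^ k) has_real_derivative
        - (inverse t ^ Suc (Suc 0)) * inverse t ^ k + (- real k * inverse t ^ (k + 1)) * inverse t) (at t)"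
      using greater by (intro DERIV_mult DERIV_inverse Suc.IH) simp
    then show ?case by (simp add: algebra_simps)
  qed simp
  moreover have "((\<lambda>t. exp (- inverse t)) has_real_derivative exp (- inverse t) * (inverse t * inverse t)) (at t)"
    using greater by (auto intro!: derivative_eq_intros)
  ultimately have "((\<lambda>t. inverse t ^ k * exp (- inverse t)) has_real_derivative
      - real k * inverse t ^ (k + 1) * exp (- inverse t)
      + exp (- inverse t) * (inverse t * inverse t) * inverse t ^ k) (at t)"
    by (rule DERIV_mult)
  then have "((\<lambda>t. inverse t ^ k * exp (- inverse t)) has_real_derivative
      (flat_exp (k + 2) t - real k * flat_exp (k + 1) t)) (at t)"
    using greater by (simp add: flat_exp_def algebra_simps)
  then show ?thesis
    by (rule DERIV_cong_ev[THEN iffD1, rotated -1, OF _ refl _ refl])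
      (use greater eventually_nhds_in_open[of "{0<..}" t] in \<open>auto simp: flat_exp_def elim!: eventually_mono\<close>)
qed

lemma Ck_on_flat_exp: "Ck_on n UNIV (flat_exp k)"
proof (induction n arbitrary: k)
  case 0
  have "isCont (flat_exp k) t" for t
    using flat_exp_has_derivative by (rule DERIV_isCont)
  then have "continuous_on UNIV (flat_exp k)" by (intro continuous_at_imp_continuous_on ballI)
  then show ?case by simp
next
  case (Suc n)
  have "(flat_exp k has_derivative (\<lambda>v. v * (flat_exp (k + 2) t - real k * flat_exp (k + 1) t))) (at t)"
    for t using flat_exp_has_derivative[of k t] by (simp add: has_field_derivative_def mult_commute_abs)
  with open_UNIV show ?case
  proof (rule Ck_on_SucI)
    fix v :: real
    have "Ck_on n UNIV (\<lambda>t. (- real k) * flat_exp (k + 1) t)"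
      by (intro Ck_on_bilinear[OF bounded_bilinear_mult open_UNIV] Ck_on_const Suc.IH)
    then have "Ck_on n UNIV (\<lambda>t. flat_exp (k + 2) t + (- real k) * flat_exp (k + 1) t)"
      by (intro Ck_on_add open_UNIV Suc.IH)
    then have "Ck_on n UNIV (\<lambda>t. flat_exp (k + 2) t - real k * flat_exp (k + 1) t)" by simp
    then show "Ck_on n UNIV (\<lambda>t. v * (flat_exp (k + 2) t - real k * flat_exp (k + 1) t))"
      by (intro Ck_on_bilinear[OF bounded_bilinear_mult open_UNIV] Ck_on_const)
  qed
qed

text \<open>The bump is a quotient a/(a + b), where \<open>a\<close> is positive exactly inside the
  ball of radius \<open>r\<close> and \<open>b\<close> exactly outside the closed ball of radius
  \<open>r / 2\<close>, so that the denominator has no zero. The squared distance is used because it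
  is smooth at the centre too.\<close>

lemma smooth_bump:
  fixes y0 :: "'a::real_inner"
  assumes "0 < r"
  obtains \<phi> :: "'a \<Rightarrow> real" where "\<And>y. smooth_near \<phi> y" "\<And>y. 0 \<le> \<phi> y"
    "\<And>y. y \<in> ball y0 (r / 2) \<Longrightarrow> \<phi> y = 1" "\<And>y. y \<notin> ball y0 r \<Longrightarrow> \<phi> y = 0"
proof -
  define q where "q y = (y - y0) \<bullet> (y - y0)" for y
  have q: "q y = (dist y0 y)\<^sup>2" for y
    by (metis q_def dist_norm norm_minus_commute power2_norm_eq_inner)
  define a where "a y = flat_exp 0 (r\<^sup>2 - q y)" for y
  define b where "b y = flat_exp 0 (q y - (r / 2)\<^sup>2)" for y
  have a0: "0 \<le> a y" and b0: "0 \<le> b y" for y by (auto simp: a_def b_def flat_exp_def)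
  have "0 < a y + b y" for y
  proof (cases "q y < r\<^sup>2")
    case True
    then have "0 < a y" by (simp add: a_def flat_exp_def)
    then show ?thesis using b0[of y] by simp
  next
    case False
    have "(r / 2)\<^sup>2 < r\<^sup>2" using assms by (simp add: power2_eq_square)
    then have "0 < b y" using False by (simp add: b_def flat_exp_def)
    then show ?thesis using a0[of y] by simp
  qed
  then have ab: "a y + b y \<noteq> 0" for y by (metis less_irrefl)
  have "smooth_near (\<lambda>y. y + - y0) y" for y
    by (intro smooth_near_add smooth_near_id smooth_near_const)
  then have sq: "smooth_near q y" for y
    unfolding q_def diff_conv_add_uminus by (intro smooth_near_bilinear[OF bounded_bilinear_inner])
  have sf: "smooth_near (flat_exp 0) t" for t
    unfolding smooth_near_def smooth_on_def using Ck_on_flat_exp by blast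
  have sa: "smooth_near a y" for y
  proof -
    have "smooth_near (\<lambda>y. r\<^sup>2 + (- 1) * q y) y"
      by (intro smooth_near_add smooth_near_bilinear[OF bounded_bilinear_mult] smooth_near_const sq)
    then show ?thesis
      using smooth_near_compose[OF orthonormal_frame_one _ sf, of "\<lambda>y. r\<^sup>2 + (- 1) * q y" y]
      by (simp add: a_def[abs_def])
  qed
  have sb: "smooth_near b y" for y
  proof -
    have "smooth_near (\<lambda>y. q y + - (r / 2)\<^sup>2) y"
      by (intro smooth_near_add smooth_near_const sq)
    then show ?thesis
      using smooth_near_compose[OF orthonormal_frame_one _ sf, of "\<lambda>y. q y + - (r / 2)\<^sup>2" y]
      by (simp add: b_def[abs_def])
  qed
  show thesis
  proof (rule that)
    show "smooth_near (\<lambda>y. a y * inverse (a y + b y)) y" for y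
      by (intro smooth_near_bilinear[OF bounded_bilinear_mult] sa smooth_near_inverse
          smooth_near_add sb ab)
    show "0 \<le> a y * inverse (a y + b y)" for y using a0[of y] b0[of y] by simp
    show "a y * inverse (a y + b y) = 1" if "y \<in> ball y0 (r / 2)" for y
    proof -
      have "q y \<le> (r / 2)\<^sup>2" using that unfolding q by (intro power_mono) auto
      then have "b y = 0" by (simp add: b_def flat_exp_def)
      then show ?thesis using ab[of y] by simp
    qed
    show "a y * inverse (a y + b y) = 0" if "y \<notin> ball y0 r" for y
    proof -
      have "r\<^sup>2 \<le> q y" using that assms unfolding q by (intro power_mono) auto
      then show ?thesis by (simp add: a_def flat_exp_def)
    qed
  qed
qed


subsection \<open>Hadamard's lemma\<close>

text \<open>The weight \<open>t ^ k\<close> appears because differentiating the integral in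
  \<open>y\<close> brings out a factor \<open>t\<close>; with it the family is closed under
  derivatives.\<close>

definition ray_integral :: "'a::real_inner \<Rightarrow> nat \<Rightarrow> ('a \<Rightarrow> real) \<Rightarrow> 'a \<Rightarrow> real" where
  "ray_integral y0 k \<phi> y = integral {0..1} (\<lambda>t. t ^ k * \<phi> (y0 + t *\<^sub>R (y - y0)))"

lemma ray_in_ball:
  fixes y0 :: "'a::real_inner"
  assumes y: "y \<in> ball y0 r" and t: "t \<in> {0..1}"
  shows "y0 + t *\<^sub>R (y - y0) \<in> ball y0 r"
proof -
  have "dist y0 (y0 + t *\<^sub>R (y - y0)) = norm (t *\<^sub>R (y - y0))" by (simp add: dist_norm)
  also have "\<dots> = t * dist y0 y" using t by (simp add: dist_norm norm_minus_commute)
  also have "\<dots> \<le> 1 * dist y0 y"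
    using t by (intro mult_right_mono) auto
  finally show ?thesis using y by simp
qed

lemma continuous_on_ray:
  fixes y0 :: "'a::real_inner"
  assumes "continuous_on (ball y0 r) \<phi>"
  shows "continuous_on (ball y0 r \<times> {0..1}) (\<lambda>(y, t). \<phi> (y0 + t *\<^sub>R (y - y0)))"
  unfolding case_prod_beta
proof (rule continuous_on_compose2[OF assms])
  show "continuous_on (ball y0 r \<times> {0..1}) (\<lambda>p. y0 + snd p *\<^sub>R (fst p - y0))"
    by (intro continuous_intros)
qed (auto intro!: ray_in_ball simp del: mem_ball)

lemma ray_integrable:
  fixes y0 :: "'a::real_inner"
  assumes "continuous_on (ball y0 r) \<phi>" "y \<in> ball y0 r"
  shows "(\<lambda>t. t ^ k * \<phi> (y0 + t *\<^sub>R (y - y0))) integrable_on {0..1}"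
proof (rule integrable_continuous_interval)
  have "continuous_on {0..1} (\<lambda>t. \<phi> (y0 + t *\<^sub>R (y - y0)))"
  proof (rule continuous_on_compose2[OF assms(1)])
    show "continuous_on {0..1} (\<lambda>t. y0 + t *\<^sub>R (y - y0))" by (intro continuous_intros)
  qed (use assms(2) in \<open>auto intro!: ray_in_ball simp del: mem_ball\<close>)
  then show "continuous_on {0..1} (\<lambda>t. t ^ k * \<phi> (y0 + t *\<^sub>R (y - y0)))"
    by (intro continuous_intros)
qed

lemma ray_integral_continuous:
  assumes "continuous_on (ball y0 r) \<phi>"
  shows "continuous_on (ball y0 r) (ray_integral y0 k \<phi>)"
proof -
  have "continuous_on (ball y0 r \<times> cbox 0 (1::real)) (\<lambda>(y, t). t ^ k * \<phi> (y0 + t *\<^sub>R (y - y0)))"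
    using continuous_on_ray[OF assms] unfolding case_prod_beta box_real
    by (intro continuous_intros)
  from integral_continuous_on_param[OF this] show ?thesis
    by (simp add: ray_integral_def[abs_def])
qed

text \<open>
  Differentiation under the integral sign is done by hand because \<open>leibniz_rule\<close> requires a
  parameter space of class \<open>banach\<close>.
\<close>

lemma ray_integral_has_derivative:
  fixes E :: "'a::real_inner set" and y0 :: 'a
  assumes E: "orthonormal_frame E"
    and d: "\<And>z. z \<in> ball y0 r \<Longrightarrow> (\<phi> has_derivative \<phi>' z) (at z)"
    and c: "\<And>e. continuous_on (ball y0 r) (\<lambda>z. \<phi>' z e)"
    and y: "y \<in> ball y0 r"
  shows "(ray_integral y0 k \<phi> has_derivative (\<lambda>v. ray_integral y0 (Suc k) (\<lambda>z. \<phi>' z v) y)) (at y)"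
proof -
  let ?c = "\<lambda>y t. y0 + t *\<^sub>R (y - y0)"
  have finE: "finite E" using E by (simp add: orthonormal_frame_def)
  have cont: "continuous_on (ball y0 r) \<phi>"
    using d by (intro continuous_at_imp_continuous_on ballI has_derivative_continuous)
  have lin: "linear (\<phi>' z)" if "z \<in> ball y0 r" for z
    using d[OF that] has_derivative_linear by blast
  \<comment> \<open>Linearity reduces every direction \<open>v\<close> to the finitely many frame
    vectors. This makes the candidate derivative bounded linear and leaves finitely many partial
    derivatives to control.\<close>
  have expand: "ray_integral y0 (Suc k) (\<lambda>z. \<phi>' z v) y
      = (\<Sum>e\<in>E. (v \<bullet> e) * ray_integral y0 (Suc k) (\<lambda>z. \<phi>' z e) y)" for v
  proof -
    have "ray_integral y0 (Suc k) (\<lambda>z. \<phi>' z v) y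
        = integral {0..1} (\<lambda>t. \<Sum>e\<in>E. (v \<bullet> e) * (t ^ Suc k * \<phi>' (?c y t) e))"
      unfolding ray_integral_def
    proof (rule integral_cong)
      fix t :: real assume "t \<in> {0..1}"
      then have "\<phi>' (?c y t) v = (\<Sum>e\<in>E. (v \<bullet> e) *\<^sub>R \<phi>' (?c y t) e)"
        using linear_frame_expand[OF E lin] ray_in_ball[OF y] by blast
      then show "t ^ Suc k * \<phi>' (?c y t) v = (\<Sum>e\<in>E. (v \<bullet> e) * (t ^ Suc k * \<phi>' (?c y t) e))"
        by (simp add: sum_distrib_left mult_ac)
    qed
    also have "\<dots> = (\<Sum>e\<in>E. (v \<bullet> e) * ray_integral y0 (Suc k) (\<lambda>z. \<phi>' z e) y)"
      unfolding ray_integral_def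
      using finE ray_integrable[OF c y]
      by (subst integral_sum) (auto intro!: integrable_on_mult_right simp del: power_Suc)
    finally show ?thesis .
  qed
  have bl: "bounded_linear (\<lambda>v. ray_integral y0 (Suc k) (\<lambda>z. \<phi>' z v) y)"
    by (rule ssubst[OF ext[OF expand]])
      (intro bounded_linear_sum bounded_linear_mult_const bounded_linear_inner_left)
  show ?thesis
    unfolding has_derivative_at_alt
  proof (intro conjI allI impI bl)
    fix \<epsilon> :: real assume \<epsilon>: "0 < \<epsilon>"
    \<comment> \<open>The error is summed over the frame; the added 1 keeps the denominator positive
      for the empty frame.\<close>
    define \<eta> where "\<eta> = \<epsilon> / (real (card E) + 1)"
    have \<eta>: "0 < \<eta>" using \<epsilon> by (simp add: \<eta>_def)
    \<comment> \<open>Compactness of \<open>{0..1}\<close> makes the continuity at \<open>y\<close>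
      uniform along the whole ray.\<close>
    have "\<exists>X. open X \<and> y \<in> X \<and> (\<forall>y'\<in>X \<inter> ball y0 r. \<forall>t\<in>{0..1}.
        dist (\<phi>' (?c y' t) e) (\<phi>' (?c y t) e) \<le> \<eta>)" for e
      using continuous_on_prod_compactE[OF continuous_on_ray[OF c[of e]] compact_Icc y \<eta>]
      by (metis case_prod_conv)
    then obtain X where X: "\<And>e. open (X e)" "\<And>e. y \<in> X e"
      "\<And>e y' t. y' \<in> X e \<inter> ball y0 r \<Longrightarrow> t \<in> {0..1} \<Longrightarrow>
        dist (\<phi>' (?c y' t) e) (\<phi>' (?c y t) e) \<le> \<eta>" by metis
    have "open (ball y0 r \<inter> (\<Inter>e\<in>E. X e))" using X(1) finE by (intro open_Int open_INT) auto
    moreover have "y \<in> ball y0 r \<inter> (\<Inter>e\<in>E. X e)" using X(2) y by auto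
    ultimately obtain \<delta> where \<delta>: "0 < \<delta>" "ball y \<delta> \<subseteq> ball y0 r \<inter> (\<Inter>e\<in>E. X e)"
      unfolding open_contains_ball by meson
    have close: "\<bar>\<phi>' (?c y'' t) v - \<phi>' (?c y t) v\<bar> \<le> \<epsilon> * norm v"
      if y'': "y'' \<in> ball y \<delta>" and t: "t \<in> {0..1}" for y'' t v
    proof -
      have y''B: "y'' \<in> ball y0 r" using y'' \<delta>(2) by blast
      note B = ray_in_ball[OF y''B t] ray_in_ball[OF y t]
      have "\<phi>' (?c y'' t) v - \<phi>' (?c y t) v
          = (\<Sum>e\<in>E. (v \<bullet> e) * (\<phi>' (?c y'' t) e - \<phi>' (?c y t) e))"
        using linear_frame_expand[OF E lin[OF B(1)], of v] linear_frame_expand[OF E lin[OF B(2)], of v]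
        by (simp add: sum_subtractf right_diff_distrib)
      also have "\<bar>\<dots>\<bar> \<le> (\<Sum>e\<in>E. norm v * \<eta>)"
      proof (rule order_trans[OF sum_abs], rule sum_mono)
        fix e assume e: "e \<in> E"
        have "norm e = 1" using E e by (simp add: orthonormal_frame_def norm_eq_1)
        then have "\<bar>v \<bullet> e\<bar> \<le> norm v" using Cauchy_Schwarz_ineq2[of v e] by simp
        moreover have "\<bar>\<phi>' (?c y'' t) e - \<phi>' (?c y t) e\<bar> \<le> \<eta>"
        proof -
          have "y'' \<in> X e \<inter> ball y0 r" using y'' \<delta>(2) e by blast
          from X(3)[OF this t] show ?thesis by (simp add: dist_real_def)
        qed
        ultimately show "\<bar>(v \<bullet> e) * (\<phi>' (?c y'' t) e - \<phi>' (?c y t) e)\<bar> \<le> norm v * \<eta>"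
          unfolding abs_mult by (intro mult_mono) auto
      qed
      also have "\<dots> = norm v * (real (card E) * \<eta>)" by simp
      also have "\<dots> \<le> norm v * \<epsilon>"
        using \<epsilon> by (intro mult_left_mono) (auto simp: \<eta>_def field_simps)
      finally show ?thesis by (simp add: mult.commute)
    qed
    have "norm (ray_integral y0 k \<phi> y' - ray_integral y0 k \<phi> y
        - ray_integral y0 (Suc k) (\<lambda>z. \<phi>' z (y' - y)) y) \<le> \<epsilon> * norm (y' - y)"
      if y': "norm (y' - y) < \<delta>" for y'
    proof -
      have y'b: "y' \<in> ball y \<delta>" using y' by (simp add: dist_norm norm_minus_commute)
      have y'B: "y' \<in> ball y0 r" using y'b \<delta>(2) by blast
      have contd: "continuous_on (ball y0 r) (\<lambda>z. \<phi>' z v)" for v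
        by (rule c)
      let ?f = "\<lambda>t. t ^ k * \<phi> (?c y' t) - t ^ k * \<phi> (?c y t) - t ^ Suc k * \<phi>' (?c y t) (y' - y)"
      have int: "(?f has_integral (ray_integral y0 k \<phi> y' - ray_integral y0 k \<phi> y
          - ray_integral y0 (Suc k) (\<lambda>z. \<phi>' z (y' - y)) y)) {0..1}"
        unfolding ray_integral_def
        by (intro has_integral_diff integrable_integral ray_integrable[OF cont]
            ray_integrable[OF contd] y y'B)
      have "norm (?f t) \<le> \<epsilon> * norm (y' - y)" if t: "t \<in> {0..1}" for t
      proof -
        \<comment> \<open>Mean value estimate: between the points with the same parameter
          \<open>t\<close> on the two rays, the derivative of \<phi> stays within \<epsilon> of its
          value at the start.\<close>
        have on: "onorm (\<lambda>v. \<phi>' x v - \<phi>' (?c y t) v) \<le> \<epsilon>"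
          if "x \<in> closed_segment (?c y t) (?c y' t)" for x
        proof -
          from that obtain s where s: "0 \<le> s" "s \<le> 1" "x = (1 - s) *\<^sub>R ?c y t + s *\<^sub>R ?c y' t"
            by (auto simp: in_segment)
          have xe: "x = ?c (y + s *\<^sub>R (y' - y)) t" unfolding s(3) by (simp add: algebra_simps)
          have "norm (s *\<^sub>R (y' - y)) \<le> 1 * norm (y' - y)"
            using s by (simp add: mult_left_le_one_le)
          then have "y + s *\<^sub>R (y' - y) \<in> ball y \<delta>" using y' by (simp add: dist_norm)
          from close[OF this t] show ?thesis unfolding xe
            using \<epsilon> by (intro onorm_bound) auto
        qed
        have sub: "closed_segment (?c y t) (?c y' t) \<subseteq> ball y0 r"
          using ray_in_ball[OF y t] ray_in_ball[OF y'B t] by (intro closed_segment_subset convex_ball)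
        have "norm (\<phi> (?c y' t) - \<phi> (?c y t) - \<phi>' (?c y t) (?c y' t - ?c y t))
            \<le> norm (?c y' t - ?c y t) * \<epsilon>"
        proof (rule differentiable_bound_linearization)
          show "?c y t + s *\<^sub>R (?c y' t - ?c y t) \<in> closed_segment (?c y t) (?c y' t)"
            if "s \<in> {0..1}" for s
            using that unfolding in_segment by (intro exI[of _ s]) (auto simp: algebra_simps)
          show "(\<phi> has_derivative \<phi>' x) (at x within closed_segment (?c y t) (?c y' t))"
            if "x \<in> closed_segment (?c y t) (?c y' t)" for x
            using d[of x] that sub by (blast intro: has_derivative_at_withinI)
        qed (use on in \<open>auto simp: fun_diff_def\<close>)
        moreover have "?c y' t - ?c y t = t *\<^sub>R (y' - y)" by (simp add: algebra_simps)
        moreover have "\<phi>' (?c y t) (t *\<^sub>R (y' - y)) = t * \<phi>' (?c y t) (y' - y)"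
          using linear_scale[OF lin[OF ray_in_ball[OF y t]]] by simp
        ultimately have le: "\<bar>\<phi> (?c y' t) - \<phi> (?c y t) - t * \<phi>' (?c y t) (y' - y)\<bar>
            \<le> t * norm (y' - y) * \<epsilon>" using t by simp
        have "\<bar>?f t\<bar> = t ^ k * \<bar>\<phi> (?c y' t) - \<phi> (?c y t) - t * \<phi>' (?c y t) (y' - y)\<bar>"
        proof -
          have "?f t = t ^ k * (\<phi> (?c y' t) - \<phi> (?c y t) - t * \<phi>' (?c y t) (y' - y))"
            by (simp add: algebra_simps)
          then show ?thesis using t by (simp add: abs_mult)
        qed
        also have "\<dots> \<le> 1 * (1 * norm (y' - y) * \<epsilon>)"
          using t \<epsilon> by (intro mult_mono order_trans[OF le] power_le_one) auto
        finally show ?thesis by (simp add: mult.commute)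
      qed
      then have "norm (ray_integral y0 k \<phi> y' - ray_integral y0 k \<phi> y
          - ray_integral y0 (Suc k) (\<lambda>z. \<phi>' z (y' - y)) y) \<le> \<epsilon> * norm (y' - y) * measure lborel {0..1::real}"
        using has_integral_bound_real[OF _ finite.emptyI int] \<epsilon> by simp
      then show ?thesis by simp
    qed
    then show "\<exists>d>0. \<forall>y'. norm (y' - y) < d \<longrightarrow>
        norm (ray_integral y0 k \<phi> y' - ray_integral y0 k \<phi> y
          - ray_integral y0 (Suc k) (\<lambda>z. \<phi>' z (y' - y)) y) \<le> \<epsilon> * norm (y' - y)"
      using \<delta>(1) by blast
  qed
qed

text \<open>The induction varies \<open>k\<close>, which grows by one with each derivative.\<close>

lemma Ck_on_ray_integral:
  fixes E :: "'a::real_inner set" and y0 :: 'a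
  assumes "orthonormal_frame E" "Ck_on n (ball y0 r) \<phi>"
  shows "Ck_on n (ball y0 r) (ray_integral y0 k \<phi>)"
  using assms(2)
proof (induction n arbitrary: k \<phi>)
  case 0
  then show ?case using ray_integral_continuous by simp
next
  case (Suc n)
  from Suc.prems obtain \<phi>' where d: "\<And>z. z \<in> ball y0 r \<Longrightarrow> (\<phi> has_derivative \<phi>' z) (at z)"
    and C: "\<And>v. Ck_on n (ball y0 r) (\<lambda>z. \<phi>' z v)" by (rule Ck_on_SucE) blast
  have "continuous_on (ball y0 r) (\<lambda>z. \<phi>' z v)" for v
    using C[of v] by (induction n) (auto dest: Ck_on_SucD simp del: Ck_on.simps(2))
  from open_ball ray_integral_has_derivative[OF assms(1) d this] Suc.IH[OF C]
  show ?case by (rule Ck_on_SucI)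
qed

text \<open>By the fundamental theorem of calculus \<open>f y - f y0\<close> is the integral over
  the ray of the derivative in the direction \<open>y - y0\<close>. Expanding this constant
  direction in the frame takes the coordinates out of the integral; the functions \<open>h e\<close>
  are the averages of the partial derivatives over the ray.\<close>

lemma Hadamard:
  fixes E :: "'a::real_inner set" and f :: "'a \<Rightarrow> real"
  assumes E: "orthonormal_frame E" and f: "smooth_on (ball y0 r) f" and r: "0 < r"
  obtains h where "\<And>e. smooth_on (ball y0 r) (h e)"
    "\<And>e. h e y0 = frechet_derivative f (at y0) e"
    "\<And>y. y \<in> ball y0 r \<Longrightarrow> f y = f y0 + (\<Sum>e\<in>E. ((y - y0) \<bullet> e) * h e y)"
proof
  let ?D = "\<lambda>z. frechet_derivative f (at z)"
  let ?h = "\<lambda>e. ray_integral y0 0 (\<lambda>z. ?D z e)"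
  have Ck: "Ck_on n (ball y0 r) (\<lambda>z. ?D z e)" for n e
    using f Ck_on.simps(2)[of n "ball y0 r" f] unfolding smooth_on_def by blast
  show "smooth_on (ball y0 r) (?h e)" for e
    unfolding smooth_on_def using Ck_on_ray_integral[OF E Ck] by blast
  show "?h e y0 = ?D y0 e" for e by (simp add: ray_integral_def)
  fix y assume y: "y \<in> ball y0 r"
  have d: "(f has_derivative ?D z) (at z)" if "z \<in> ball y0 r" for z
    using f that Ck_on.simps(2)[of 0 "ball y0 r" f] unfolding smooth_on_def
    by (metis frechet_derivative_works)
  have cont: "continuous_on (ball y0 r) (\<lambda>z. ?D z e)" for e
    using Ck[of 0 e] by simp
  let ?c = "\<lambda>t. y0 + t *\<^sub>R (y - y0)"
  have "((\<lambda>t. ?D (?c t) (y - y0)) has_integral (f (?c 1) - f (?c 0))) {0..1}"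
  proof (rule fundamental_theorem_of_calculus)
    fix t :: real assume t: "t \<in> {0..1}"
    have B: "?c t \<in> ball y0 r" using ray_in_ball[OF y t] .
    have "(?c has_derivative (\<lambda>s. s *\<^sub>R (y - y0))) (at t)"
      by (auto intro!: derivative_eq_intros)
    from has_derivative_compose[OF this d[OF B]]
    have "((\<lambda>t. f (?c t)) has_derivative (\<lambda>s. s *\<^sub>R ?D (?c t) (y - y0))) (at t)"
      using linear_scale[OF has_derivative_linear[OF d[OF B]]] by simp
    then show "((\<lambda>t. f (?c t)) has_vector_derivative ?D (?c t) (y - y0)) (at t within {0..1})"
      unfolding has_vector_derivative_def by (rule has_derivative_at_withinI)
  qed simp
  moreover have "((\<lambda>t. ?D (?c t) (y - y0)) has_integral (\<Sum>e\<in>E. ((y - y0) \<bullet> e) * ?h e y)) {0..1}"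
  proof (rule has_integral_eq)
    show "((\<lambda>t. \<Sum>e\<in>E. ((y - y0) \<bullet> e) * (t ^ 0 * ?D (?c t) e)) has_integral
        (\<Sum>e\<in>E. ((y - y0) \<bullet> e) * ?h e y)) {0..1}"
      unfolding ray_integral_def using E
      by (intro has_integral_sum has_integral_mult_right integrable_integral ray_integrable[OF cont y])
        (simp add: orthonormal_frame_def)
    show "(\<Sum>e\<in>E. ((y - y0) \<bullet> e) * (t ^ 0 * ?D (?c t) e)) = ?D (?c t) (y - y0)" if "t \<in> {0..1}" for t
      using linear_frame_expand[OF E has_derivative_linear[OF d[OF ray_in_ball[OF y that]]], of "y - y0"]
      by simp
  qed
  ultimately have "f (?c 1) - f (?c 0) = (\<Sum>e\<in>E. ((y - y0) \<bullet> e) * ?h e y)"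
    using has_integral_unique by blast
  then show "f y = f y0 + (\<Sum>e\<in>E. ((y - y0) \<bullet> e) * ?h e y)" by simp
qed


section \<open>Smooth functions and tangent vectors on a manifold\<close>

lemma compact_frame_box:
  fixes E :: "'a::real_normed_vector set"
  assumes "finite E"
  shows "\<exists>C. compact C \<and> (\<forall>c. (\<forall>e\<in>E. \<bar>c e\<bar> \<le> R) \<longrightarrow> (\<Sum>e\<in>E. c e *\<^sub>R e) \<in> C)"
  using assms
proof induction
  case empty
  show ?case by (intro exI[of _ "{0}"]) simp
next
  case (insert e E)
  then obtain C where C: "compact C" "\<And>c. (\<forall>e\<in>E. \<bar>c e\<bar> \<le> R) \<Longrightarrow> (\<Sum>e\<in>E. c e *\<^sub>R e) \<in> C" by blast
  let ?I = "(\<lambda>t. t *\<^sub>R e) ` {- R..R}"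
  have "compact ?I" by (intro compact_continuous_image continuous_intros compact_Icc)
  then have "compact {x + y | x y. x \<in> ?I \<and> y \<in> C}" using C(1) by (rule compact_sums)
  moreover have "(\<Sum>e\<in>insert e E. c e *\<^sub>R e) \<in> {x + y | x y. x \<in> ?I \<and> y \<in> C}"
    if c: "\<forall>e\<in>insert e E. \<bar>c e\<bar> \<le> R" for c
  proof -
    have "c e *\<^sub>R e \<in> ?I" using c by (intro imageI) auto
    moreover have "(\<Sum>e\<in>E. c e *\<^sub>R e) \<in> C" using C(2) c by simp
    ultimately show ?thesis using insert.hyps by auto
  qed
  ultimately show ?case by blast
qed

text \<open>The coordinates of points of the ball are bounded, so the ball is a closed subset of a
  compact box.\<close>

lemma compact_cball_frame:
  fixes E :: "'a::real_inner set" and y0 :: 'a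
  assumes "orthonormal_frame E"
  shows "compact (cball y0 r)"
proof -
  have "finite E" using assms by (simp add: orthonormal_frame_def)
  then obtain C where C: "compact C"
    "\<And>c. (\<forall>e\<in>E. \<bar>c e\<bar> \<le> norm y0 + r) \<Longrightarrow> (\<Sum>e\<in>E. c e *\<^sub>R e) \<in> C"
    using compact_frame_box[of E "norm y0 + r"] by auto
  have "cball y0 r \<subseteq> C"
  proof
    fix y assume y: "y \<in> cball y0 r"
    have "norm (y0 + (y - y0)) \<le> norm y0 + norm (y - y0)" by (rule norm_triangle_ineq)
    then have ny: "norm y \<le> norm y0 + r" using y by (simp add: dist_norm norm_minus_commute)
    have "\<bar>y \<bullet> e\<bar> \<le> norm y0 + r" if "e \<in> E" for e
    proof -
      have "norm e = 1" using assms that by (simp add: orthonormal_frame_def norm_eq_1)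
      then show ?thesis using Cauchy_Schwarz_ineq2[of y e] ny by simp
    qed
    then show "y \<in> C" using C(2)[of "\<lambda>e. y \<bullet> e"] orthonormal_frame_expand[OF assms, of y] by simp
  qed
  then have "cball y0 r = C \<inter> cball y0 r" by blast
  then show ?thesis using compact_Int_closed[OF C(1) closed_cball] by metis
qed

section \<open>Smoothness at a point of the manifold\<close>

definition smooth_at ::
    "('m::topological_space, 'e::real_inner) manifold_data \<Rightarrow> ('m \<Rightarrow> 'b::real_normed_vector) \<Rightarrow> 'm \<Rightarrow> bool" where
  "smooth_at M f x \<longleftrightarrow> (\<exists>N. open N \<and> x \<in> N \<and> smooth_fun_on M N f)"

locale smooth_mfd =
  fixes M :: "('m::t2_space, 'e::real_inner) manifold_data"
  assumes smooth_manifold: "smooth_manifold M"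
begin

abbreviation smooth :: "('m \<Rightarrow> 'b::real_normed_vector) \<Rightarrow> bool" where
  "smooth \<equiv> smooth_fun_on M UNIV"

lemma frame: "orthonormal_frame (frame M)"
  using smooth_manifold by (simp add: smooth_manifold_def orthonormal_frame_def)

lemma finite_frame: "finite (frame M)"
  using frame by (simp add: orthonormal_frame_def)

lemma ex_chart: obtains U \<xi> where "(U, \<xi>) \<in> charts M" "x \<in> U"
proof -
  have "x \<in> (\<Union>(U, \<xi>)\<in>charts M. U)" using smooth_manifold by (simp add: smooth_manifold_def)
  then show ?thesis using that by blast
qed

context
  fixes U :: "'m set" and \<xi> :: "'m \<Rightarrow> 'e"
  assumes chart: "(U, \<xi>) \<in> charts M"
begin

lemma chart_homeomorphism: "open U" "open (\<xi> ` U)" "homeomorphism U (\<xi> ` U) \<xi> (inv_into U \<xi>)"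
  using smooth_manifold chart by (force simp: smooth_manifold_def)+

lemma chart_continuous: "continuous_on U \<xi>"
  using chart_homeomorphism(3) homeomorphism_cont1 by blast

lemma chart_inv: "x \<in> U \<Longrightarrow> inv_into U \<xi> (\<xi> x) = x"
  using chart_homeomorphism(3) homeomorphism_apply1 by metis

lemma chart_open_image:
  assumes "open W"
  shows "open (\<xi> ` (U \<inter> W))"
proof -
  have "\<xi> ` (U \<inter> W) = \<xi> ` U \<inter> inv_into U \<xi> -` W" using chart_inv by force
  moreover have "continuous_on (\<xi> ` U) (inv_into U \<xi>)"
    using chart_homeomorphism(3) homeomorphism_cont2 by blast
  ultimately show ?thesis using chart_homeomorphism(2) assms by (simp add: continuous_open_preimage)
qed

lemma chart_open_preimage: "open S \<Longrightarrow> open (U \<inter> \<xi> -` S)"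
  using chart_continuous chart_homeomorphism(1) by (simp add: continuous_open_preimage)

end

text \<open>\<open>smooth_fun_on\<close> asks about every chart; because transition maps are smooth,
  one chart around the point decides. The closure properties of \<open>smooth_near\<close> then
  carry over to the manifold through a single chart.\<close>

lemma smooth_at_chart_iff:
  assumes chart: "(U, \<xi>) \<in> charts M" and x: "x \<in> U"
  shows "smooth_at M f x \<longleftrightarrow> smooth_near (f \<circ> inv_into U \<xi>) (\<xi> x)"
proof
  assume "smooth_at M f x"
  then obtain N where N: "open N" "x \<in> N" "smooth_on (\<xi> ` (U \<inter> N)) (f \<circ> inv_into U \<xi>)"
    using chart by (auto simp: smooth_at_def smooth_fun_on_def)
  then show "smooth_near (f \<circ> inv_into U \<xi>) (\<xi> x)"
    unfolding smooth_near_def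
    using chart_open_image[OF chart] x by (intro exI[of _ "\<xi> ` (U \<inter> N)"]) simp
next
  assume "smooth_near (f \<circ> inv_into U \<xi>) (\<xi> x)"
  then obtain S where S: "open S" "\<xi> x \<in> S" "smooth_on S (f \<circ> inv_into U \<xi>)"
    by (auto simp: smooth_near_def)
  define N where "N = U \<inter> \<xi> -` S"
  have N: "open N" using chart_open_preimage[OF chart S(1)] by (simp add: N_def)
  have "smooth_on (\<eta> ` (V \<inter> N)) (f \<circ> inv_into V \<eta>)" if V: "(V, \<eta>) \<in> charts M" for V \<eta>
    unfolding smooth_on_iff_smooth_near[OF chart_open_image[OF V N]]
  proof safe
    fix y assume y: "y \<in> V" "y \<in> N"
    have "smooth_on (\<eta> ` (V \<inter> U)) (\<xi> \<circ> inv_into V \<eta>)"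
      using smooth_manifold V chart by (force simp: smooth_manifold_def)
    then have t: "smooth_near (\<xi> \<circ> inv_into V \<eta>) (\<eta> y)"
      unfolding smooth_near_def using y chart_open_image[OF V chart_homeomorphism(1)[OF chart]]
      by (intro exI[of _ "\<eta> ` (V \<inter> U)"]) (auto simp: N_def)
    have "smooth_near (f \<circ> inv_into U \<xi>) (\<xi> y)"
      using S y by (auto simp: smooth_near_def N_def)
    then have "smooth_near (\<lambda>z. (f \<circ> inv_into U \<xi>) ((\<xi> \<circ> inv_into V \<eta>) z)) (\<eta> y)"
      using y chart_inv[OF V] by (intro smooth_near_compose[OF frame t]) (simp add: comp_def)
    then show "smooth_near (f \<circ> inv_into V \<eta>) (\<eta> y)"
    proof (rule smooth_near_cong)
      show "open (\<eta> ` (V \<inter> N))" by (rule chart_open_image[OF V N])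
    qed (use y chart_inv[OF V] chart_inv[OF chart] in \<open>auto simp: N_def\<close>)
  qed
  then have "smooth_fun_on M N f" by (auto simp: smooth_fun_on_def)
  then show "smooth_at M f x" using N x S(2) by (auto simp: smooth_at_def N_def)
qed

lemma smooth_fun_on_iff:
  assumes "open W"
  shows "smooth_fun_on M W f \<longleftrightarrow> (\<forall>x\<in>W. smooth_at M f x)"
proof
  assume s: "\<forall>x\<in>W. smooth_at M f x"
  have "smooth_on (\<xi> ` (U \<inter> W)) (f \<circ> inv_into U \<xi>)" if "(U, \<xi>) \<in> charts M" for U \<xi>
    unfolding smooth_on_iff_smooth_near[OF chart_open_image[OF that assms]]
    using s smooth_at_chart_iff[OF that] by auto
  then show "smooth_fun_on M W f" by (auto simp: smooth_fun_on_def)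
qed (use assms in \<open>auto simp: smooth_at_def\<close>)

lemma smooth_iff: "smooth f \<longleftrightarrow> (\<forall>x. smooth_at M f x)"
  by (simp add: smooth_fun_on_iff)

lemma smooth_at_cong:
  assumes "smooth_at M f x" "open N" "x \<in> N" "\<And>y. y \<in> N \<Longrightarrow> f y = g y"
  shows "smooth_at M g x"
proof -
  obtain U \<xi> where U: "(U, \<xi>) \<in> charts M" "x \<in> U" by (rule ex_chart)
  have "smooth_near (f \<circ> inv_into U \<xi>) (\<xi> x)" using assms(1) smooth_at_chart_iff[OF U] by blast
  then have "smooth_near (g \<circ> inv_into U \<xi>) (\<xi> x)"
  proof (rule smooth_near_cong)
    show "open (\<xi> ` (U \<inter> N))" by (rule chart_open_image[OF U(1) assms(2)])
  qed (use assms U chart_inv[OF U(1)] in auto)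
  then show ?thesis using smooth_at_chart_iff[OF U] by blast
qed

lemma smooth_at_const: "smooth_at M (\<lambda>_. c) x"
proof -
  obtain U \<xi> where U: "(U, \<xi>) \<in> charts M" "x \<in> U" by (rule ex_chart)
  show ?thesis unfolding smooth_at_chart_iff[OF U] comp_def by (rule smooth_near_const)
qed

lemma smooth_at_bounded_linear:
  assumes "bounded_linear h" "smooth_at M f x"
  shows "smooth_at M (\<lambda>y. h (f y)) x"
proof -
  obtain U \<xi> where U: "(U, \<xi>) \<in> charts M" "x \<in> U" by (rule ex_chart)
  show ?thesis using assms smooth_near_bounded_linear
    unfolding smooth_at_chart_iff[OF U] comp_def by blast
qed

lemma smooth_at_bilinear:
  assumes "bounded_bilinear h" "smooth_at M f x" "smooth_at M g x"
  shows "smooth_at M (\<lambda>y. h (f y) (g y)) x"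
proof -
  obtain U \<xi> where U: "(U, \<xi>) \<in> charts M" "x \<in> U" by (rule ex_chart)
  show ?thesis using assms(2,3) unfolding smooth_at_chart_iff[OF U] comp_def
    by (rule smooth_near_bilinear[OF assms(1)])
qed

lemmas smooth_at_mult = smooth_at_bilinear[OF bounded_bilinear_mult]
  and smooth_at_scaleR = smooth_at_bilinear[OF bounded_bilinear_scaleR]

lemma smooth_at_add:
  assumes "smooth_at M f x" "smooth_at M g x"
  shows "smooth_at M (\<lambda>y. f y + g y) x"
proof -
  obtain U \<xi> where U: "(U, \<xi>) \<in> charts M" "x \<in> U" by (rule ex_chart)
  show ?thesis using assms unfolding smooth_at_chart_iff[OF U] comp_def
    by (rule smooth_near_add)
qed

lemma smooth_at_sum:
  "(\<And>i. i \<in> I \<Longrightarrow> smooth_at M (f i) x) \<Longrightarrow> smooth_at M (\<lambda>y. \<Sum>i\<in>I. f i y) x"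
  by (induction I rule: infinite_finite_induct) (auto simp: smooth_at_const smooth_at_add)

lemma smooth_at_minus: "smooth_at M f x \<Longrightarrow> smooth_at M (\<lambda>y. - f y) x"
  using smooth_at_bounded_linear[OF bounded_linear_minus[OF bounded_linear_ident]] .

lemma smooth_at_diff:
  "smooth_at M f x \<Longrightarrow> smooth_at M g x \<Longrightarrow> smooth_at M (\<lambda>y. f y - g y) x"
  unfolding diff_conv_add_uminus by (intro smooth_at_add smooth_at_minus)

lemma smooth_at_inner: "smooth_at M f x \<Longrightarrow> smooth_at M (\<lambda>y. f y \<bullet> b) x"
  by (rule smooth_at_bounded_linear[OF bounded_linear_inner_left])

lemma smooth_at_of_real:
  "smooth_at M f x \<Longrightarrow> smooth_at M (\<lambda>y. of_real (f y) :: 'b::real_normed_algebra_1) x"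
  by (rule smooth_at_bounded_linear[OF bounded_linear_of_real])

lemma smooth_at_inverse:
  fixes f :: "'m \<Rightarrow> real"
  assumes "smooth_at M f x" "f x \<noteq> 0"
  shows "smooth_at M (\<lambda>y. inverse (f y)) x"
proof -
  obtain U \<xi> where U: "(U, \<xi>) \<in> charts M" "x \<in> U" by (rule ex_chart)
  show ?thesis using assms unfolding smooth_at_chart_iff[OF U] comp_def
    by (intro smooth_near_inverse) (simp_all add: chart_inv[OF U(1)] U(2))
qed

lemmas smooth_at_intros = smooth_at_const smooth_at_mult smooth_at_scaleR smooth_at_add
  smooth_at_sum smooth_at_minus smooth_at_diff smooth_at_inner smooth_at_of_real

lemma smooth_at_chart:
  assumes "(U, \<xi>) \<in> charts M" "x \<in> U"
  shows "smooth_at M \<xi> x"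
  unfolding smooth_at_chart_iff[OF assms]
proof (rule smooth_near_cong[OF smooth_near_id])
  show "open (\<xi> ` U)" by (rule chart_homeomorphism(2)[OF assms(1)])
qed (use assms chart_inv[OF assms(1)] in auto)

text \<open>The Euclidean bump is extended by 0 outside the chart. This is smooth because
  \<open>K\<close> is the image of a compact ball, hence closed: here the Hausdorff axiom enters.
  \<open>K\<close> is returned so that objects that are smooth on \<open>W\<close> only can be
  multiplied by \<phi> and extended by 0 across the open set \<open>- K\<close>.\<close>

lemma ex_bump:
  assumes "open W" "x \<in> W"
  obtains \<phi> :: "'m \<Rightarrow> real" and N K where "smooth \<phi>" "\<And>y. 0 \<le> \<phi> y"
    "open N" "x \<in> N" "N \<subseteq> K" "\<And>y. y \<in> N \<Longrightarrow> \<phi> y = 1"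
    "compact K" "closed K" "K \<subseteq> W" "\<And>y. y \<notin> K \<Longrightarrow> \<phi> y = 0"
proof -
  obtain U \<xi> where U: "(U, \<xi>) \<in> charts M" "x \<in> U" by (rule ex_chart)
  have "\<xi> x \<in> \<xi> ` (U \<inter> W)" using U assms by blast
  with chart_open_image[OF U(1) assms(1)] obtain r
    where r: "0 < r" "cball (\<xi> x) r \<subseteq> \<xi> ` (U \<inter> W)"
    unfolding open_contains_cball by blast
  from r(1) obtain \<psi> :: "'e \<Rightarrow> real" where \<psi>: "\<And>y. smooth_near \<psi> y" "\<And>y. 0 \<le> \<psi> y"
    "\<And>y. y \<in> ball (\<xi> x) (r / 2) \<Longrightarrow> \<psi> y = 1" "\<And>y. y \<notin> ball (\<xi> x) r \<Longrightarrow> \<psi> y = 0"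
    by (rule smooth_bump[where ?y0.0 = "\<xi> x"]) blast
  define K where "K = inv_into U \<xi> ` cball (\<xi> x) r"
  define \<phi> where "\<phi> y = (if y \<in> U then \<psi> (\<xi> y) else 0)" for y
  have "continuous_on (\<xi> ` U) (inv_into U \<xi>)"
    using chart_homeomorphism(3)[OF U(1)] homeomorphism_cont2 by blast
  then have "continuous_on (cball (\<xi> x) r) (inv_into U \<xi>)"
    by (rule continuous_on_subset) (use r in auto)
  then have K: "compact K" unfolding K_def
    by (rule compact_continuous_image[OF _ compact_cball_frame[OF frame]])
  then have clK: "closed K" by (rule compact_imp_closed)
  have KW: "K \<subseteq> U \<inter> W" unfolding K_def using r chart_inv[OF U(1)] by force
  have inK: "y \<in> K" if "y \<in> U" "\<xi> y \<in> cball (\<xi> x) r" for y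
    unfolding K_def using that chart_inv[OF U(1)] by force
  have zero: "\<phi> y = 0" if "y \<notin> K" for y
    using that inK[of y] \<psi>(4)[of "\<xi> y"] by (cases "dist (\<xi> x) (\<xi> y) < r") (auto simp: \<phi>_def)
  define N where "N = U \<inter> \<xi> -` ball (\<xi> x) (r / 2)"
  have "smooth_at M \<phi> y" for y
  proof (cases "y \<in> K")
    case True
    then have y: "y \<in> U" using KW by blast
    show ?thesis unfolding smooth_at_chart_iff[OF U(1) y]
    proof (rule smooth_near_cong[OF \<psi>(1)])
      show "open (\<xi> ` U)" by (rule chart_homeomorphism(2)[OF U(1)])
    qed (use y chart_inv[OF U(1)] in \<open>auto simp: \<phi>_def\<close>)
  next
    case False
    show ?thesis
    proof (rule smooth_at_cong[OF smooth_at_const])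
      show "open (- K)" using clK by blast
    qed (use False zero in auto)
  qed
  then have "smooth \<phi>" by (simp add: smooth_iff)
  moreover have "open N" unfolding N_def by (rule chart_open_preimage[OF U(1) open_ball])
  moreover have "x \<in> N" using U r by (simp add: N_def)
  moreover have "N \<subseteq> K" using inK r by (auto simp: N_def)
  moreover have "\<phi> y = 1" if "y \<in> N" for y using that \<psi>(3) by (auto simp: N_def \<phi>_def)
  moreover have "0 \<le> \<phi> y" for y using \<psi>(2) by (simp add: \<phi>_def)
  ultimately show ?thesis using that K clK KW zero by auto
qed

lemma ex_smooth_extension:
  fixes f :: "'m \<Rightarrow> 'b::real_normed_vector"
  assumes "open W" "x \<in> W" "\<And>y. y \<in> W \<Longrightarrow> smooth_at M f y"
  obtains g N where "smooth g" "open N" "x \<in> N" "\<And>y. y \<in> N \<Longrightarrow> g y = f y"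
proof -
  from assms(1,2) obtain \<phi> :: "'m \<Rightarrow> real" and N K where \<phi>: "smooth \<phi>" "\<And>y. 0 \<le> \<phi> y"
    "open N" "x \<in> N" "N \<subseteq> K" "\<And>y. y \<in> N \<Longrightarrow> \<phi> y = 1"
    "compact K" "closed K" "K \<subseteq> W" "\<And>y. y \<notin> K \<Longrightarrow> \<phi> y = 0" by (rule ex_bump) blast
  have "smooth_at M (\<lambda>y. \<phi> y *\<^sub>R f y) y" for y
  proof (cases "y \<in> K")
    case True
    then show ?thesis using \<phi>(1,9) assms(3) by (intro smooth_at_scaleR) (auto simp: smooth_iff)
  next
    case False
    show ?thesis
    proof (rule smooth_at_cong[OF smooth_at_const])
      show "open (- K)" using \<phi>(8) by blast
    qed (use False \<phi>(10) in auto)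
  qed
  then have "smooth (\<lambda>y. \<phi> y *\<^sub>R f y)" by (simp add: smooth_iff)
  then show ?thesis using \<phi>(3,4,6) by (intro that[of "\<lambda>y. \<phi> y *\<^sub>R f y" N]) auto
qed


subsection \<open>Tangent vectors\<close>

context
  fixes v x assumes v: "v \<in> tangent_space M x"
begin

lemma tangent_add: "smooth f \<Longrightarrow> smooth g \<Longrightarrow> v (\<lambda>y. f y + g y) = v f + v g"
  and tangent_mult: "smooth f \<Longrightarrow> smooth g \<Longrightarrow> v (\<lambda>y. f y * g y) = v f * g x + f x * v g"
  and tangent_scale: "smooth f \<Longrightarrow> v (\<lambda>y. c * f y) = c * v f"
  and tangent_junk: "\<not> smooth f \<Longrightarrow> v f = 0"
  using v unfolding tangent_space_def by auto

lemma tangent_const: "v (\<lambda>_. c) = 0"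
proof -
  have s: "smooth (\<lambda>_. c)" for c :: real by (simp add: smooth_iff smooth_at_const)
  have "v (\<lambda>_. 1) = v (\<lambda>y. 1 * 1)" by simp
  then have "v (\<lambda>_. 1) = 0" using tangent_mult[OF s s, of 1 1] by simp
  then show ?thesis using tangent_scale[OF s, of c 1] by simp
qed

lemma tangent_diff:
  assumes "smooth f" "smooth g"
  shows "v (\<lambda>y. f y - g y) = v f - v g"
proof -
  have "smooth (\<lambda>y. (- 1) * g y)" using assms by (simp add: smooth_iff smooth_at_minus)
  then have "v (\<lambda>y. f y + (- 1) * g y) = v f + v (\<lambda>y. (- 1) * g y)" by (rule tangent_add[OF assms(1)])
  also have "v (\<lambda>y. (- 1) * g y) = (- 1) * v g" by (rule tangent_scale[OF assms(2)])
  finally show ?thesis by simp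
qed

lemma tangent_sum:
  "(\<And>i. i \<in> I \<Longrightarrow> smooth (f i)) \<Longrightarrow> v (\<lambda>y. \<Sum>i\<in>I. f i y) = (\<Sum>i\<in>I. v (f i))"
proof (induction I rule: infinite_finite_induct)
  case (insert i I)
  then have "smooth (\<lambda>y. \<Sum>i\<in>I. f i y)" by (simp add: smooth_iff smooth_at_sum)
  then show ?case using insert tangent_add by simp
qed (simp_all add: tangent_const)

text \<open>With a bump \<open>\<phi>\<close> supported in \<open>N\<close> and equal to 1 at
  \<open>x\<close>, \<open>f - g\<close> coincides with \<open>(1 - \<phi>) * (f - g)\<close>; both
  factors vanish at \<open>x\<close>, so the Leibniz rule gives 0.\<close>

lemma tangent_local:
  assumes "smooth f" "smooth g" "open N" "x \<in> N" "\<And>y. y \<in> N \<Longrightarrow> f y = g y"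
  shows "v f = v g"
proof -
  from assms(3,4) obtain \<phi> :: "'m \<Rightarrow> real" and N' K where \<phi>: "smooth \<phi>" "\<And>y. 0 \<le> \<phi> y"
    "open N'" "x \<in> N'" "N' \<subseteq> K" "\<And>y. y \<in> N' \<Longrightarrow> \<phi> y = 1"
    "compact K" "closed K" "K \<subseteq> N" "\<And>y. y \<notin> K \<Longrightarrow> \<phi> y = 0" by (rule ex_bump) blast
  have s: "smooth (\<lambda>y. f y - g y)" "smooth (\<lambda>y. 1 - \<phi> y)"
    using assms(1,2) \<phi>(1) by (auto simp: smooth_iff intro!: smooth_at_intros)
  have "(1 - \<phi> y) * (f y - g y) = f y - g y" for y
    using \<phi>(9) \<phi>(10)[of y] assms(5)[of y] by (cases "y \<in> K") auto
  then have "(\<lambda>y. (1 - \<phi> y) * (f y - g y)) = (\<lambda>y. f y - g y)" by (rule ext)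
  then have "v (\<lambda>y. f y - g y) = v (\<lambda>y. (1 - \<phi> y) * (f y - g y))" by (simp only:)
  also have "\<dots> = 0" using tangent_mult[OF s(2,1)] assms(4,5) \<phi>(4,6) by simp
  finally show ?thesis using tangent_diff[OF assms(1,2)] by simp
qed

end

lemma tangent_zero: "(\<lambda>f. 0) \<in> tangent_space M x"
  by (simp add: tangent_space_def)

lemma tangent_lincomb:
  assumes "v \<in> tangent_space M x" "w \<in> tangent_space M x"
  shows "(\<lambda>f. a * v f + b * w f) \<in> tangent_space M x"
  using assms unfolding tangent_space_def
  by (auto simp: algebra_simps)

lemma tangent_sum_in:
  assumes "finite I" "\<And>i. i \<in> I \<Longrightarrow> v i \<in> tangent_space M x"
  shows "(\<lambda>f. \<Sum>i\<in>I. c i * v i f) \<in> tangent_space M x"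
  using assms
proof induction
  case (insert i I)
  then have "(\<lambda>f. c i * v i f + 1 * (\<Sum>i\<in>I. c i * v i f)) \<in> tangent_space M x"
    by (intro tangent_lincomb) auto
  then show ?case using insert by simp
qed (simp add: tangent_zero)

text \<open>Coordinates of a point of the chart domain, cut off to smooth functions on the whole manifold.\<close>

definition coordinates_near :: "'m set \<Rightarrow> ('m \<Rightarrow> 'e) \<Rightarrow> 'm set \<Rightarrow> ('e \<Rightarrow> 'm \<Rightarrow> real) \<Rightarrow> bool" where
  "coordinates_near U \<xi> N \<zeta> \<longleftrightarrow> open N \<and> N \<subseteq> U \<and> (\<forall>e. smooth (\<zeta> e)) \<and>
     (\<forall>y\<in>N. \<forall>e. \<zeta> e y = \<xi> y \<bullet> e)"

lemma ex_coordinates: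
  assumes "(U, \<xi>) \<in> charts M" "x \<in> U"
  obtains \<zeta> N where "coordinates_near U \<xi> N \<zeta>" "x \<in> N"
proof -
  obtain g N where g: "smooth g" "open N" "x \<in> N" "\<And>y. y \<in> N \<Longrightarrow> g y = \<xi> y"
    using ex_smooth_extension[OF chart_homeomorphism(1)[OF assms(1)] assms(2) smooth_at_chart[OF assms(1)]]
    by blast
  then have "coordinates_near U \<xi> (N \<inter> U) (\<lambda>e y. g y \<bullet> e)"
    using chart_homeomorphism(1)[OF assms(1)]
    by (auto simp: coordinates_near_def smooth_iff intro!: smooth_at_inner)
  then show ?thesis using that g(3) assms(2) by blast
qed

lemma coord_field_eq:
  "smooth f \<Longrightarrow> coord_field M U \<xi> e x f = frechet_derivative (f \<circ> inv_into U \<xi>) (at (\<xi> x)) e"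
  by (simp add: coord_field_def)

lemma coord_field_smooth_at:
  assumes U: "(U, \<xi>) \<in> charts M" "x \<in> U" and f: "smooth f"
  shows "smooth_at M (\<lambda>y. coord_field M U \<xi> e y f) x"
  unfolding smooth_at_chart_iff[OF U]
proof (rule smooth_near_cong)
  show "smooth_near (\<lambda>z. frechet_derivative (f \<circ> inv_into U \<xi>) (at z) e) (\<xi> x)"
    using f smooth_at_chart_iff[OF U] by (intro smooth_near_derivative) (auto simp: smooth_iff)
  show "open (\<xi> ` U)" by (rule chart_homeomorphism(2)[OF U(1)])
qed (use U chart_inv[OF U(1)] in \<open>auto simp: coord_field_eq[OF f]\<close>)

lemma coord_field_tangent:
  assumes U: "(U, \<xi>) \<in> charts M" "x \<in> U"
  shows "coord_field M U \<xi> e x \<in> tangent_space M x"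
proof -
  have d: "(f \<circ> inv_into U \<xi> has_derivative frechet_derivative (f \<circ> inv_into U \<xi>) (at (\<xi> x))) (at (\<xi> x))"
    if "smooth f" for f :: "'m \<Rightarrow> real"
    using that smooth_at_chart_iff[OF U, of f]
      smooth_near_imp_differentiable[of "f \<circ> inv_into U \<xi>" "\<xi> x"]
    by (simp only: smooth_iff frechet_derivative_works[symmetric])
  show ?thesis
    unfolding tangent_space_def mem_Collect_eq
  proof (intro conjI allI impI)
    fix f :: "'m \<Rightarrow> real" assume "\<not> smooth f"
    then show "coord_field M U \<xi> e x f = 0" by (simp add: coord_field_def)
  next
    fix f g :: "'m \<Rightarrow> real" assume f: "smooth f" and g: "smooth g"
    have "smooth (\<lambda>y. f y + g y)" using f g by (simp add: smooth_iff smooth_at_add)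
    moreover have "frechet_derivative ((\<lambda>y. f y + g y) \<circ> inv_into U \<xi>) (at (\<xi> x))
        = (\<lambda>e. frechet_derivative (f \<circ> inv_into U \<xi>) (at (\<xi> x)) e
          + frechet_derivative (g \<circ> inv_into U \<xi>) (at (\<xi> x)) e)"
      by (rule sym, rule frechet_derivative_at)
        (use has_derivative_add[OF d[OF f] d[OF g]] in \<open>simp add: comp_def\<close>)
    ultimately show "coord_field M U \<xi> e x (\<lambda>y. f y + g y)
        = coord_field M U \<xi> e x f + coord_field M U \<xi> e x g"
      using f g by (simp add: coord_field_eq)
    have "smooth (\<lambda>y. f y * g y)" using f g by (simp add: smooth_iff smooth_at_mult)
    moreover have "frechet_derivative ((\<lambda>y. f y * g y) \<circ> inv_into U \<xi>) (at (\<xi> x))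
        = (\<lambda>e. (f \<circ> inv_into U \<xi>) (\<xi> x) * frechet_derivative (g \<circ> inv_into U \<xi>) (at (\<xi> x)) e
          + frechet_derivative (f \<circ> inv_into U \<xi>) (at (\<xi> x)) e * (g \<circ> inv_into U \<xi>) (\<xi> x))"
      by (rule sym, rule frechet_derivative_at)
        (use has_derivative_mult[OF d[OF f] d[OF g]] in \<open>simp add: comp_def\<close>)
    ultimately show "coord_field M U \<xi> e x (\<lambda>y. f y * g y)
        = coord_field M U \<xi> e x f * g x + f x * coord_field M U \<xi> e x g"
      using f g by (simp add: coord_field_eq chart_inv[OF U])
  next
    fix f :: "'m \<Rightarrow> real" and c assume f: "smooth f"
    have "smooth (\<lambda>y. c * f y)" using f by (simp add: smooth_iff smooth_at_mult smooth_at_const)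
    moreover have "frechet_derivative ((\<lambda>y. c * f y) \<circ> inv_into U \<xi>) (at (\<xi> x))
        = (\<lambda>e. c * frechet_derivative (f \<circ> inv_into U \<xi>) (at (\<xi> x)) e)"
      by (rule sym, rule frechet_derivative_at)
        (use has_derivative_mult_right[OF d[OF f]] in \<open>simp add: comp_def\<close>)
    ultimately show "coord_field M U \<xi> e x (\<lambda>y. c * f y) = c * coord_field M U \<xi> e x f"
      using f by (simp add: coord_field_eq)
  qed
qed

text \<open>
  Hadamard's lemma writes a smooth function near \<open>x\<close> as its value at \<open>x\<close> plus products of
  functions one of which is a coordinate vanishing at \<open>x\<close>; so a point derivation is determined by
  its values on coordinates.
\<close>

lemma tangent_expand:
  assumes U: "(U, \<xi>) \<in> charts M" and \<zeta>: "coordinates_near U \<xi> N \<zeta>" "x \<in> N"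
    and v: "v \<in> tangent_space M x"
  shows "v = (\<lambda>f. \<Sum>e\<in>frame M. v (\<zeta> e) * coord_field M U \<xi> e x f)"
proof
  fix f :: "'m \<Rightarrow> real"
  have N: "open N" "N \<subseteq> U" and s\<zeta>: "\<And>e. smooth (\<zeta> e)" and \<zeta>eq: "\<And>y e. y \<in> N \<Longrightarrow> \<zeta> e y = \<xi> y \<bullet> e"
    using \<zeta> by (auto simp: coordinates_near_def)
  have xU: "x \<in> U" using N \<zeta>(2) by blast
  show "v f = (\<Sum>e\<in>frame M. v (\<zeta> e) * coord_field M U \<xi> e x f)"
  proof (cases "smooth f")
    case False
    then show ?thesis using tangent_junk[OF v] by (simp add: coord_field_def)
  next
    case f: True
    have "open (\<xi> ` (U \<inter> N))" "\<xi> x \<in> \<xi> ` (U \<inter> N)"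
      using chart_open_image[OF U N(1)] xU \<zeta>(2) by auto
    then obtain r where r: "0 < r" "ball (\<xi> x) r \<subseteq> \<xi> ` (U \<inter> N)"
      unfolding open_contains_ball by blast
    have "smooth_on (ball (\<xi> x) r) (f \<circ> inv_into U \<xi>)"
    proof -
      have "smooth_near (f \<circ> inv_into U \<xi>) z" if "z \<in> ball (\<xi> x) r" for z
      proof -
        from that r(2) obtain y where "y \<in> U" "z = \<xi> y" by blast
        then show ?thesis using f smooth_at_chart_iff[OF U, of y f] by (simp only: smooth_iff)
      qed
      then show ?thesis by (simp add: smooth_on_iff_smooth_near)
    qed
    from Hadamard[OF frame this r(1)] obtain h where h: "\<And>e. smooth_on (ball (\<xi> x) r) (h e)"
      "\<And>e. h e (\<xi> x) = frechet_derivative (f \<circ> inv_into U \<xi>) (at (\<xi> x)) e"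
      "\<And>z. z \<in> ball (\<xi> x) r \<Longrightarrow> (f \<circ> inv_into U \<xi>) z = (f \<circ> inv_into U \<xi>) (\<xi> x)
        + (\<Sum>e\<in>frame M. ((z - \<xi> x) \<bullet> e) * h e z)" by blast
    define W where "W = U \<inter> \<xi> -` ball (\<xi> x) r"
    have W: "open W" "x \<in> W"
      using chart_open_preimage[OF U open_ball] xU r(1) by (auto simp: W_def)
    have sm: "smooth_at M (\<lambda>y. h e (\<xi> y)) y" if y: "y \<in> W" for y e
    proof -
      have "smooth_near (h e) (\<xi> y)"
        using h(1)[of e] y unfolding smooth_near_def W_def by (intro exI[of _ "ball (\<xi> x) r"]) simp
      moreover have yU: "y \<in> U" using y by (simp add: W_def)
      ultimately have "smooth_near ((\<lambda>y. h e (\<xi> y)) \<circ> inv_into U \<xi>) (\<xi> y)"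
        by (elim smooth_near_cong[OF _ chart_homeomorphism(2)[OF U]]) (use chart_inv[OF U] in auto)
      then show ?thesis unfolding smooth_at_chart_iff[OF U yU] .
    qed
    \<comment> \<open>\<open>v\<close> acts on global functions only, so the Hadamard factors are
      replaced by global functions with the same germs at \<open>x\<close>.\<close>
    have "\<forall>e. \<exists>g N. smooth g \<and> open N \<and> x \<in> N \<and> (\<forall>y\<in>N. g y = h e (\<xi> y))"
      using ex_smooth_extension[OF W sm] by metis
    then obtain H N' where H: "\<And>e. smooth (H e)" "\<And>e. open (N' e)" "\<And>e. x \<in> N' e"
      "\<And>e y. y \<in> N' e \<Longrightarrow> H e y = h e (\<xi> y)" by metis
    let ?g = "\<lambda>y. f x + (\<Sum>e\<in>frame M. (\<zeta> e y - \<zeta> e x) * H e y)"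
    have sg: "smooth (\<lambda>y. (\<zeta> e y - \<zeta> e x) * H e y)" "smooth (\<lambda>y. \<zeta> e y - \<zeta> e x)" for e
      using s\<zeta> H(1) unfolding smooth_iff by (auto intro!: smooth_at_intros)
    have ss: "smooth (\<lambda>y. \<Sum>e\<in>frame M. (\<zeta> e y - \<zeta> e x) * H e y)"
      using sg(1) unfolding smooth_iff by (intro allI smooth_at_sum) blast
    have sc: "smooth (\<lambda>y. f x)" by (simp add: smooth_iff smooth_at_const)
    have "v f = v ?g"
    proof (rule tangent_local[OF v f])
      show "smooth ?g" using ss sc unfolding smooth_iff by (intro allI smooth_at_add) auto
      show "open (W \<inter> N \<inter> (\<Inter>e\<in>frame M. N' e))"
        using W N H(2) finite_frame by (intro open_Int open_INT) auto
      show "x \<in> W \<inter> N \<inter> (\<Inter>e\<in>frame M. N' e)" using W \<zeta>(2) H(3) by blast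
      fix y assume y: "y \<in> W \<inter> N \<inter> (\<Inter>e\<in>frame M. N' e)"
      then have "f y = f x + (\<Sum>e\<in>frame M. ((\<xi> y - \<xi> x) \<bullet> e) * h e (\<xi> y))"
        using h(3)[of "\<xi> y"] chart_inv[OF U] xU by (simp add: W_def)
      also have "(\<Sum>e\<in>frame M. ((\<xi> y - \<xi> x) \<bullet> e) * h e (\<xi> y))
          = (\<Sum>e\<in>frame M. (\<zeta> e y - \<zeta> e x) * H e y)"
        using y H(4) \<zeta>eq \<zeta>(2) by (intro sum.cong) (auto simp: inner_diff_left)
      finally show "f y = ?g y" .
    qed
    also have "\<dots> = (\<Sum>e\<in>frame M. v (\<lambda>y. (\<zeta> e y - \<zeta> e x) * H e y))"
      using tangent_add[OF v sc ss] tangent_const[OF v] tangent_sum[OF v sg(1)] by simp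
    also have "\<dots> = (\<Sum>e\<in>frame M. v (\<zeta> e) * coord_field M U \<xi> e x f)"
    proof (rule sum.cong[OF refl])
      fix e
      have "smooth (\<lambda>y. \<zeta> e x)" by (simp add: smooth_iff smooth_at_const)
      then have "v (\<lambda>y. \<zeta> e y - \<zeta> e x) = v (\<zeta> e)"
        using tangent_diff[OF v s\<zeta>] tangent_const[OF v] by simp
      moreover have "H e x = coord_field M U \<xi> e x f"
        using H(3,4) h(2) coord_field_eq[OF f] by simp
      ultimately show "v (\<lambda>y. (\<zeta> e y - \<zeta> e x) * H e y) = v (\<zeta> e) * coord_field M U \<xi> e x f"
        using tangent_mult[OF v sg(2) H(1)] by simp
    qed
    finally show ?thesis .
  qed
qed

lemma coord_field_coordinates:
  assumes U: "(U, \<xi>) \<in> charts M" and \<zeta>: "coordinates_near U \<xi> N \<zeta>" "x \<in> N"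
    and e: "e \<in> frame M" "e' \<in> frame M"
  shows "coord_field M U \<xi> e x (\<zeta> e') = (if e = e' then 1 else 0)"
proof -
  have N: "open N" "N \<subseteq> U" and s\<zeta>: "\<And>e. smooth (\<zeta> e)" and \<zeta>eq: "\<And>y e. y \<in> N \<Longrightarrow> \<zeta> e y = \<xi> y \<bullet> e"
    using \<zeta> by (auto simp: coordinates_near_def)
  have "((\<lambda>z. z \<bullet> e') has_derivative (\<lambda>v. v \<bullet> e')) (at (\<xi> x))"
    by (intro bounded_linear_imp_has_derivative bounded_linear_inner_left)
  then have "(\<zeta> e' \<circ> inv_into U \<xi> has_derivative (\<lambda>v. v \<bullet> e')) (at (\<xi> x))"
  proof (rule has_derivative_transform_within_open)
    show "open (\<xi> ` (U \<inter> N))" by (rule chart_open_image[OF U N(1)])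
    show "\<xi> x \<in> \<xi> ` (U \<inter> N)" using N(2) \<zeta>(2) by blast
  qed (use \<zeta>eq chart_inv[OF U] in auto)
  then have "frechet_derivative (\<zeta> e' \<circ> inv_into U \<xi>) (at (\<xi> x)) = (\<lambda>v. v \<bullet> e')"
    using frechet_derivative_at by metis
  then show ?thesis using frame e by (simp add: coord_field_eq[OF s\<zeta>] orthonormal_frame_def)
qed


subsection \<open>Vector fields\<close>

text \<open>A criterion free of charts, under which cutting off is easy. The coefficients in a chart
  are recovered as the values of \<open>X\<close> on cut-off coordinates.\<close>

lemma vector_field_iff:
  "X \<in> vector_fields M \<longleftrightarrow>
     (\<forall>x. X x \<in> tangent_space M x) \<and> (\<forall>f. smooth f \<longrightarrow> smooth (\<lambda>x. X x f))"
proof (intro iffI conjI)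
  assume X: "X \<in> vector_fields M"
  then show "\<forall>x. X x \<in> tangent_space M x" by (simp add: vector_fields_def)
  show "\<forall>f. smooth f \<longrightarrow> smooth (\<lambda>x. X x f)"
    unfolding smooth_iff[of "\<lambda>x. X x _"]
  proof (intro allI impI)
    fix f :: "'m \<Rightarrow> real" and x assume f: "smooth f"
    obtain U \<xi> where U: "(U, \<xi>) \<in> charts M" "x \<in> U" by (rule ex_chart)
    have opU: "open U" by (rule chart_homeomorphism(1)[OF U(1)])
    from X U obtain c where c: "\<forall>e\<in>frame M. smooth_fun_on M U (c e)"
      "\<forall>x\<in>U. X x = (\<lambda>f. \<Sum>e\<in>frame M. c e x * coord_field M U \<xi> e x f)"
      unfolding vector_fields_def by blast
    have "smooth_at M (\<lambda>x. \<Sum>e\<in>frame M. c e x * coord_field M U \<xi> e x f) x"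
      using c(1) U f by (intro smooth_at_sum smooth_at_mult coord_field_smooth_at)
        (auto simp: smooth_fun_on_iff[OF opU])
    then show "smooth_at M (\<lambda>x. X x f) x"
      by (rule smooth_at_cong[OF _ opU U(2)]) (use c(2) in auto)
  qed
next
  assume X: "(\<forall>x. X x \<in> tangent_space M x) \<and> (\<forall>f. smooth f \<longrightarrow> smooth (\<lambda>x. X x f))"
  have "\<exists>c. (\<forall>e\<in>frame M. smooth_fun_on M U (c e)) \<and>
        (\<forall>x\<in>U. X x = (\<lambda>f. \<Sum>e\<in>frame M. c e x * coord_field M U \<xi> e x f))"
    if U: "(U, \<xi>) \<in> charts M" for U \<xi>
  proof -
    have "\<forall>x\<in>U. \<exists>\<zeta> N. coordinates_near U \<xi> N \<zeta> \<and> x \<in> N" using ex_coordinates[OF U] by metis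
    then obtain \<zeta> N where \<zeta>: "\<And>x. x \<in> U \<Longrightarrow> coordinates_near U \<xi> (N x) (\<zeta> x) \<and> x \<in> N x" by metis
    have opU: "open U" by (rule chart_homeomorphism(1)[OF U])
    \<comment> \<open>The cut-off coordinates vary with \<open>y\<close>, but for \<open>y\<close>
      near \<open>x\<close> the functions \<open>\<zeta> x e\<close> and \<open>\<zeta> y e\<close>
      have the same germ at \<open>y\<close>, so \<open>X y\<close> does not distinguish
      them.\<close>
    have "smooth_at M (\<lambda>y. X y (\<zeta> y e)) x" if x: "x \<in> U" for x e
    proof (rule smooth_at_cong[where f = "\<lambda>y. X y (\<zeta> x e)" and N = "N x"])
      have "smooth (\<zeta> x e)" using \<zeta>[OF x] by (simp add: coordinates_near_def)
      then have "smooth (\<lambda>y. X y (\<zeta> x e))" using X by blast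
      then show "smooth_at M (\<lambda>y. X y (\<zeta> x e)) x" by (simp only: smooth_iff)
      show "open (N x)" "x \<in> N x" using \<zeta>[OF x] by (auto simp: coordinates_near_def)
      fix y assume y: "y \<in> N x"
      then have yU: "y \<in> U" using \<zeta>[OF x] by (auto simp: coordinates_near_def)
      show "X y (\<zeta> x e) = X y (\<zeta> y e)"
      proof (rule tangent_local[of "X y" y])
        show "X y \<in> tangent_space M y" using X by blast
        show "open (N x \<inter> N y)" using \<zeta>[OF x] \<zeta>[OF yU] by (auto simp: coordinates_near_def)
      qed (use \<zeta>[OF x] \<zeta>[OF yU] y in \<open>auto simp: coordinates_near_def\<close>)
    qed
    then have "smooth_fun_on M U (\<lambda>y. X y (\<zeta> y e))" for e by (simp add: smooth_fun_on_iff[OF opU])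
    moreover have "X x = (\<lambda>f. \<Sum>e\<in>frame M. X x (\<zeta> x e) * coord_field M U \<xi> e x f)" if "x \<in> U" for x
      using tangent_expand[OF U, of "N x" "\<zeta> x"] \<zeta>[OF that] X by blast
    ultimately show ?thesis by (intro exI[of _ "\<lambda>e y. X y (\<zeta> y e)"]) blast
  qed
  then show "X \<in> vector_fields M" using X unfolding vector_fields_def by blast
qed

lemma vector_field_lincomb:
  assumes "X \<in> vector_fields M" "Y \<in> vector_fields M" "smooth a" "smooth b"
  shows "(\<lambda>x f. a x * X x f + b x * Y x f) \<in> vector_fields M"
  using assms unfolding vector_field_iff
  by (auto simp: tangent_lincomb smooth_iff[of "\<lambda>x. _ x + _ x"] smooth_iff[of a] smooth_iff[of b]
      smooth_iff[of "\<lambda>x. X x _"] smooth_iff[of "\<lambda>x. Y x _"] intro!: smooth_at_intros)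

lemma vector_field_sum:
  assumes "finite I" "\<And>i. i \<in> I \<Longrightarrow> X i \<in> vector_fields M" "\<And>i. i \<in> I \<Longrightarrow> smooth (a i)"
  shows "(\<lambda>x f. \<Sum>i\<in>I. a i x * X i x f) \<in> vector_fields M"
  using assms
proof induction
  case empty
  show ?case by (simp add: vector_field_iff tangent_zero smooth_iff smooth_at_const)
next
  case (insert i I)
  have "(\<lambda>x f. a i x * X i x f + 1 * (\<Sum>i\<in>I. a i x * X i x f)) \<in> vector_fields M"
    using insert by (intro vector_field_lincomb) (auto simp: smooth_iff smooth_at_const)
  then show ?case using insert by simp
qed

definition cutoff_field :: "'m set \<Rightarrow> ('m \<Rightarrow> 'e) \<Rightarrow> ('m \<Rightarrow> real) \<Rightarrow> 'e \<Rightarrow> 'm \<Rightarrow> 'm tvec" where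
  "cutoff_field U \<xi> \<phi> e x = (\<lambda>f. if x \<in> U then \<phi> x * coord_field M U \<xi> e x f else 0)"

lemma cutoff_field_in:
  assumes U: "(U, \<xi>) \<in> charts M" and \<phi>: "smooth \<phi>" "closed K" "K \<subseteq> U" "\<And>y. y \<notin> K \<Longrightarrow> \<phi> y = 0"
  shows "cutoff_field U \<xi> \<phi> e \<in> vector_fields M"
  unfolding vector_field_iff
proof (intro conjI allI impI)
  show "cutoff_field U \<xi> \<phi> e x \<in> tangent_space M x" for x
    using tangent_lincomb[OF coord_field_tangent[OF U] tangent_zero, of x "\<phi> x" e 0]
    by (cases "x \<in> U") (simp_all add: cutoff_field_def tangent_zero)
  fix f :: "'m \<Rightarrow> real" assume f: "smooth f"
  show "smooth (\<lambda>x. cutoff_field U \<xi> \<phi> e x f)"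
    unfolding smooth_iff
  proof
    fix x
    show "smooth_at M (\<lambda>x. cutoff_field U \<xi> \<phi> e x f) x"
    proof (cases "x \<in> U")
      case True
      have "smooth_at M (\<lambda>x. \<phi> x * coord_field M U \<xi> e x f) x"
        using \<phi>(1) coord_field_smooth_at[OF U True f] by (intro smooth_at_mult) (simp_all add: smooth_iff)
      then show ?thesis
        by (rule smooth_at_cong[OF _ chart_homeomorphism(1)[OF U] True]) (simp add: cutoff_field_def)
    next
      case False
      show ?thesis
      proof (rule smooth_at_cong[OF smooth_at_const])
        show "open (- K)" using \<phi>(2) by blast
      qed (use False \<phi>(3,4) in \<open>auto simp: cutoff_field_def\<close>)
    qed
  qed
qed

text \<open>Guarantees that the choice inside \<open>local_nabla\<close> has a candidate.\<close>

lemma ex_local_vector_field: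
  assumes U: "(U, \<xi>) \<in> charts M" "x \<in> U"
  obtains X N where "X \<in> vector_fields M" "open N" "x \<in> N" "N \<subseteq> U"
    "\<And>y. y \<in> N \<Longrightarrow> X y = coord_field M U \<xi> e y"
proof -
  from chart_homeomorphism(1)[OF U(1)] U(2) obtain \<phi> :: "'m \<Rightarrow> real" and N K where \<phi>: "smooth \<phi>"
    "\<And>y. 0 \<le> \<phi> y" "open N" "x \<in> N" "N \<subseteq> K" "\<And>y. y \<in> N \<Longrightarrow> \<phi> y = 1"
    "compact K" "closed K" "K \<subseteq> U" "\<And>y. y \<notin> K \<Longrightarrow> \<phi> y = 0" by (rule ex_bump) blast
  show ?thesis
  proof (rule that)
    show "cutoff_field U \<xi> \<phi> e \<in> vector_fields M" by (rule cutoff_field_in[OF U(1) \<phi>(1,8,9,10)])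
    show "open N" "x \<in> N" "N \<subseteq> U" using \<phi> by auto
    show "cutoff_field U \<xi> \<phi> e y = coord_field M U \<xi> e y" if "y \<in> N" for y
      using that \<phi>(5,6,9) by (auto simp: cutoff_field_def)
  qed
qed

lemma ex_vector_field_through:
  assumes v: "v \<in> tangent_space M x"
  obtains X where "X \<in> vector_fields M" "X x = v"
proof -
  obtain U \<xi> where U: "(U, \<xi>) \<in> charts M" "x \<in> U" by (rule ex_chart)
  obtain \<zeta> N where \<zeta>: "coordinates_near U \<xi> N \<zeta>" "x \<in> N" using ex_coordinates[OF U] by blast
  have "\<forall>e. \<exists>X. X \<in> vector_fields M \<and> X x = coord_field M U \<xi> e x"
    using ex_local_vector_field[OF U] by metis
  then obtain X where X: "\<And>e. X e \<in> vector_fields M" "\<And>e. X e x = coord_field M U \<xi> e x" by metis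
  have "(\<lambda>x f. \<Sum>e\<in>frame M. v (\<zeta> e) * X e x f) \<in> vector_fields M"
    using vector_field_sum[OF finite_frame, of X "\<lambda>e _. v (\<zeta> e)"] X(1)
    by (simp add: smooth_iff smooth_at_const)
  moreover have "(\<lambda>f. \<Sum>e\<in>frame M. v (\<zeta> e) * X e x f) = v"
    using tangent_expand[OF U(1) \<zeta> v] X(2) by simp
  ultimately show ?thesis using that by blast
qed

text \<open>
  Near \<open>x\<close>, \<open>\<phi>\<^sup>2X\<close> is a combination of the global vector fields \<open>\<phi>\<partial>\<^sub>e\<close> whose coefficients vanish at
  \<open>x\<close> if \<open>X\<close> does.
\<close>

lemma vector_field_vanishing:
  assumes X: "X \<in> vector_fields M" and X0: "X x = (\<lambda>f. 0)"
  obtains b a Z where "smooth b" "b x = 0" "\<And>e. smooth (a e)" "\<And>e. a e x = 0"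
    "\<And>e. Z e \<in> vector_fields M"
    "X = (\<lambda>y f. b y * X y f + (\<Sum>e\<in>frame M. a e y * Z e y f))"
proof -
  obtain U \<xi> where U: "(U, \<xi>) \<in> charts M" "x \<in> U" by (rule ex_chart)
  obtain \<zeta> N where \<zeta>: "coordinates_near U \<xi> N \<zeta>" "x \<in> N" using ex_coordinates[OF U] by blast
  have N: "open N" "N \<subseteq> U" "\<And>e. smooth (\<zeta> e)" using \<zeta> by (auto simp: coordinates_near_def)
  from N(1) \<zeta>(2) obtain \<phi> :: "'m \<Rightarrow> real" and N' K where \<phi>: "smooth \<phi>"
    "\<And>y. 0 \<le> \<phi> y" "open N'" "x \<in> N'" "N' \<subseteq> K" "\<And>y. y \<in> N' \<Longrightarrow> \<phi> y = 1"
    "compact K" "closed K" "K \<subseteq> N" "\<And>y. y \<notin> K \<Longrightarrow> \<phi> y = 0" by (rule ex_bump) blast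
  show ?thesis
  proof (rule that)
    show "smooth (\<lambda>y. 1 - \<phi> y * \<phi> y)" using \<phi>(1) by (auto simp: smooth_iff intro!: smooth_at_intros)
    show "1 - \<phi> x * \<phi> x = 0" using \<phi>(4,6) by simp
    show "smooth (\<lambda>y. \<phi> y * X y (\<zeta> e))" for e
      using X \<phi>(1) N(3)[of e] unfolding vector_field_iff
      by (auto simp: smooth_iff[of \<phi>] smooth_iff[of "\<lambda>y. X y (\<zeta> e)"] smooth_iff[of "\<lambda>y. \<phi> y * _ y"]
          intro!: smooth_at_mult)
    show "\<phi> x * X x (\<zeta> e) = 0" for e using X0 by simp
    show "cutoff_field U \<xi> \<phi> e \<in> vector_fields M" for e
      using \<phi>(9) N(2) by (intro cutoff_field_in[OF U(1) \<phi>(1,8) _ \<phi>(10)]) auto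
    show "X = (\<lambda>y f. (1 - \<phi> y * \<phi> y) * X y f
        + (\<Sum>e\<in>frame M. \<phi> y * X y (\<zeta> e) * cutoff_field U \<xi> \<phi> e y f))"
    proof (intro ext)
      fix y f
      show "X y f = (1 - \<phi> y * \<phi> y) * X y f
          + (\<Sum>e\<in>frame M. \<phi> y * X y (\<zeta> e) * cutoff_field U \<xi> \<phi> e y f)"
      proof (cases "y \<in> K")
        case True
        then have y: "y \<in> N" "y \<in> U" using \<phi>(9) N(2) by auto
        have "X y \<in> tangent_space M y" using X by (simp add: vector_fields_def)
        from fun_cong[OF tangent_expand[OF U(1) \<zeta>(1) y(1) this], of f]
        have "\<phi> y * \<phi> y * X y f = (\<Sum>e\<in>frame M. \<phi> y * X y (\<zeta> e) * cutoff_field U \<xi> \<phi> e y f)"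
          using y(2) by (simp add: cutoff_field_def sum_distrib_left mult_ac)
        then show ?thesis by (simp add: algebra_simps)
      next
        case False
        then show ?thesis using \<phi>(10) by simp
      qed
    qed
  qed
qed

end


section \<open>Finitely coloured covers\<close>

lemma disjoint_compact_separation:
  fixes S T :: "'a::t2_space set"
  assumes "compact S" "compact T" "S \<inter> T = {}"
  obtains A B where "open A" "open B" "S \<subseteq> A" "T \<subseteq> B" "A \<inter> B = {}"
proof -
  have "Hausdorff_space (euclidean :: 'a topology)"
    unfolding Hausdorff_space_def disjnt_def by (simp add: separation_t2)
  from Hausdorff_space_compact_separation[OF this, of S T] assms that show ?thesis
    by (auto simp: disjnt_def)
qed

text \<open>Gives the compact pieces of one colour disjoint open neighbourhoods, on which bumps and
  trivializations can be chosen piece by piece. In the induction the new set is separated from the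
  union of the others.\<close>

lemma finite_disjoint_compact_separation:
  fixes \<C> :: "'a::t2_space set set"
  assumes "finite \<C>" "\<And>C. C \<in> \<C> \<Longrightarrow> compact C" "disjoint \<C>"
  shows "\<exists>P. (\<forall>C\<in>\<C>. open (P C) \<and> C \<subseteq> P C) \<and> disjoint_family_on P \<C>"
  using assms
proof induction
  case empty
  show ?case by (simp add: disjoint_family_on_def)
next
  case (insert D \<C>)
  have "disjoint \<C>" using insert.prems(2) by (simp add: disjoint_def)
  then obtain P where P: "\<And>C. C \<in> \<C> \<Longrightarrow> open (P C) \<and> C \<subseteq> P C" "disjoint_family_on P \<C>"
    using insert by auto
  have "compact D" using insert by simp
  moreover have "compact (\<Union>\<C>)" using insert by (intro compact_Union) auto
  moreover have "D \<inter> \<Union>\<C> = {}" using insert unfolding disjoint_def by fastforce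
  ultimately obtain A B where AB: "open A" "open B" "D \<subseteq> A" "\<Union>\<C> \<subseteq> B" "A \<inter> B = {}"
    by (rule disjoint_compact_separation)
  let ?P = "\<lambda>C. if C = D then A else P C \<inter> B"
  have "\<forall>C\<in>insert D \<C>. open (?P C) \<and> C \<subseteq> ?P C" using P AB by auto
  moreover have "disjoint_family_on ?P (insert D \<C>)"
    unfolding disjoint_family_on_def
  proof (intro ballI impI)
    fix C C' assume "C \<in> insert D \<C>" "C' \<in> insert D \<C>" "C \<noteq> C'"
    then consider "C = D" "C' \<noteq> D" | "C' = D" "C \<noteq> D" | "C \<in> \<C>" "C' \<in> \<C>" "C \<noteq> D" "C' \<noteq> D" by blast
    then show "?P C \<inter> ?P C' = {}"
    proof cases
      case 3
      then have "P C \<inter> P C' = {}" using P(2) \<open>C \<noteq> C'\<close> by (simp add: disjoint_family_on_def)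
      then show ?thesis using 3 by auto
    qed (use AB(5) in auto)
  qed
  ultimately show ?case by (intro exI[of _ ?P] conjI)
qed

context smooth_mfd
begin

text \<open>
  The compact set \<open>K\<close> has covering dimension at most \<open>2\<^sup>m - 1\<close>: for every open cover it is the
  union of \<open>2\<^sup>m\<close> finite disjoint families of compact sets subordinate to the cover. The
  colours are the sets of frame vectors along which a grid cell has odd coordinate.
\<close>

definition colourable :: "'m set \<Rightarrow> bool" where
  "colourable K \<longleftrightarrow> (\<forall>\<W>. (\<forall>W\<in>\<W>. open W) \<longrightarrow> \<Union>\<W> = UNIV \<longrightarrow>
     (\<exists>F :: 'e set \<Rightarrow> 'm set set.
        (\<forall>i. finite (F i) \<and> disjoint (F i) \<and> (\<forall>C\<in>F i. compact C \<and> C \<subseteq> K \<and> (\<exists>W\<in>\<W>. C \<subseteq> W))) \<and>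
        K \<subseteq> (\<Union>i\<in>Pow (frame M). \<Union>(F i))))"

lemma colourableE:
  assumes "colourable K" "\<forall>W\<in>\<W>. open W" "\<Union>\<W> = UNIV"
  obtains F :: "'e set \<Rightarrow> 'm set set" where "\<And>i. finite (F i)" "\<And>i. disjoint (F i)"
    "\<And>i C. C \<in> F i \<Longrightarrow> compact C \<and> C \<subseteq> K \<and> (\<exists>W\<in>\<W>. C \<subseteq> W)"
    "K \<subseteq> (\<Union>i\<in>Pow (frame M). \<Union>(F i))"
proof -
  from assms have "\<exists>F :: 'e set \<Rightarrow> 'm set set. (\<forall>i. finite (F i) \<and> disjoint (F i) \<and>
      (\<forall>C\<in>F i. compact C \<and> C \<subseteq> K \<and> (\<exists>W\<in>\<W>. C \<subseteq> W))) \<and> K \<subseteq> (\<Union>i\<in>Pow (frame M). \<Union>(F i))"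
    unfolding colourable_def by simp
  then show ?thesis using that by (elim exE conjE) blast
qed

lemma colourable_empty: "colourable {}"
  unfolding colourable_def by (intro allI impI exI[of _ "\<lambda>_. {}"]) (simp add: disjoint_def)

text \<open>
  The second family is chosen so fine that each of its members meets at most one member \<open>C\<close> of
  the first family of the same colour, and then lies in the neighbourhood \<open>P C\<close>; it is merged
  with \<open>C\<close>.
\<close>

lemma colourable_Un:
  assumes "colourable K1" "colourable K2"
  shows "colourable (K1 \<union> K2)"
  unfolding colourable_def
proof (intro allI impI)
  fix \<W> :: "'m set set"
  assume W: "\<forall>W\<in>\<W>. open W" "\<Union>\<W> = UNIV"
  from assms(1) W obtain F :: "'e set \<Rightarrow> 'm set set" where F: "\<And>i. finite (F i)" "\<And>i. disjoint (F i)"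
    "\<And>i C. C \<in> F i \<Longrightarrow> compact C \<and> C \<subseteq> K1 \<and> (\<exists>W\<in>\<W>. C \<subseteq> W)"
    "K1 \<subseteq> (\<Union>i\<in>Pow (frame M). \<Union>(F i))" by (rule colourableE) blast+
  have "\<forall>i. \<exists>P. (\<forall>C\<in>F i. open (P C) \<and> C \<subseteq> P C) \<and> disjoint_family_on P (F i)"
    using finite_disjoint_compact_separation[OF F(1) _ F(2)] F(3) by blast
  then obtain Q where Q: "\<And>i C. C \<in> F i \<Longrightarrow> open (Q i C) \<and> C \<subseteq> Q i C"
    "\<And>i. disjoint_family_on (Q i) (F i)" by metis
  define w where "w i C = (SOME W. W \<in> \<W> \<and> C \<subseteq> W)" for i :: "'e set" and C
  have w: "w i C \<in> \<W> \<and> C \<subseteq> w i C" if "C \<in> F i" for i C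
    unfolding w_def by (rule someI_ex) (use F(3)[OF that] in blast)
  define P where "P i C = Q i C \<inter> w i C" for i C
  have P: "open (P i C)" "C \<subseteq> P i C" if "C \<in> F i" for i C
    using Q(1)[OF that] w[OF that] W(1) unfolding P_def by auto
  have Pd: "P i C \<inter> P i C' = {}" if "C \<in> F i" "C' \<in> F i" "C \<noteq> C'" for i C C'
    using Q(2) that unfolding P_def disjoint_family_on_def by blast
  have "\<forall>x. \<exists>W\<in>\<W>. x \<in> W" using W(2) by blast
  then obtain u where u: "\<And>x. u x \<in> \<W> \<and> x \<in> u x" by metis
  \<comment> \<open>A subset of \<open>N x\<close> can meet a member \<open>C\<close> of the first
    family only if \<open>x\<close> lies in \<open>C\<close>, and then it lies in
    \<open>P i C\<close>. The second family is made subordinate to the cover by these sets.\<close>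
  define N where "N x = u x \<inter> (\<Inter>i\<in>Pow (frame M). \<Inter>C\<in>F i. if x \<in> C then P i C else - C)" for x
  have openN: "open (N x)" for x
  proof -
    have "open (if x \<in> C then P i C else - C)" if "C \<in> F i" for i C
      using P(1)[OF that] F(3)[OF that] compact_imp_closed by auto
    moreover have "open (u x)" using u W(1) by blast
    moreover have "finite (Pow (frame M))" using finite_frame by simp
    ultimately show ?thesis unfolding N_def using F(1) by (intro open_Int open_INT ballI)
  qed
  moreover have xN: "x \<in> N x" for x unfolding N_def using u P(2) by auto
  ultimately have "\<forall>W\<in>range N. open W" "\<Union>(range N) = UNIV" by auto
  with assms(2) obtain G :: "'e set \<Rightarrow> 'm set set" where G: "\<And>i. finite (G i)" "\<And>i. disjoint (G i)"
    "\<And>i C. C \<in> G i \<Longrightarrow> compact C \<and> C \<subseteq> K2 \<and> (\<exists>W\<in>range N. C \<subseteq> W)"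
    "K2 \<subseteq> (\<Union>i\<in>Pow (frame M). \<Union>(G i))" by (rule colourableE) blast+
  have near: "B \<subseteq> P i C" if "i \<in> Pow (frame M)" "C \<in> F i" "B \<in> G i" "B \<inter> C \<noteq> {}" for i B C
  proof -
    from G(3)[OF that(3)] obtain x where x: "B \<subseteq> N x" by blast
    then have "B \<subseteq> (if x \<in> C then P i C else - C)" using that(1,2) unfolding N_def by blast
    then show ?thesis using that(4) by (auto split: if_splits)
  qed
  define m where "m i C = C \<union> \<Union>{B \<in> G i. B \<inter> C \<noteq> {}}" for i C
  \<comment> \<open>\<open>N\<close> controls the colours in \<open>Pow (frame M)\<close> only; the
    others are emptied so that disjointness holds for every \<open>i\<close>.\<close>
  define H where "H i = (if i \<in> Pow (frame M)
    then m i ` F i \<union> {B \<in> G i. \<forall>C\<in>F i. B \<inter> C = {}} else {})" for i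
  have mP: "m i C \<subseteq> P i C" if "i \<in> Pow (frame M)" "C \<in> F i" for i C
    unfolding m_def using near[OF that] P(2)[OF that(2)] by blast
  have "disjoint (H i)" for i
  proof (cases "i \<in> Pow (frame M)")
    case i: True
    have 1: "m i C \<inter> m i C' = {}" if "C \<in> F i" "C' \<in> F i" "m i C \<noteq> m i C'" for C C'
      using mP[OF i that(1)] mP[OF i that(2)] Pd[OF that(1,2)] that(3) by blast
    have 2: "m i C \<inter> B = {}" if "C \<in> F i" "B \<in> G i" "\<forall>C\<in>F i. B \<inter> C = {}" for C B
      using that G(2)[of i] unfolding m_def disjoint_def by blast
    have 3: "B \<inter> B' = {}" if "B \<in> G i" "B' \<in> G i" "B \<noteq> B'" for B B'
      using that G(2)[of i] unfolding disjoint_def by blast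
    show ?thesis unfolding disjoint_def
    proof (intro ballI impI)
      fix A B assume AB: "A \<in> H i" "B \<in> H i" "A \<noteq> B"
      have "(\<exists>C\<in>F i. A = m i C) \<or> (A \<in> G i \<and> (\<forall>C\<in>F i. A \<inter> C = {}))"
        "(\<exists>C\<in>F i. B = m i C) \<or> (B \<in> G i \<and> (\<forall>C\<in>F i. B \<inter> C = {}))"
        using AB i unfolding H_def by auto
      then show "A \<inter> B = {}"
      proof (elim disjE bexE conjE)
        fix C assume "C \<in> F i" "A = m i C" "B \<in> G i" "\<forall>C\<in>F i. B \<inter> C = {}"
        then show ?thesis using 2 by simp
      next
        fix C assume "C \<in> F i" "B = m i C" "A \<in> G i" "\<forall>C\<in>F i. A \<inter> C = {}"
        then show ?thesis using 2[of C A] by (simp add: Int_commute)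
      qed (use 1 3 AB(3) in simp_all)
    qed
  qed (simp add: H_def disjoint_def)
  moreover have "finite (H i)" for i unfolding H_def using F(1) G(1) by simp
  moreover have "compact C \<and> C \<subseteq> K1 \<union> K2 \<and> (\<exists>W\<in>\<W>. C \<subseteq> W)" if "C \<in> H i" for i C
  proof -
    have i: "i \<in> Pow (frame M)" using that by (auto simp: H_def split: if_splits)
    from that i consider C' where "C' \<in> F i" "C = m i C'" | "C \<in> G i" by (auto simp: H_def)
    then show ?thesis
    proof cases
      case 1
      have "compact (m i C')" unfolding m_def
        using F(3)[OF 1(1)] G(1,3) by (intro compact_Un compact_Union) auto
      moreover have "m i C' \<subseteq> K1 \<union> K2" unfolding m_def using F(3)[OF 1(1)] G(3) by blast
      moreover have "m i C' \<subseteq> w i C'" using mP[OF i 1(1)] by (auto simp: P_def)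
      ultimately show ?thesis using w[OF 1(1)] 1(2) by blast
    next
      case 2
      from G(3)[OF 2] obtain x where "C \<subseteq> N x" by blast
      then have "C \<subseteq> u x" by (auto simp: N_def)
      then show ?thesis using G(3)[OF 2] u by blast
    qed
  qed
  moreover have "K1 \<union> K2 \<subseteq> (\<Union>i\<in>Pow (frame M). \<Union>(H i))"
  proof
    fix x assume "x \<in> K1 \<union> K2"
    then consider "x \<in> K1" | "x \<in> K2" by blast
    then show "x \<in> (\<Union>i\<in>Pow (frame M). \<Union>(H i))"
    proof cases
      case 1
      then obtain i C where "i \<in> Pow (frame M)" "C \<in> F i" "x \<in> C" using F(4) by blast
      then have "m i C \<in> H i" "x \<in> m i C" by (auto simp: H_def m_def)
      then show ?thesis using \<open>i \<in> Pow (frame M)\<close> by blast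
    next
      case 2
      then obtain i B where B: "i \<in> Pow (frame M)" "B \<in> G i" "x \<in> B" using G(4) by blast
      show ?thesis
      proof (cases "\<forall>C\<in>F i. B \<inter> C = {}")
        case True
        then have "B \<in> H i" using B by (auto simp: H_def)
        then show ?thesis using B by blast
      next
        case False
        then obtain C where "C \<in> F i" "B \<inter> C \<noteq> {}" by blast
        then have "m i C \<in> H i" "x \<in> m i C" using B by (auto simp: H_def m_def)
        then show ?thesis using B(1) by blast
      qed
    qed
  qed
  ultimately show "\<exists>F :: 'e set \<Rightarrow> 'm set set.
        (\<forall>i. finite (F i) \<and> disjoint (F i) \<and>
          (\<forall>C\<in>F i. compact C \<and> C \<subseteq> K1 \<union> K2 \<and> (\<exists>W\<in>\<W>. C \<subseteq> W))) \<and>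
        K1 \<union> K2 \<subseteq> (\<Union>i\<in>Pow (frame M). \<Union>(F i))" by blast
qed

lemma norm_le_frame:
  assumes "\<And>e. e \<in> frame M \<Longrightarrow> \<bar>y \<bullet> e\<bar> \<le> \<delta>"
  shows "norm y \<le> real (card (frame M)) * \<delta>"
proof -
  have "norm y = norm (\<Sum>e\<in>frame M. (y \<bullet> e) *\<^sub>R e)"
    using orthonormal_frame_expand[OF frame, of y] by simp
  also have "\<dots> \<le> (\<Sum>e\<in>frame M. \<delta>)"
  proof (rule order_trans[OF norm_sum], rule sum_mono)
    fix e assume e: "e \<in> frame M"
    then have "norm e = 1" using frame by (simp add: orthonormal_frame_def norm_eq_1)
    then show "norm ((y \<bullet> e) *\<^sub>R e) \<le> \<delta>" using assms[OF e] by simp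
  qed
  finally show ?thesis by simp
qed

text \<open>Grid cells whose diameter is below a Lebesgue number of the cover, taken in coordinates,
  are subordinate to it. Two distinct cells of one colour have, along some frame vector, different
  indices of the same parity, hence indices at least 2 apart, which leaves a gap even between closed
  cells.\<close>

lemma colourable_in_chart:
  assumes U: "(U, \<xi>) \<in> charts M" and K: "compact K" "K \<subseteq> U"
  shows "colourable K"
  unfolding colourable_def
proof (intro allI impI)
  fix \<W> :: "'m set set"
  assume W: "\<forall>W\<in>\<W>. open W" "\<Union>\<W> = UNIV"
  have cont: "continuous_on K \<xi>" using chart_continuous[OF U] K(2) continuous_on_subset by blast
  have comp: "compact (\<xi> ` K)" by (rule compact_continuous_image[OF cont K(1)])
  have "\<xi> ` K \<subseteq> \<Union>((\<lambda>W. \<xi> ` (U \<inter> W)) ` \<W>)" using W(2) K(2) by blast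
  moreover have "\<And>T. T \<in> (\<lambda>W. \<xi> ` (U \<inter> W)) ` \<W> \<Longrightarrow> open T"
    using W(1) chart_open_image[OF U] by blast
  ultimately obtain \<epsilon> where \<epsilon>: "0 < \<epsilon>"
    "\<And>x. x \<in> \<xi> ` K \<Longrightarrow> \<exists>T\<in>(\<lambda>W. \<xi> ` (U \<inter> W)) ` \<W>. ball x \<epsilon> \<subseteq> T"
    using Heine_Borel_lemma[OF comp] by metis
  \<comment> \<open>Points of one cell differ by at most \<delta> in each coordinate, so by less
    than \<epsilon> in norm; the added 1 covers the empty frame and makes the estimate
    strict.\<close>
  define \<delta> where "\<delta> = \<epsilon> / (real (card (frame M)) + 1)"
  have \<delta>: "0 < \<delta>" "real (card (frame M)) * \<delta> < \<epsilon>" using \<epsilon>(1) by (auto simp: \<delta>_def field_simps)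
  define cell where "cell z = {x \<in> K. \<forall>e\<in>frame M. \<delta> * of_int (z e) \<le> \<xi> x \<bullet> e \<and> \<xi> x \<bullet> e \<le> \<delta> * (of_int (z e) + 1)}"
    for z :: "'e \<Rightarrow> int"
  define Z where "Z = {z \<in> frame M \<rightarrow>\<^sub>E UNIV. cell z \<noteq> {}}"
  define F where "F i = cell ` {z \<in> Z. {e \<in> frame M. odd (z e)} = i}" for i
  have "bounded (\<xi> ` K)" by (rule compact_imp_bounded[OF comp])
  then obtain R where R: "\<And>x. x \<in> K \<Longrightarrow> norm (\<xi> x) \<le> R" unfolding bounded_iff by blast
  \<comment> \<open>The image of \<open>K\<close> under the chart is bounded, so only finitely many
    cells are nonempty.\<close>
  have "Z \<subseteq> frame M \<rightarrow>\<^sub>E {- (\<lceil>R / \<delta>\<rceil> + 1)..\<lceil>R / \<delta>\<rceil>}"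
  proof
    fix z assume z: "z \<in> Z"
    then obtain x where x: "x \<in> cell z" by (auto simp: Z_def)
    have "z e \<in> {- (\<lceil>R / \<delta>\<rceil> + 1)..\<lceil>R / \<delta>\<rceil>}" if e: "e \<in> frame M" for e
    proof -
      have "norm e = 1" using frame e by (simp add: orthonormal_frame_def norm_eq_1)
      then have "\<bar>\<xi> x \<bullet> e\<bar> \<le> R"
        using Cauchy_Schwarz_ineq2[of "\<xi> x" e] R[of x] x by (simp add: cell_def)
      moreover have "\<delta> * of_int (z e) \<le> \<xi> x \<bullet> e" "\<xi> x \<bullet> e \<le> \<delta> * (of_int (z e) + 1)"
        using x e by (auto simp: cell_def)
      ultimately have "\<delta> * of_int (z e) \<le> R" "- R \<le> \<delta> * (of_int (z e) + 1)" by linarith+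
      then have "of_int (z e) \<le> R / \<delta>" "- (R / \<delta>) \<le> of_int (z e) + 1"
        using \<delta>(1) by (auto simp: field_simps)
      then show ?thesis by (simp; linarith)
    qed
    then show "z \<in> frame M \<rightarrow>\<^sub>E {- (\<lceil>R / \<delta>\<rceil> + 1)..\<lceil>R / \<delta>\<rceil>}" using z by (auto simp: Z_def PiE_iff)
  qed
  then have "finite Z" by (rule finite_subset) (intro finite_PiE finite_frame finite_atLeastAtMost_int)
  then have fin: "finite (F i)" for i by (simp add: F_def)
  have disj: "disjoint (F i)" for i
  proof -
    have "cell z \<inter> cell z' = {}" if "z \<in> Z" "z' \<in> Z" "cell z \<noteq> cell z'"
      "{e \<in> frame M. odd (z e)} = {e \<in> frame M. odd (z' e)}" for z z'
    proof -
      note zZ = that(1,2)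
      have "z \<noteq> z'" using that by blast
      then obtain e where e: "e \<in> frame M" "z e \<noteq> z' e"
        using zZ PiE_ext[of z "frame M" "\<lambda>_. UNIV" z'] unfolding Z_def by blast
      have "odd (z e) = odd (z' e)" using that(4) e(1) by blast
      then have "z e + 2 \<le> z' e \<or> z' e + 2 \<le> z e" using e(2) by presburger
      then have lt: "of_int (z e) + 1 < (of_int (z' e) :: real) \<or> of_int (z' e) + 1 < (of_int (z e) :: real)"
        by linarith
      show ?thesis
      proof (rule ccontr)
        assume "cell z \<inter> cell z' \<noteq> {}"
        then obtain x where "x \<in> cell z" "x \<in> cell z'" by blast
        then have "\<delta> * of_int (z e) \<le> \<delta> * (of_int (z' e) + 1)" "\<delta> * of_int (z' e) \<le> \<delta> * (of_int (z e) + 1)"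
          using e(1) by (force simp: cell_def)+
        then show False using lt \<delta>(1) by simp
      qed
    qed
    then show ?thesis unfolding F_def disjoint_def by blast
  qed
  have sub: "compact C \<and> C \<subseteq> K \<and> (\<exists>W\<in>\<W>. C \<subseteq> W)" if C: "C \<in> F i" for i C
  proof -
    from C obtain z where z: "z \<in> Z" "C = cell z" by (auto simp: F_def)
    then obtain x0 where x0: "x0 \<in> cell z" by (auto simp: Z_def)
    let ?B = "\<Inter>e\<in>frame M. {y. \<delta> * of_int (z e) \<le> y \<bullet> e} \<inter> {y. y \<bullet> e \<le> \<delta> * (of_int (z e) + 1)}"
    have "closed ?B" by (intro closed_INT ballI closed_Int closed_Collect_le continuous_intros)
    then have "closedin (top_of_set K) (K \<inter> \<xi> -` ?B)" by (rule continuous_closedin_preimage[OF cont])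
    then have "compact (K \<inter> \<xi> -` ?B)" by (rule closedin_compact[OF K(1)])
    moreover have "cell z = K \<inter> \<xi> -` ?B" by (auto simp: cell_def)
    ultimately have "compact (cell z)" by simp
    moreover have "cell z \<subseteq> K" by (auto simp: cell_def)
    moreover have "\<exists>W\<in>\<W>. cell z \<subseteq> W"
    proof -
      have "\<xi> x0 \<in> \<xi> ` K" using x0 by (auto simp: cell_def)
      from \<epsilon>(2)[OF this] obtain W where W': "W \<in> \<W>" "ball (\<xi> x0) \<epsilon> \<subseteq> \<xi> ` (U \<inter> W)" by blast
      have "x \<in> W" if x: "x \<in> cell z" for x
      proof -
        have "norm (\<xi> x0 - \<xi> x) \<le> real (card (frame M)) * \<delta>"
        proof (rule norm_le_frame)
          fix e assume e: "e \<in> frame M"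
          have "\<delta> * of_int (z e) \<le> \<xi> x \<bullet> e" "\<xi> x \<bullet> e \<le> \<delta> * of_int (z e) + \<delta>"
            "\<delta> * of_int (z e) \<le> \<xi> x0 \<bullet> e" "\<xi> x0 \<bullet> e \<le> \<delta> * of_int (z e) + \<delta>"
            using x x0 e by (auto simp: cell_def distrib_left)
          then show "\<bar>(\<xi> x0 - \<xi> x) \<bullet> e\<bar> \<le> \<delta>" by (simp add: inner_diff_left abs_le_iff)
        qed
        then have "\<xi> x \<in> ball (\<xi> x0) \<epsilon>" using \<delta>(2) by (simp add: dist_norm)
        then obtain x' where "x' \<in> U" "x' \<in> W" "\<xi> x = \<xi> x'" using W'(2) by blast
        then show ?thesis using chart_inv[OF U] x K(2) by (metis (no_types, lifting) cell_def mem_Collect_eq subsetD)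
      qed
      then show ?thesis using W'(1) by blast
    qed
    ultimately show ?thesis using z(2) by blast
  qed
  have "K \<subseteq> (\<Union>i\<in>Pow (frame M). \<Union>(F i))"
  proof
    fix x assume x: "x \<in> K"
    define z where "z = (\<lambda>e\<in>frame M. \<lfloor>(\<xi> x \<bullet> e) / \<delta>\<rfloor>)"
    have "\<delta> * of_int (z e) \<le> \<xi> x \<bullet> e \<and> \<xi> x \<bullet> e \<le> \<delta> * (of_int (z e) + 1)" if "e \<in> frame M" for e
    proof -
      have "of_int (z e) \<le> (\<xi> x \<bullet> e) / \<delta>" "(\<xi> x \<bullet> e) / \<delta> \<le> of_int (z e) + 1"
        using that by (simp_all add: z_def)
      then show ?thesis using \<delta>(1) by (simp add: field_simps)
    qed
    then have "x \<in> cell z" using x by (simp add: cell_def)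
    moreover from this have "z \<in> Z" by (auto simp: Z_def z_def)
    ultimately have "x \<in> \<Union>(F {e \<in> frame M. odd (z e)})" by (auto simp: F_def)
    then show "x \<in> (\<Union>i\<in>Pow (frame M). \<Union>(F i))"
      by (rule UN_I[rotated]) auto
  qed
  with fin disj sub show "\<exists>F :: 'e set \<Rightarrow> 'm set set.
        (\<forall>i. finite (F i) \<and> disjoint (F i) \<and> (\<forall>C\<in>F i. compact C \<and> C \<subseteq> K \<and> (\<exists>W\<in>\<W>. C \<subseteq> W))) \<and>
        K \<subseteq> (\<Union>i\<in>Pow (frame M). \<Union>(F i))" by blast
qed

text \<open>The number of colours stays 2^m however many charts are needed, because
  \<open>colourable_Un\<close> reuses the colours.\<close>

lemma compact_imp_colourable:
  assumes "compact K"
  shows "colourable K"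
proof -
  have "\<exists>N K' U \<xi>. open N \<and> x \<in> N \<and> N \<subseteq> K' \<and> compact K' \<and> closed K' \<and> K' \<subseteq> U \<and> (U, \<xi>) \<in> charts M" for x
  proof -
    obtain U \<xi> where U: "(U, \<xi>) \<in> charts M" "x \<in> U" by (rule ex_chart)
    from chart_homeomorphism(1)[OF U(1)] U(2) obtain N K' where
      "open N" "x \<in> N" "N \<subseteq> K'" "compact K'" "closed K'" "K' \<subseteq> U" by (rule ex_bump) blast
    then show ?thesis using U(1) by blast
  qed
  then obtain N K' U \<xi> where N: "\<And>x. open (N x) \<and> x \<in> N x \<and> N x \<subseteq> K' x \<and> compact (K' x) \<and>
    closed (K' x) \<and> K' x \<subseteq> U x \<and> (U x, \<xi> x) \<in> charts M" by metis
  have "K \<subseteq> (\<Union>x\<in>K. N x)" using N by blast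
  with assms obtain T where T: "T \<subseteq> K" "finite T" "K \<subseteq> (\<Union>x\<in>T. N x)"
    using compactE_image[of K K N] N by metis
  have "colourable (\<Union>x\<in>T. K \<inter> K' x)" using T(2)
  proof induction
    case (insert x T)
    have "colourable (K \<inter> K' x)"
      using N[of x] assms by (intro colourable_in_chart[of "U x" "\<xi> x"]) auto
    then show ?case using insert colourable_Un by simp
  qed (simp add: colourable_empty)
  moreover have "(\<Union>x\<in>T. K \<inter> K' x) = K"
  proof
    show "K \<subseteq> (\<Union>x\<in>T. K \<inter> K' x)"
    proof
      fix y assume y: "y \<in> K"
      then obtain x where "x \<in> T" "y \<in> N x" using T(3) by blast
      moreover from this have "y \<in> K' x" using N[of x] by blast
      ultimately show "y \<in> (\<Union>x\<in>T. K \<inter> K' x)" using y by blast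
    qed
  qed blast
  ultimately show ?thesis by simp
qed

section \<open>Bump functions for disjoint families of compact sets\<close>

lemma ex_bump_compact:
  assumes C: "compact C" "open P" "C \<subseteq> P"
  obtains b :: "'m \<Rightarrow> real" and K where "smooth b" "\<And>x. 0 \<le> b x" "closed K" "K \<subseteq> P"
    "\<And>x. x \<notin> K \<Longrightarrow> b x = 0" "\<And>x. x \<in> C \<Longrightarrow> 0 < b x"
proof -
  have "\<forall>x\<in>C. \<exists>(\<phi>::'m \<Rightarrow> real) N K. smooth \<phi> \<and> (\<forall>y. 0 \<le> \<phi> y) \<and> open N \<and> x \<in> N \<and> (\<forall>y\<in>N. \<phi> y = 1) \<and>
      closed K \<and> K \<subseteq> P \<and> (\<forall>y. y \<notin> K \<longrightarrow> \<phi> y = 0)"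
  proof
    fix x assume "x \<in> C"
    with C have "x \<in> P" by blast
    from C(2) this show "\<exists>(\<phi>::'m \<Rightarrow> real) N K. smooth \<phi> \<and> (\<forall>y. 0 \<le> \<phi> y) \<and> open N \<and> x \<in> N \<and>
        (\<forall>y\<in>N. \<phi> y = 1) \<and> closed K \<and> K \<subseteq> P \<and> (\<forall>y. y \<notin> K \<longrightarrow> \<phi> y = 0)"
      by (rule ex_bump) blast
  qed
  then obtain \<phi> :: "'m \<Rightarrow> 'm \<Rightarrow> real" and N K where "\<forall>x\<in>C. smooth (\<phi> x) \<and> (\<forall>y. 0 \<le> \<phi> x y) \<and>
      open (N x) \<and> x \<in> N x \<and> (\<forall>y\<in>N x. \<phi> x y = 1) \<and>
      closed (K x) \<and> K x \<subseteq> P \<and> (\<forall>y. y \<notin> K x \<longrightarrow> \<phi> x y = 0)"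
    unfolding bchoice_iff by blast
  then have \<phi>: "\<And>x. x \<in> C \<Longrightarrow> smooth (\<phi> x)"
    "\<And>x y. x \<in> C \<Longrightarrow> 0 \<le> \<phi> x y" "\<And>x. x \<in> C \<Longrightarrow> open (N x)" "\<And>x. x \<in> C \<Longrightarrow> x \<in> N x"
    "\<And>x y. x \<in> C \<Longrightarrow> y \<in> N x \<Longrightarrow> \<phi> x y = 1" "\<And>x. x \<in> C \<Longrightarrow> closed (K x)"
    "\<And>x. x \<in> C \<Longrightarrow> K x \<subseteq> P" "\<And>x y. x \<in> C \<Longrightarrow> y \<notin> K x \<Longrightarrow> \<phi> x y = 0" by blast+
  have "C \<subseteq> (\<Union>x\<in>C. N x)" using \<phi>(4) by blast
  with C(1) obtain T where T: "T \<subseteq> C" "finite T" "C \<subseteq> (\<Union>x\<in>T. N x)"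
    using compactE_image[of C C N] \<phi>(3) by metis
  show ?thesis
  proof (rule that)
    show "smooth (\<lambda>y. \<Sum>x\<in>T. \<phi> x y)" using \<phi>(1) T(1) unfolding smooth_iff
      by (intro allI smooth_at_sum) blast
    show "0 \<le> (\<Sum>x\<in>T. \<phi> x y)" for y using \<phi>(2) T(1) by (intro sum_nonneg) blast
    show "closed (\<Union>x\<in>T. K x)" using \<phi>(6) T by (intro closed_UN) auto
    show "(\<Union>x\<in>T. K x) \<subseteq> P" using \<phi>(7) T(1) by blast
    show "(\<Sum>x\<in>T. \<phi> x y) = 0" if "y \<notin> (\<Union>x\<in>T. K x)" for y
      using that \<phi>(8) T(1) by (intro sum.neutral) blast
    show "0 < (\<Sum>x\<in>T. \<phi> x y)" if y: "y \<in> C" for y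
    proof -
      from y T obtain x where x: "x \<in> T" "y \<in> N x" by blast
      then have "0 < \<phi> x y" using \<phi>(5)[of x y] T(1) by force
      moreover have "\<And>x. x \<in> T \<Longrightarrow> 0 \<le> \<phi> x y" using \<phi>(2) T(1) by blast
      ultimately show ?thesis using x(1) T(2) by (intro sum_pos2) auto
    qed
  qed
qed

text \<open>Disjointness of the \<open>P j\<close> makes the pieced-together function well defined.
  Local finiteness makes the union of the sets \<open>K j\<close> closed, so that extension by 0 is
  smooth also at boundary points of the union of the \<open>P j\<close>.\<close>

lemma glue_bumps:
  fixes C P :: "'i \<Rightarrow> 'm set"
  assumes C: "\<And>j. j \<in> J \<Longrightarrow> compact (C j)" and P: "\<And>j. j \<in> J \<Longrightarrow> open (P j)"
    and CP: "\<And>j. j \<in> J \<Longrightarrow> C j \<subseteq> P j" and disj: "disjoint_family_on P J"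
    and loc: "\<And>x. \<exists>N. open N \<and> x \<in> N \<and> finite {j \<in> J. P j \<inter> N \<noteq> {}}"
  obtains b :: "'m \<Rightarrow> real" and K where "smooth b" "\<And>x. 0 \<le> b x" "closed K" "K \<subseteq> (\<Union>j\<in>J. P j)"
    "\<And>x. x \<notin> K \<Longrightarrow> b x = 0" "\<And>x j. j \<in> J \<Longrightarrow> x \<in> C j \<Longrightarrow> 0 < b x"
proof -
  have "\<forall>j\<in>J. \<exists>(b::'m \<Rightarrow> real) K. smooth b \<and> (\<forall>x. 0 \<le> b x) \<and> closed K \<and> K \<subseteq> P j \<and>
      (\<forall>x. x \<notin> K \<longrightarrow> b x = 0) \<and> (\<forall>x\<in>C j. 0 < b x)"
  proof
    fix j assume j: "j \<in> J"
    show "\<exists>(b::'m \<Rightarrow> real) K. smooth b \<and> (\<forall>x. 0 \<le> b x) \<and> closed K \<and> K \<subseteq> P j \<and>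
        (\<forall>x. x \<notin> K \<longrightarrow> b x = 0) \<and> (\<forall>x\<in>C j. 0 < b x)"
      by (rule ex_bump_compact[OF C[OF j] P[OF j] CP[OF j]]) blast
  qed
  then obtain b :: "'i \<Rightarrow> 'm \<Rightarrow> real" and K where "\<forall>j\<in>J. smooth (b j) \<and> (\<forall>x. 0 \<le> b j x) \<and>
      closed (K j) \<and> K j \<subseteq> P j \<and> (\<forall>x. x \<notin> K j \<longrightarrow> b j x = 0) \<and> (\<forall>x\<in>C j. 0 < b j x)"
    unfolding bchoice_iff by blast
  then have b: "\<And>j. j \<in> J \<Longrightarrow> smooth (b j)"
    "\<And>j x. j \<in> J \<Longrightarrow> 0 \<le> b j x" "\<And>j. j \<in> J \<Longrightarrow> closed (K j)" "\<And>j. j \<in> J \<Longrightarrow> K j \<subseteq> P j"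
    "\<And>j x. j \<in> J \<Longrightarrow> x \<notin> K j \<Longrightarrow> b j x = 0" "\<And>j x. j \<in> J \<Longrightarrow> x \<in> C j \<Longrightarrow> 0 < b j x" by blast+
  have clK: "closed (\<Union>j\<in>J. K j)"
    unfolding closed_def
  proof (subst open_subopen, intro ballI)
    fix x assume x: "x \<in> - (\<Union>j\<in>J. K j)"
    from loc obtain N where N: "open N" "x \<in> N" "finite {j \<in> J. P j \<inter> N \<noteq> {}}" by blast
    let ?N = "N \<inter> (\<Inter>j\<in>{j \<in> J. P j \<inter> N \<noteq> {}}. - K j)"
    have "open ?N" using N b(3) by (intro open_Int open_INT) auto
    moreover have "x \<in> ?N" using N x by blast
    moreover have "?N \<subseteq> - (\<Union>j\<in>J. K j)" using b(4) by blast
    ultimately show "\<exists>T. open T \<and> x \<in> T \<and> T \<subseteq> - (\<Union>j\<in>J. K j)" by blast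
  qed
  define B where "B x = (if \<exists>j\<in>J. x \<in> P j then b (THE j. j \<in> J \<and> x \<in> P j) x else 0)" for x
  have B: "B x = b j x" if "j \<in> J" "x \<in> P j" for j x
  proof -
    have "(THE j. j \<in> J \<and> x \<in> P j) = j"
      using that disj by (intro the_equality) (auto simp: disjoint_family_on_def)
    then show ?thesis using that by (auto simp: B_def)
  qed
  have B0: "B x = 0" if "x \<notin> (\<Union>j\<in>J. K j)" for x
  proof (cases "\<exists>j\<in>J. x \<in> P j")
    case True
    then obtain j where "j \<in> J" "x \<in> P j" by blast
    then show ?thesis using B b(5) that by auto
  qed (simp add: B_def)
  show ?thesis
  proof (rule that)
    show "smooth B" unfolding smooth_iff
    proof
      fix x
      show "smooth_at M B x"
      proof (cases "x \<in> (\<Union>j\<in>J. K j)")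
        case True
        then obtain j where j: "j \<in> J" "x \<in> P j" using b(4) by blast
        show ?thesis
        proof (rule smooth_at_cong[OF _ P[OF j(1)] j(2)])
          show "smooth_at M (b j) x" using b(1)[OF j(1)] by (simp add: smooth_iff)
        qed (rule B[OF j(1), symmetric])
      next
        case False
        show ?thesis
        proof (rule smooth_at_cong[OF smooth_at_const])
          show "open (- (\<Union>j\<in>J. K j))" using clK by blast
        qed (use False B0 in auto)
      qed
    qed
    show "0 \<le> B x" for x
    proof (cases "\<exists>j\<in>J. x \<in> P j")
      case True
      then obtain j where "j \<in> J" "x \<in> P j" by blast
      then show ?thesis using B b(2) by simp
    qed (simp add: B_def)
    show "closed (\<Union>j\<in>J. K j)" by (rule clK)
    show "(\<Union>j\<in>J. K j) \<subseteq> (\<Union>j\<in>J. P j)" using b(4) by blast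
    show "0 < B x" if "j \<in> J" "x \<in> C j" for x j
    proof -
      have "x \<in> P j" using that CP by blast
      then show ?thesis using B b(6) that by simp
    qed
  qed (rule B0)
qed

text \<open>
  Connectedness makes the adjacency graph of a locally finite relatively compact cover connected
  and locally finite, so graph distance sorts the cover into finite layers, only neighbouring ones
  of which meet; layers are coloured separately, and a fourfold distinction of layers keeps
  enlargements of different layers of the same colour apart.
\<close>

lemma ex_layers:
  obtains \<V> :: "'m set set" and d :: "'m set \<Rightarrow> nat" where
    "\<And>V. V \<in> \<V> \<Longrightarrow> open V \<and> compact (closure V)" "\<Union>\<V> = UNIV"
    "\<And>n. finite {V \<in> \<V>. d V = n}"
    "\<And>V V'. V \<in> \<V> \<Longrightarrow> V' \<in> \<V> \<Longrightarrow> closure V \<inter> closure V' \<noteq> {} \<Longrightarrow> d V' \<le> d V + 1"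
proof -
  define \<U> where "\<U> = {U :: 'm set. open U \<and> (\<exists>K. compact K \<and> closed K \<and> U \<subseteq> K)}"
  have "\<Union>\<U> = UNIV"
  proof -
    have "x \<in> \<Union>\<U>" for x
    proof -
      obtain N :: "'m set" and K where "open N" "x \<in> N" "N \<subseteq> K" "compact K" "closed K"
        by (rule ex_bump[OF open_UNIV UNIV_I]) blast
      then show ?thesis unfolding \<U>_def by blast
    qed
    then show ?thesis by blast
  qed
  moreover have "\<forall>U\<in>\<U>. open U" by (simp add: \<U>_def)
  moreover have "paracompact_type TYPE('m)" using smooth_manifold by (simp add: smooth_manifold_def)
  then have "(\<forall>U\<in>\<U>. open U) \<and> \<Union>\<U> = UNIV \<longrightarrow>
        (\<exists>\<V>. (\<forall>V\<in>\<V>. open V) \<and> \<Union>\<V> = UNIV \<and> (\<forall>V\<in>\<V>. \<exists>U\<in>\<U>. V \<subseteq> U) \<and>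
             locally_finite_in euclidean \<V>)"
    unfolding paracompact_type_def by (rule spec)
  ultimately obtain \<V>0 where \<V>0: "\<forall>V\<in>\<V>0. open V" "\<Union>\<V>0 = UNIV" "\<forall>V\<in>\<V>0. \<exists>U\<in>\<U>. V \<subseteq> U"
    "locally_finite_in euclidean \<V>0"
    by blast
  \<comment> \<open>The empty set is removed so that a member not reached from \<open>V0\<close>
    makes the union of the unreached members nonempty, which connectedness forbids.\<close>
  define \<V> where "\<V> = \<V>0 - {{}}"
  have op: "open V" if "V \<in> \<V>" for V using that \<V>0(1) by (simp add: \<V>_def)
  have cpt: "compact (closure V)" if V: "V \<in> \<V>" for V
  proof -
    obtain K where K: "compact K" "closed K" "V \<subseteq> K" using V \<V>0(3) by (force simp: \<V>_def \<U>_def)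
    then have "closure V \<subseteq> K" by (simp add: closure_minimal)
    then have "closure V = K \<inter> closure V" by blast
    then show ?thesis using compact_Int_closed[OF K(1) closed_closure] by metis
  qed
  have cover: "\<Union>\<V> = UNIV" using \<V>0(2) by (auto simp: \<V>_def)
  have "\<forall>x. \<exists>N. open N \<and> x \<in> N \<and> finite {V \<in> \<V>0. V \<inter> N \<noteq> {}}"
  proof
    fix x :: 'm
    have "\<forall>x\<in>topspace euclidean. \<exists>N. openin euclidean N \<and> x \<in> N \<and> finite {V \<in> \<V>0. V \<inter> N \<noteq> {}}"
      using \<V>0(4) unfolding locally_finite_in_def by (rule conjunct2)
    then show "\<exists>N. open N \<and> x \<in> N \<and> finite {V \<in> \<V>0. V \<inter> N \<noteq> {}}"
      by (simp add: open_openin[symmetric])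
  qed
  then obtain N where N: "\<And>x. open (N x) \<and> x \<in> N x \<and> finite {V \<in> \<V>0. V \<inter> N x \<noteq> {}}" by metis
  define R where "R = {(V, V'). V \<in> \<V> \<and> V' \<in> \<V> \<and> closure V \<inter> closure V' \<noteq> {}}"
  \<comment> \<open>Finitely many sets \<open>N x\<close> cover the compact closure of
    \<open>V\<close>, and each of them meets only finitely many members.\<close>
  have Rfin: "finite (R `` {V})" if V: "V \<in> \<V>" for V
  proof -
    have "closure V \<subseteq> (\<Union>x\<in>closure V. N x)" using N by blast
    with cpt[OF V] obtain T where T: "T \<subseteq> closure V" "finite T" "closure V \<subseteq> (\<Union>x\<in>T. N x)"
      using compactE_image[of "closure V" "closure V" N] N by metis
    have "R `` {V} \<subseteq> (\<Union>x\<in>T. {V \<in> \<V>0. V \<inter> N x \<noteq> {}})"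
    proof
      fix V' assume V': "V' \<in> R `` {V}"
      then obtain p where p: "p \<in> closure V'" "p \<in> closure V" by (auto simp: R_def)
      then obtain x where "x \<in> T" "p \<in> N x" using T(3) by blast
      then have "N x \<inter> V' \<noteq> {}" using N[of x] open_Int_closure_eq_empty[of "N x" V'] p(1) by blast
      then show "V' \<in> (\<Union>x\<in>T. {V \<in> \<V>0. V \<inter> N x \<noteq> {}})" using V' \<open>x \<in> T\<close> by (auto simp: R_def \<V>_def)
    qed
    moreover have "finite (\<Union>x\<in>T. {V \<in> \<V>0. V \<inter> N x \<noteq> {}})" using T(2) N by blast
    ultimately show ?thesis by (rule finite_subset)
  qed
  obtain V0 where V0: "V0 \<in> \<V>" using cover by (metis UNIV_I UnionE)
  define S where "S n = (R ^^ n) `` {V0}" for n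
  have S: "finite (S n) \<and> S n \<subseteq> \<V>" for n
  proof (induction n)
    case (Suc n)
    have "S (Suc n) = (\<Union>V\<in>S n. R `` {V})" unfolding S_def by auto
    moreover have "finite (\<Union>V\<in>S n. R `` {V})" using Suc Rfin by blast
    ultimately show ?case using Suc by (auto simp: R_def)
  qed (simp add: S_def V0)
  define \<R> where "\<R> = (\<Union>n. S n)"
  have clos: "V' \<in> \<R>" if "V \<in> \<R>" "(V, V') \<in> R" for V V'
  proof -
    from that(1) obtain n where "(V0, V) \<in> R ^^ n" by (auto simp: \<R>_def S_def)
    then have "(V0, V') \<in> R ^^ Suc n" using that(2) by auto
    then show ?thesis unfolding \<R>_def S_def by blast
  qed
  have "\<V> \<subseteq> \<R>"
  proof (rule ccontr)
    assume "\<not> \<V> \<subseteq> \<R>"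
    then obtain V1 where V1: "V1 \<in> \<V>" "V1 \<notin> \<R>" by blast
    have "\<R> \<subseteq> \<V>" using S by (auto simp: \<R>_def)
    have "\<Union>\<R> \<inter> \<Union>(\<V> - \<R>) = {}"
    proof (rule ccontr)
      assume "\<Union>\<R> \<inter> \<Union>(\<V> - \<R>) \<noteq> {}"
      then obtain x V V' where "V \<in> \<R>" "V' \<in> \<V>" "V' \<notin> \<R>" "x \<in> V" "x \<in> V'" by blast
      moreover from this have "V \<in> \<V>" "x \<in> closure V" "x \<in> closure V'"
        using \<open>\<R> \<subseteq> \<V>\<close> closure_subset[of V] closure_subset[of V'] by auto
      then have "(V, V') \<in> R" using \<open>V' \<in> \<V>\<close> by (auto simp: R_def)
      ultimately show False using clos by blast
    qed
    moreover have "UNIV \<subseteq> \<Union>\<R> \<union> \<Union>(\<V> - \<R>)" unfolding cover[symmetric] by blast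
    moreover have "open (\<Union>\<R>)" "open (\<Union>(\<V> - \<R>))" using op \<open>\<R> \<subseteq> \<V>\<close> by auto
    moreover have "connected (UNIV :: 'm set)" using smooth_manifold by (simp add: smooth_manifold_def)
    ultimately have "\<Union>\<R> = {} \<or> \<Union>(\<V> - \<R>) = {}"
      using connectedD[of UNIV "\<Union>\<R>" "\<Union>(\<V> - \<R>)"] by auto
    moreover have "V0 \<in> \<R>" unfolding \<R>_def S_def by (auto intro!: exI[of _ 0])
    ultimately show False using V0 V1 by (auto simp: \<V>_def)
  qed
  define d where "d V = (LEAST n. (V0, V) \<in> R ^^ n)" for V
  have d: "(V0, V) \<in> R ^^ d V" if "V \<in> \<V>" for V
  proof -
    from that \<open>\<V> \<subseteq> \<R>\<close> obtain n where "(V0, V) \<in> R ^^ n" by (auto simp: \<R>_def S_def)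
    then show ?thesis unfolding d_def by (rule LeastI)
  qed
  show ?thesis
  proof (rule that)
    show "open V \<and> compact (closure V)" if "V \<in> \<V>" for V using that op cpt by blast
    show "finite {V \<in> \<V>. d V = n}" for n
      by (rule finite_subset[of _ "S n"]) (use d S in \<open>auto simp: S_def\<close>)
    show "d V' \<le> d V + 1" if "V \<in> \<V>" "V' \<in> \<V>" "closure V \<inter> closure V' \<noteq> {}" for V V'
    proof -
      have "(V0, V') \<in> R ^^ Suc (d V)" using d[OF that(1)] that by (auto simp: R_def)
      then show ?thesis unfolding d_def[of V'] by (simp add: Least_le)
    qed
  qed (rule cover)
qed

text \<open>
  Since \<open>w i\<close> is locally constant, trivializations over the members of the cover combine to one over
  all of \<open>P i\<close>.
\<close>

lemma ex_finite_locally_constant_cover: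
  assumes W: "\<And>W. W \<in> \<W> \<Longrightarrow> open W" "\<Union>\<W> = UNIV"
  obtains I :: "('e set \<times> nat) set" and b :: "'e set \<times> nat \<Rightarrow> 'm \<Rightarrow> real" and P K w where
    "finite I" "\<And>i. i \<in> I \<Longrightarrow> smooth (b i)" "\<And>i. i \<in> I \<Longrightarrow> open (P i)"
    "\<And>i. i \<in> I \<Longrightarrow> closed (K i)" "\<And>i. i \<in> I \<Longrightarrow> K i \<subseteq> P i"
    "\<And>i x. i \<in> I \<Longrightarrow> x \<notin> K i \<Longrightarrow> b i x = 0"
    "\<And>i x. i \<in> I \<Longrightarrow> x \<in> P i \<Longrightarrow> w i x \<in> \<W> \<and> x \<in> w i x \<and>
       (\<exists>N. open N \<and> x \<in> N \<and> N \<subseteq> P i \<and> (\<forall>y\<in>N. w i y = w i x))"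
    "\<And>x. \<exists>i\<in>I. b i x \<noteq> 0"
proof -
  obtain \<V> and d :: "'m set \<Rightarrow> nat" where V: "\<And>V. V \<in> \<V> \<Longrightarrow> open V \<and> compact (closure V)" "\<Union>\<V> = UNIV"
    "\<And>n. finite {V \<in> \<V>. d V = n}"
    "\<And>V V'. V \<in> \<V> \<Longrightarrow> V' \<in> \<V> \<Longrightarrow> closure V \<inter> closure V' \<noteq> {} \<Longrightarrow> d V' \<le> d V + 1"
    by (rule ex_layers) blast
  define L where "L n = (\<Union>V\<in>{V \<in> \<V>. d V = n}. closure V)" for n
  have "compact (L n)" for n unfolding L_def using V(1,3) by (intro compact_UN) auto
  then have "colourable (L n)" for n by (rule compact_imp_colourable)
  then have "\<forall>n. \<exists>F :: 'e set \<Rightarrow> 'm set set. (\<forall>i. finite (F i) \<and> disjoint (F i) \<and>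
      (\<forall>C\<in>F i. compact C \<and> C \<subseteq> L n \<and> (\<exists>W\<in>\<W>. C \<subseteq> W))) \<and> L n \<subseteq> (\<Union>i\<in>Pow (frame M). \<Union>(F i))"
    using W unfolding colourable_def by blast
  then obtain F :: "nat \<Rightarrow> 'e set \<Rightarrow> 'm set set" where F: "\<And>n i. finite (F n i)" "\<And>n i. disjoint (F n i)"
    "\<And>n i C. C \<in> F n i \<Longrightarrow> compact C \<and> C \<subseteq> L n \<and> (\<exists>W\<in>\<W>. C \<subseteq> W)"
    "\<And>n. L n \<subseteq> (\<Union>i\<in>Pow (frame M). \<Union>(F n i))" by metis
  have "\<forall>n i. \<exists>P. (\<forall>C\<in>F n i. open (P C) \<and> C \<subseteq> P C) \<and> disjoint_family_on P (F n i)"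
    using finite_disjoint_compact_separation[OF F(1) _ F(2)] F(3) by blast
  then obtain Q where Q: "\<And>n i C. C \<in> F n i \<Longrightarrow> open (Q n i C) \<and> C \<subseteq> Q n i C"
    "\<And>n i. disjoint_family_on (Q n i) (F n i)" by metis
  define u where "u n i C = (SOME W. W \<in> \<W> \<and> C \<subseteq> W)" for n :: nat and i :: "'e set" and C
  have u: "u n i C \<in> \<W> \<and> C \<subseteq> u n i C" if "C \<in> F n i" for n i C
    unfolding u_def by (rule someI_ex) (use F(3)[OF that] in blast)
  \<comment> \<open>An open neighbourhood of the layer \<open>L n\<close> made of members of the
    cover, so that graph distance still bounds which layers it can reach.\<close>
  define E where "E n = \<Union>{V \<in> \<V>. V \<inter> L n \<noteq> {}}" for n
  have openE: "open (E n)" for n unfolding E_def using V(1) by (intro open_Union) auto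
  have LE: "L n \<subseteq> E n" for n
  proof
    fix x assume x: "x \<in> L n"
    have "x \<in> \<Union>\<V>" by (simp add: V(2))
    then show "x \<in> E n" using x unfolding E_def by blast
  qed
  have near: "d V \<le> n + 1 \<and> n \<le> d V + 1" if "V \<in> \<V>" "V \<inter> L n \<noteq> {}" for V n
  proof -
    from that obtain V' where V': "V' \<in> \<V>" "d V' = n" "V \<inter> closure V' \<noteq> {}" by (auto simp: L_def)
    then have "closure V \<inter> closure V' \<noteq> {}" "closure V' \<inter> closure V \<noteq> {}"
      using closure_subset[of V] by blast+
    then show ?thesis using V(4)[OF that(1) V'(1)] V(4)[OF V'(1) that(1)] V'(2) by blast
  qed
  have dist: "d V \<le> n + 2 \<and> n \<le> d V + 2" if "V \<in> \<V>" "E n \<inter> V \<noteq> {}" for n V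
  proof -
    from that obtain V' where V': "V' \<in> \<V>" "V' \<inter> L n \<noteq> {}" "V' \<inter> V \<noteq> {}" by (auto simp: E_def)
    then have "closure V \<inter> closure V' \<noteq> {}" "closure V' \<inter> closure V \<noteq> {}"
      using closure_subset[of V] closure_subset[of V'] by blast+
    then show ?thesis
      using V(4)[OF that(1) V'(1)] V(4)[OF V'(1) that(1)] near[OF V'(1,2)] by linarith
  qed
  \<comment> \<open>A common member \<open>V\<close> is at most one step from layer
    \<open>n'\<close> and two from layer \<open>n\<close>. Indices of meeting neighbourhoods thus
    differ by at most 3, which is why residues modulo 4 keep them apart.\<close>
  have Edisj: "n \<le> n' + 3" if "E n \<inter> E n' \<noteq> {}" for n n'
  proof -
    from that obtain V where V': "V \<in> \<V>" "V \<inter> L n' \<noteq> {}" "E n \<inter> V \<noteq> {}" by (auto simp: E_def[of n'])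
    then show ?thesis using near[of V n'] dist[of V n] by linarith
  qed
  define J where "J i = {(n, C). n mod 4 = snd i \<and> C \<in> F n (fst i)}" for i :: "'e set \<times> nat"
  \<comment> \<open>\<open>Q\<close> separates pieces of one colour in one layer, \<open>E\<close>
    separates different layers of one residue, and \<open>u\<close> keeps the set inside a member of
    the given cover.\<close>
  define P where "P i = (\<lambda>(n, C). Q n (fst i) C \<inter> E n \<inter> u n (fst i) C)" for i :: "'e set \<times> nat"
  have Pdisj: "disjoint_family_on (P i) (J i)" for i
    unfolding disjoint_family_on_def
  proof (intro ballI impI)
    fix j j' assume j: "j \<in> J i" "j' \<in> J i" "j \<noteq> j'"
    obtain n C n' C' where nC: "j = (n, C)" "j' = (n', C')" by fastforce
    have mod: "n mod 4 = n' mod 4" and C: "C \<in> F n (fst i)" "C' \<in> F n' (fst i)"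
      using j nC by (auto simp: J_def)
    show "P i j \<inter> P i j' = {}"
    proof (cases "n = n'")
      case True
      then have "Q n (fst i) C \<inter> Q n (fst i) C' = {}"
        using Q(2)[of n "fst i"] C j(3) nC unfolding disjoint_family_on_def by blast
      then show ?thesis using True nC by (auto simp: P_def)
    next
      case False
      have "E n \<inter> E n' = {}"
      proof (rule ccontr)
        assume *: "E n \<inter> E n' \<noteq> {}"
        then have "n \<le> n' + 3" "n' \<le> n + 3" using Edisj[of n n'] Edisj[of n' n] by (auto simp: Int_commute)
        then show False using mod False by presburger
      qed
      then show ?thesis using nC by (auto simp: P_def)
    qed
  qed
  have Popen: "open (P i j)" and CP: "snd j \<subseteq> P i j" and Ccpt: "compact (snd j)" if "j \<in> J i" for i j
  proof -
    obtain n C where nC: "j = (n, C)" by fastforce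
    then have C: "C \<in> F n (fst i)" using that by (simp add: J_def)
    show "open (P i j)" using Q(1)[OF C] openE u[OF C] W(1) nC by (auto simp: P_def)
    show "snd j \<subseteq> P i j" using Q(1)[OF C] F(3)[OF C] LE[of n] u[OF C] nC by (auto simp: P_def)
    show "compact (snd j)" using F(3)[OF C] nC by simp
  qed
  have loc: "\<exists>N. open N \<and> x \<in> N \<and> finite {j \<in> J i. P i j \<inter> N \<noteq> {}}" for x i
  proof -
    have "x \<in> \<Union>\<V>" by (simp add: V(2))
    then obtain V where V': "V \<in> \<V>" "x \<in> V" by blast
    have "{j \<in> J i. P i j \<inter> V \<noteq> {}} \<subseteq> (SIGMA n:{..d V + 2}. F n (fst i))"
      using dist[OF V'(1)] by (fastforce simp: J_def P_def)
    moreover have "finite (SIGMA n:{..d V + 2}. F n (fst i))" using F(1) by simp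
    ultimately have "finite {j \<in> J i. P i j \<inter> V \<noteq> {}}" by (rule finite_subset)
    then show ?thesis using V' V(1) by (intro exI[of _ V]) simp
  qed
  have "\<forall>i. \<exists>(b::'m \<Rightarrow> real) K. smooth b \<and> (\<forall>x. 0 \<le> b x) \<and> closed K \<and> K \<subseteq> (\<Union>j\<in>J i. P i j) \<and>
      (\<forall>x. x \<notin> K \<longrightarrow> b x = 0) \<and> (\<forall>j\<in>J i. \<forall>x\<in>snd j. 0 < b x)"
  proof
    fix i
    show "\<exists>(b::'m \<Rightarrow> real) K. smooth b \<and> (\<forall>x. 0 \<le> b x) \<and> closed K \<and> K \<subseteq> (\<Union>j\<in>J i. P i j) \<and>
        (\<forall>x. x \<notin> K \<longrightarrow> b x = 0) \<and> (\<forall>j\<in>J i. \<forall>x\<in>snd j. 0 < b x)"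
      by (rule glue_bumps[OF Ccpt Popen CP Pdisj loc, of i]) blast+
  qed
  then obtain b :: "'e set \<times> nat \<Rightarrow> 'm \<Rightarrow> real" and K where "\<forall>i. smooth (b i) \<and> (\<forall>x. 0 \<le> b i x) \<and>
      closed (K i) \<and> K i \<subseteq> (\<Union>j\<in>J i. P i j) \<and> (\<forall>x. x \<notin> K i \<longrightarrow> b i x = 0) \<and>
      (\<forall>j\<in>J i. \<forall>x\<in>snd j. 0 < b i x)"
    unfolding choice_iff by blast
  then have b: "\<And>i. smooth (b i)"
    "\<And>i. closed (K i)" "\<And>i. K i \<subseteq> (\<Union>j\<in>J i. P i j)" "\<And>i x. x \<notin> K i \<Longrightarrow> b i x = 0"
    "\<And>i j x. j \<in> J i \<Longrightarrow> x \<in> snd j \<Longrightarrow> 0 < b i x" by blast+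
  \<comment> \<open>The sets \<open>P i j\<close> are disjoint, so the index \<open>j\<close> at
    \<open>x\<close> is unique and stays the same throughout \<open>P i j\<close>; hence
    \<open>w i\<close> is locally constant.\<close>
  define w where "w i x = (let j = THE j. j \<in> J i \<and> x \<in> P i j in u (fst j) (fst i) (snd j))" for i x
  have w: "w i x = u n (fst i) C" if "(n, C) \<in> J i" "x \<in> P i (n, C)" for i x n C
  proof -
    have "(THE j. j \<in> J i \<and> x \<in> P i j) = (n, C)"
    proof (rule the_equality)
      show "(n, C) \<in> J i \<and> x \<in> P i (n, C)" using that by blast
      show "j = (n, C)" if "j \<in> J i \<and> x \<in> P i j" for j
        using that \<open>(n, C) \<in> J i\<close> \<open>x \<in> P i (n, C)\<close> Pdisj[of i]
        unfolding disjoint_family_on_def by blast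
    qed
    then show ?thesis by (simp add: w_def)
  qed
  show ?thesis
  proof (rule that)
    show "finite (Pow (frame M) \<times> {..<4::nat})" using finite_frame by simp
    show "open (\<Union>j\<in>J i. P i j)" for i using Popen by (intro open_UN) auto
    show "K i \<subseteq> (\<Union>j\<in>J i. P i j)" for i by (rule b(3))
    show "w i x \<in> \<W> \<and> x \<in> w i x \<and> (\<exists>N. open N \<and> x \<in> N \<and> N \<subseteq> (\<Union>j\<in>J i. P i j) \<and> (\<forall>y\<in>N. w i y = w i x))"
      if "x \<in> (\<Union>j\<in>J i. P i j)" for i x
    proof -
      from that obtain n C where j: "(n, C) \<in> J i" "x \<in> P i (n, C)" by (metis UN_E surj_pair)
      have C: "C \<in> F n (fst i)" using j by (simp add: J_def)
      have "w i y = u n (fst i) C" if "y \<in> P i (n, C)" for y using w j(1) that by blast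
      moreover have "x \<in> u n (fst i) C" using j(2) by (simp add: P_def)
      moreover have "u n (fst i) C \<in> \<W>" using u[OF C] by blast
      ultimately show ?thesis using j Popen[OF j(1)] by (intro conjI exI[of _ "P i (n, C)"]) auto
    qed
    show "\<exists>i\<in>Pow (frame M) \<times> {..<4::nat}. b i x \<noteq> 0" for x
    proof -
      have "x \<in> \<Union>\<V>" by (simp add: V(2))
      then obtain V where V': "V \<in> \<V>" "x \<in> V" by blast
      then have "x \<in> L (d V)" unfolding L_def using closure_subset by blast
      then obtain i C where "i \<in> Pow (frame M)" "C \<in> F (d V) i" "x \<in> C" using F(4) by blast
      moreover from this have "0 < b (i, d V mod 4) x"
        by (intro b(5)[of "(d V, C)"]) (auto simp: J_def)
      ultimately show ?thesis by (intro bexI[of _ "(i, d V mod 4)"]) auto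
    qed
  qed (use b in auto)
qed

end


section \<open>Finite-dimensional Lie algebras\<close>

locale lie_alg =
  fixes G :: "('k::{real_normed_field,euclidean_space}, 'f::ab_group_add) lie_algebra_data"
  assumes lie: "findim_lie_algebra G"
begin

abbreviation sc :: "'k \<Rightarrow> 'f \<Rightarrow> 'f" where "sc \<equiv> scl G"
abbreviation br :: "'f \<Rightarrow> 'f \<Rightarrow> 'f" where "br \<equiv> brk G"

definition basis :: "'f set" where
  "basis = (SOME B. finite_dimensional_vector_space sc B)"

sublocale V: finite_dimensional_vector_space sc basis
  unfolding basis_def by (rule someI_ex) (use lie in \<open>simp add: findim_lie_algebra_def\<close>)

definition lin :: "('f \<Rightarrow> 'f) \<Rightarrow> bool" where
  "lin h \<longleftrightarrow> (\<forall>u v. h (u + v) = h u + h v) \<and> (\<forall>c u. h (sc c u) = sc c (h u))"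

lemma linear_iff_lin: "Vector_Spaces.linear sc sc h \<longleftrightarrow> lin h"
  unfolding Vector_Spaces.linear_iff lin_def using V.vector_space_axioms by blast

definition lfun :: "('f \<Rightarrow> 'k) \<Rightarrow> bool" where
  "lfun l \<longleftrightarrow> (\<forall>u v. l (u + v) = l u + l v) \<and> (\<forall>c u. l (sc c u) = c * l u)"

lemma linear_iff_lfun: "Vector_Spaces.linear sc (*) l \<longleftrightarrow> lfun l"
proof -
  have "vector_space ((*) :: 'k \<Rightarrow> 'k \<Rightarrow> 'k)" by unfold_locales (simp_all add: algebra_simps)
  then show ?thesis
    unfolding Vector_Spaces.linear_iff lfun_def using V.vector_space_axioms by blast
qed

lemma lin_add: "lin h \<Longrightarrow> h (u + v) = h u + h v"
  and lin_scale: "lin h \<Longrightarrow> h (sc c u) = sc c (h u)"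
  by (simp_all add: lin_def)

lemma lin_zero: "lin h \<Longrightarrow> h 0 = 0"
  using lin_add[of h 0 0] by simp

lemma lin_sum: "lin h \<Longrightarrow> h (\<Sum>i\<in>I. f i) = (\<Sum>i\<in>I. h (f i))"
  by (induction I rule: infinite_finite_induct) (simp_all add: lin_zero lin_add)

lemma lin_minus: "lin h \<Longrightarrow> h (- u) = - h u"
  using lin_add[of h u "- u"] lin_zero[of h] by (simp add: eq_neg_iff_add_eq_0 add.commute)

lemma lin_diff: "lin h \<Longrightarrow> h (u - v) = h u - h v"
  using lin_add[of h u "- v"] lin_minus[of h v] by simp

lemma lfun_add: "lfun l \<Longrightarrow> l (u + v) = l u + l v"
  and lfun_scale: "lfun l \<Longrightarrow> l (sc c u) = c * l u"
  by (simp_all add: lfun_def)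

lemma lfun_zero: "lfun l \<Longrightarrow> l 0 = 0"
  using lfun_add[of l 0 0] by simp

lemma lfun_sum: "lfun l \<Longrightarrow> l (\<Sum>i\<in>I. f i) = (\<Sum>i\<in>I. l (f i))"
  by (induction I rule: infinite_finite_induct) (simp_all add: lfun_zero lfun_add)

definition co :: "'f \<Rightarrow> 'f \<Rightarrow> 'k" where "co b v = V.representation basis v b"

lemma lfun_representation:
  assumes "V.independent B" "V.span B = UNIV"
  shows "lfun (\<lambda>v. V.representation B v b)"
  using assms by (simp add: lfun_def V.representation_add V.representation_scale)

lemma representation_expand:
  assumes "V.independent B" "V.span B = UNIV"
  shows "(\<Sum>b\<in>B. sc (V.representation B v b) b) = v"
  using assms V.finiteI_independent[OF assms(1)] by (intro V.sum_representation_eq) auto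

lemma lfun_co: "lfun (co b)"
  using lfun_representation[OF V.independent_Basis V.span_Basis] by (simp add: co_def[abs_def])

lemma co_expand: "(\<Sum>b\<in>basis. sc (co b v) b) = v"
  unfolding co_def by (rule representation_expand[OF V.independent_Basis V.span_Basis])

lemma co_eqI: "(\<And>b. b \<in> basis \<Longrightarrow> co b u = co b v) \<Longrightarrow> u = v"
  using co_expand[of u] co_expand[of v] by (metis (no_types, lifting) sum.cong)

lemma lin_expand: "lin h \<Longrightarrow> h v = (\<Sum>b\<in>basis. sc (co b v) (h b))"
proof -
  assume h: "lin h"
  have "h v = h (\<Sum>b\<in>basis. sc (co b v) b)" by (simp add: co_expand)
  then show ?thesis by (simp add: lin_sum[OF h] lin_scale[OF h])
qed

lemma lfun_expand: "lfun l \<Longrightarrow> l v = (\<Sum>b\<in>basis. co b v * l b)"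
proof -
  assume l: "lfun l"
  have "l v = l (\<Sum>b\<in>basis. sc (co b v) b)" by (simp add: co_expand)
  then show ?thesis by (simp add: lfun_sum[OF l] lfun_scale[OF l])
qed

lemma lin_br: "lin (br u)" "lin (\<lambda>v. br v w)"
  using lie by (simp_all add: findim_lie_algebra_def linear_iff_lin)

lemmas br_add_right = lin_add[OF lin_br(1)] and br_add_left = lin_add[OF lin_br(2)]
  and br_scale_right = lin_scale[OF lin_br(1)] and br_scale_left = lin_scale[OF lin_br(2)]
  and br_zero_right = lin_zero[OF lin_br(1)] and br_zero_left = lin_zero[OF lin_br(2)]
  and br_diff_right = lin_diff[OF lin_br(1)] and br_diff_left = lin_diff[OF lin_br(2)]
  and br_sum_right = lin_sum[OF lin_br(1)] and br_sum_left = lin_sum[OF lin_br(2)]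

lemma br_self: "br u u = 0"
  using lie by (simp add: findim_lie_algebra_def)

lemma br_swap: "br u v = - br v u"
proof -
  have "br (u + v) (u + v) = br u v + br v u"
    unfolding br_add_left br_add_right by (simp add: br_self)
  then show ?thesis by (simp add: br_self eq_neg_iff_add_eq_0)
qed

lemma lie_aut_lin: "g \<in> lie_aut G \<Longrightarrow> lin g"
  and lie_aut_bij: "g \<in> lie_aut G \<Longrightarrow> bij g"
  and lie_aut_br: "g \<in> lie_aut G \<Longrightarrow> g (br u v) = br (g u) (g v)"
  by (simp_all add: lie_aut_def linear_iff_lin)

lemma lie_aut_inv:
  assumes "g \<in> lie_aut G"
  shows "inv g \<in> lie_aut G"
proof -
  note b = lie_aut_bij[OF assms]
  have gi: "g (inv g u) = u" for u using b by (simp add: bij_is_surj surj_f_inv_f)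
  have eqI: "u = v" if "g u = g v" for u v using that b by (meson bij_is_inj injD)
  have "lin (inv g)" unfolding lin_def
    by (intro conjI allI; rule eqI) (simp_all add: lin_add[OF lie_aut_lin[OF assms]]
        lin_scale[OF lie_aut_lin[OF assms]] gi)
  moreover have "inv g (br u v) = br (inv g u) (inv g v)" for u v
    by (rule eqI) (simp add: lie_aut_br[OF assms] gi)
  ultimately show ?thesis using b by (simp add: lie_aut_def linear_iff_lin bij_imp_bij_inv)
qed

lemma lie_aut_apply_inv: "g \<in> lie_aut G \<Longrightarrow> g (inv g u) = u"
  and lie_aut_inv_apply: "g \<in> lie_aut G \<Longrightarrow> inv g (g u) = u"
  by (simp_all add: lie_aut_def bij_is_surj bij_is_inj surj_f_inv_f)

text \<open>A spanning set contains a basis. When the basis vectors are single brackets, each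
  coordinate of an element costs one bracket, and the count does not depend on the element.\<close>

lemma perfect_basis:
  assumes "perfect_lie G"
  obtains B p q where "V.independent B" "V.span B = UNIV" "\<And>b. b \<in> B \<Longrightarrow> b = br (p b) (q b)"
proof -
  have "V.span {br x y | x y. True} = UNIV" using assms by (simp add: perfect_lie_def)
  moreover obtain B where B: "B \<subseteq> {br x y | x y. True}" "V.independent B"
    "{br x y | x y. True} \<subseteq> V.span B" by (rule V.maximal_independent_subset)
  ultimately have "V.span B = UNIV" using V.span_mono[OF B(3)] by (simp add: V.span_span top.extremum_unique)
  moreover have "\<forall>b\<in>B. \<exists>x y. b = br x y" using B(1) by blast
  then obtain p q where "\<forall>b\<in>B. b = br (p b) (q b)" by metis
  ultimately show ?thesis using that B(2) by blast
qed

end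


section \<open>Sections of a bundle of Lie algebras in a set-theoretic trivialization\<close>

locale fibre_smooth = smooth_mfd M + lie_alg G
  for M :: "('m::t2_space, 'e::real_inner) manifold_data"
    and G :: "('k::{real_normed_field,euclidean_space}, 'f::ab_group_add) lie_algebra_data"
begin

text \<open>The coordinates in one basis are enough to test: all linear functionals, which
  \<open>smooth_fib_on\<close> asks for, are combinations of them.\<close>

definition smf :: "('m \<Rightarrow> 'f) \<Rightarrow> 'm \<Rightarrow> bool" where
  "smf \<beta> x \<longleftrightarrow> (\<forall>b\<in>basis. smooth_at M (\<lambda>y. co b (\<beta> y)) x)"

lemma smf_lfun: "lfun l \<Longrightarrow> smf \<beta> x \<Longrightarrow> smooth_at M (\<lambda>y. l (\<beta> y)) x"
  unfolding lfun_expand[of l "\<beta> _"] smf_def by (intro smooth_at_sum smooth_at_mult smooth_at_const) auto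

lemma smf_iff_lfun: "smf \<beta> x \<longleftrightarrow> (\<forall>l. lfun l \<longrightarrow> smooth_at M (\<lambda>y. l (\<beta> y)) x)"
  using smf_lfun lfun_co unfolding smf_def by blast

lemma smf_cong:
  assumes "smf \<beta> x" "open N" "x \<in> N" "\<And>y. y \<in> N \<Longrightarrow> \<beta> y = \<gamma> y"
  shows "smf \<gamma> x"
  unfolding smf_def
proof
  fix b assume "b \<in> basis"
  then have "smooth_at M (\<lambda>y. co b (\<beta> y)) x" using assms(1) by (simp add: smf_def)
  then show "smooth_at M (\<lambda>y. co b (\<gamma> y)) x"
    by (rule smooth_at_cong[OF _ assms(2,3)]) (simp add: assms(4))
qed

lemma smf_const: "smf (\<lambda>_. c) x"
  by (simp add: smf_def smooth_at_const)

lemma smf_add: "smf \<beta> x \<Longrightarrow> smf \<gamma> x \<Longrightarrow> smf (\<lambda>y. \<beta> y + \<gamma> y) x"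
  by (simp add: smf_def lfun_add[OF lfun_co] smooth_at_add)

lemma smf_scale: "smooth_at M a x \<Longrightarrow> smf \<beta> x \<Longrightarrow> smf (\<lambda>y. sc (a y) (\<beta> y)) x"
  by (simp add: smf_def lfun_scale[OF lfun_co] smooth_at_mult)

lemma smf_sum: "(\<And>i. i \<in> I \<Longrightarrow> smf (\<beta> i) x) \<Longrightarrow> smf (\<lambda>y. \<Sum>i\<in>I. \<beta> i y) x"
  by (simp add: smf_def lfun_sum[OF lfun_co] smooth_at_sum)

text \<open>Expanding the argument in the basis turns the application into a finite sum of smooth
  scalars times smooth vectors.\<close>

lemma smf_apply:
  assumes "open N" "x \<in> N" "\<And>y. y \<in> N \<Longrightarrow> lin (H y)" "\<And>b. smf (\<lambda>y. H y b) x" "smf \<beta> x"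
  shows "smf (\<lambda>y. H y (\<beta> y)) x"
proof (rule smf_cong[OF _ assms(1,2)])
  show "smf (\<lambda>y. \<Sum>b\<in>basis. sc (co b (\<beta> y)) (H y b)) x"
    using assms(4,5) by (intro smf_sum smf_scale smf_lfun[OF lfun_co])
qed (simp add: lin_expand[OF assms(3), symmetric])

lemma smf_br: "smf \<beta> x \<Longrightarrow> smf \<gamma> x \<Longrightarrow> smf (\<lambda>y. br (\<beta> y) (\<gamma> y)) x"
proof (rule smf_apply[where N = UNIV and H = "\<lambda>y. br (\<beta> y)" and \<beta> = \<gamma>])
  show "smf (\<lambda>y. br (\<beta> y) b) x" if "smf \<beta> x" for b
    using that by (rule smf_apply[where N = UNIV and H = "\<lambda>y v. br v b", rotated -1])
      (simp_all add: lin_br smf_const)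
qed (simp_all add: lin_br)

end

text \<open>
  The chosen charts \<open>triv L x\<close> identify every fibre with \<open>'f\<close>, in general not continuously in \<open>x\<close>.
  A section thus becomes a function with values in \<open>'f\<close> on which all operations are pointwise, and
  \<open>(U, g) \<in> T\<close> records a bundle chart relative to this identification.
\<close>

locale twisted = fibre_smooth M G
  for M :: "('m::t2_space, 'e::real_inner) manifold_data"
    and G :: "('k::{real_normed_field,euclidean_space}, 'f::ab_group_add) lie_algebra_data" +
  fixes T :: "('m set \<times> ('m \<Rightarrow> 'f \<Rightarrow> 'f)) set"
  assumes T_cover: "\<And>x. \<exists>U g. (U, g) \<in> T \<and> x \<in> U"
    and T_open: "(U, g) \<in> T \<Longrightarrow> open U"
    and T_aut: "(U, g) \<in> T \<Longrightarrow> x \<in> U \<Longrightarrow> g x \<in> lie_aut G"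
    and T_smooth: "(U, g) \<in> T \<Longrightarrow> (V, h) \<in> T \<Longrightarrow> x \<in> U \<Longrightarrow> x \<in> V \<Longrightarrow> smf (\<lambda>y. h y (inv (g y) w)) x"
begin

definition sm_sec :: "('m \<Rightarrow> 'f) \<Rightarrow> 'm \<Rightarrow> bool" where
  "sm_sec A x \<longleftrightarrow> (\<exists>U g. (U, g) \<in> T \<and> x \<in> U \<and> smf (\<lambda>y. g y (A y)) x)"

definition \<Gamma> :: "('m \<Rightarrow> 'f) set" where "\<Gamma> = {A. \<forall>x. sm_sec A x}"

lemma \<Gamma>I: "(\<And>x. sm_sec A x) \<Longrightarrow> A \<in> \<Gamma>" and \<Gamma>D: "A \<in> \<Gamma> \<Longrightarrow> sm_sec A x"
  unfolding \<Gamma>_def by blast+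

text \<open>At each point, \<open>h\<close> applied to \<open>A\<close> is the transition map from
  \<open>g\<close> to \<open>h\<close> applied to the value of \<open>A\<close> in the chart
  \<open>g\<close>, and transition maps are smooth.\<close>

lemma sm_sec_chart:
  assumes "sm_sec A x" "(V, h) \<in> T" "x \<in> V"
  shows "smf (\<lambda>y. h y (A y)) x"
proof -
  from assms(1) obtain U g where U: "(U, g) \<in> T" "x \<in> U" "smf (\<lambda>y. g y (A y)) x"
    by (auto simp: sm_sec_def)
  have "smf (\<lambda>y. h y (inv (g y) (g y (A y)))) x"
  proof (rule smf_apply[where N = "U \<inter> V" and H = "\<lambda>y v. h y (inv (g y) v)" and \<beta> = "\<lambda>y. g y (A y)"])
    fix y assume y: "y \<in> U \<inter> V"
    then show "lin (\<lambda>v. h y (inv (g y) v))"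
      using lie_aut_lin[OF T_aut[OF assms(2)]] lie_aut_lin[OF lie_aut_inv[OF T_aut[OF U(1)]]]
      by (simp add: lin_def)
  qed (use U assms T_open T_smooth in auto)
  then show ?thesis
    by (rule smf_cong[OF _ T_open[OF U(1)] U(2)]) (simp add: lie_aut_inv_apply[OF T_aut[OF U(1)]])
qed

lemma ex_T: obtains U g where "(U, g) \<in> T" "x \<in> U"
  using T_cover by blast

lemma sm_sec_cong:
  assumes "sm_sec A x" "open N" "x \<in> N" "\<And>y. y \<in> N \<Longrightarrow> A y = B y"
  shows "sm_sec B x"
  using assms(1) smf_cong[OF _ assms(2,3), of "\<lambda>y. _ y (A y)" "\<lambda>y. _ y (B y)"] assms(4)
  unfolding sm_sec_def by metis

lemma sm_sec_add:
  assumes "sm_sec A x" "sm_sec B x"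
  shows "sm_sec (\<lambda>y. A y + B y) x"
proof -
  obtain U g where U: "(U, g) \<in> T" "x \<in> U" by (rule ex_T)
  have "smf (\<lambda>y. g y (A y) + g y (B y)) x" using assms U by (intro smf_add sm_sec_chart)
  then have "smf (\<lambda>y. g y (A y + B y)) x"
    by (rule smf_cong[OF _ T_open[OF U(1)] U(2)]) (simp add: lin_add[OF lie_aut_lin[OF T_aut[OF U(1)]]])
  then show ?thesis using U unfolding sm_sec_def by blast
qed

lemma sm_sec_scale:
  assumes "smooth_at M a x" "sm_sec A x"
  shows "sm_sec (\<lambda>y. sc (a y) (A y)) x"
proof -
  obtain U g where U: "(U, g) \<in> T" "x \<in> U" by (rule ex_T)
  have "smf (\<lambda>y. sc (a y) (g y (A y))) x" using assms U by (intro smf_scale sm_sec_chart)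
  then have "smf (\<lambda>y. g y (sc (a y) (A y))) x"
    by (rule smf_cong[OF _ T_open[OF U(1)] U(2)]) (simp add: lin_scale[OF lie_aut_lin[OF T_aut[OF U(1)]]])
  then show ?thesis using U unfolding sm_sec_def by blast
qed

lemma sm_sec_br:
  assumes "sm_sec A x" "sm_sec B x"
  shows "sm_sec (\<lambda>y. br (A y) (B y)) x"
proof -
  obtain U g where U: "(U, g) \<in> T" "x \<in> U" by (rule ex_T)
  have "smf (\<lambda>y. br (g y (A y)) (g y (B y))) x" using assms U by (intro smf_br sm_sec_chart)
  then have "smf (\<lambda>y. g y (br (A y) (B y))) x"
    by (rule smf_cong[OF _ T_open[OF U(1)] U(2)]) (simp add: lie_aut_br[OF T_aut[OF U(1)]])
  then show ?thesis using U unfolding sm_sec_def by blast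
qed

lemma sm_sec_zero: "sm_sec (\<lambda>_. 0) x"
proof -
  obtain U g where U: "(U, g) \<in> T" "x \<in> U" by (rule ex_T)
  have "smf (\<lambda>y. g y 0) x"
    by (rule smf_cong[OF smf_const[of 0] T_open[OF U(1)] U(2)])
      (simp add: lin_zero[OF lie_aut_lin[OF T_aut[OF U(1)]]])
  then show ?thesis using U unfolding sm_sec_def by blast
qed

lemma sm_sec_sum: "(\<And>i. i \<in> I \<Longrightarrow> sm_sec (A i) x) \<Longrightarrow> sm_sec (\<lambda>y. \<Sum>i\<in>I. A i y) x"
  by (induction I rule: infinite_finite_induct) (simp_all add: sm_sec_zero sm_sec_add)

lemma sm_sec_const:
  assumes "(U, g) \<in> T" "x \<in> U"
  shows "sm_sec (\<lambda>y. inv (g y) w) x"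
  unfolding sm_sec_def using assms T_smooth[OF assms(1,1,2,2)] by blast

lemma \<Gamma>_zero: "(\<lambda>_. 0) \<in> \<Gamma>"
  by (rule \<Gamma>I, rule sm_sec_zero)

lemma \<Gamma>_add: "A \<in> \<Gamma> \<Longrightarrow> B \<in> \<Gamma> \<Longrightarrow> (\<lambda>x. A x + B x) \<in> \<Gamma>"
  by (rule \<Gamma>I, rule sm_sec_add; rule \<Gamma>D)

lemma \<Gamma>_scale: "smooth a \<Longrightarrow> A \<in> \<Gamma> \<Longrightarrow> (\<lambda>x. sc (a x) (A x)) \<in> \<Gamma>"
  by (rule \<Gamma>I, rule sm_sec_scale) (simp_all add: smooth_iff \<Gamma>D)

lemma smooth_const: "smooth (\<lambda>_. c)"
  by (simp add: smooth_iff smooth_at_const)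

lemma \<Gamma>_scale_const: "A \<in> \<Gamma> \<Longrightarrow> (\<lambda>x. sc c (A x)) \<in> \<Gamma>"
  using \<Gamma>_scale[OF smooth_const] .

lemma \<Gamma>_diff:
  assumes "A \<in> \<Gamma>" "B \<in> \<Gamma>"
  shows "(\<lambda>x. A x - B x) \<in> \<Gamma>"
  using \<Gamma>_add[OF assms(1) \<Gamma>_scale_const[OF assms(2), of "- 1"]] by (simp add: V.scale_minus_left)

lemma \<Gamma>_br: "A \<in> \<Gamma> \<Longrightarrow> B \<in> \<Gamma> \<Longrightarrow> (\<lambda>x. br (A x) (B x)) \<in> \<Gamma>"
  by (rule \<Gamma>I, rule sm_sec_br; rule \<Gamma>D)

lemma \<Gamma>_sum: "(\<And>i. i \<in> I \<Longrightarrow> A i \<in> \<Gamma>) \<Longrightarrow> (\<lambda>x. \<Sum>i\<in>I. A i x) \<in> \<Gamma>"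
  by (rule \<Gamma>I, rule sm_sec_sum) (rule \<Gamma>D)

lemma cutoff_in_\<Gamma>:
  fixes \<phi> :: "'m \<Rightarrow> real"
  assumes "smooth \<phi>" "closed K" "K \<subseteq> W" "\<And>y. y \<notin> K \<Longrightarrow> \<phi> y = 0" "\<And>y. y \<in> W \<Longrightarrow> sm_sec A y"
  shows "(\<lambda>y. sc (of_real (\<phi> y)) (A y)) \<in> \<Gamma>"
proof (rule \<Gamma>I)
  fix x
  show "sm_sec (\<lambda>y. sc (of_real (\<phi> y)) (A y)) x"
  proof (cases "x \<in> K")
    case True
    then show ?thesis using assms by (intro sm_sec_scale smooth_at_of_real) (auto simp: smooth_iff)
  next
    case False
    show ?thesis
    proof (rule sm_sec_cong[OF sm_sec_zero])
      show "open (- K)" using assms(2) by blast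
    qed (use False assms(4) in auto)
  qed
qed

lemma ex_\<Gamma>_extension:
  assumes "open W" "x \<in> W" "\<And>y. y \<in> W \<Longrightarrow> sm_sec A y"
  obtains B N where "B \<in> \<Gamma>" "open N" "x \<in> N" "\<And>y. y \<in> N \<Longrightarrow> B y = A y"
proof -
  from assms(1,2) obtain \<phi> :: "'m \<Rightarrow> real" and N K where \<phi>: "smooth \<phi>" "\<And>y. 0 \<le> \<phi> y"
    "open N" "x \<in> N" "N \<subseteq> K" "\<And>y. y \<in> N \<Longrightarrow> \<phi> y = 1"
    "compact K" "closed K" "K \<subseteq> W" "\<And>y. y \<notin> K \<Longrightarrow> \<phi> y = 0" by (rule ex_bump) blast
  show ?thesis
  proof (rule that)
    show "(\<lambda>y. sc (of_real (\<phi> y)) (A y)) \<in> \<Gamma>" by (rule cutoff_in_\<Gamma>[OF \<phi>(1,8,9,10) assms(3)])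
    show "open N" "x \<in> N" by (fact \<phi>)+
  qed (simp add: \<phi>(6))
qed

lemma ex_\<Gamma>_through: obtains A where "A \<in> \<Gamma>" "A x = u"
proof -
  obtain U g where U: "(U, g) \<in> T" "x \<in> U" by (rule ex_T)
  obtain B N where "B \<in> \<Gamma>" "x \<in> N" "\<And>y. y \<in> N \<Longrightarrow> B y = inv (g y) (g x u)"
    using ex_\<Gamma>_extension[OF T_open[OF U(1)] U(2) sm_sec_const[OF U(1)]] by metis
  then show ?thesis using that[of B] lie_aut_inv_apply[OF T_aut[OF U]] by simp
qed

text \<open>The counterpart for sections of \<open>vector_field_vanishing\<close>. The coefficients
  of \<open>A\<close> and the sections constant in the chart are smooth over \<open>U\<close> only;
  each receives one factor \<phi>, which accounts for the square in \<open>c\<close>.\<close>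

lemma \<Gamma>_vanishing:
  assumes A: "A \<in> \<Gamma>" "A x = 0"
  obtains c a E where "smooth c" "c x = 0" "\<And>b. smooth (a b)" "\<And>b. a b x = 0" "\<And>b. E b \<in> \<Gamma>"
    "A = (\<lambda>y. sc (c y) (A y) + (\<Sum>b\<in>basis. sc (a b y) (E b y)))"
proof -
  obtain U g where U: "(U, g) \<in> T" "x \<in> U" by (rule ex_T)
  from T_open[OF U(1)] U(2) obtain \<phi> :: "'m \<Rightarrow> real" and N K where \<phi>: "smooth \<phi>" "\<And>y. 0 \<le> \<phi> y"
    "open N" "x \<in> N" "N \<subseteq> K" "\<And>y. y \<in> N \<Longrightarrow> \<phi> y = 1"
    "compact K" "closed K" "K \<subseteq> U" "\<And>y. y \<notin> K \<Longrightarrow> \<phi> y = 0" by (rule ex_bump) blast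
  define c :: "'m \<Rightarrow> 'k" where "c y = of_real (1 - \<phi> y * \<phi> y)" for y
  define a where "a b y = of_real (\<phi> y) * co b (g y (A y))" for b y
  define E where "E b y = sc (of_real (\<phi> y)) (inv (g y) b)" for b y
  show ?thesis
  proof (rule that)
    show "smooth c" using \<phi>(1) unfolding c_def smooth_iff by (auto intro!: smooth_at_intros)
    show "c x = 0" using \<phi>(4,6) by (simp add: c_def)
    show "smooth (a b)" for b unfolding smooth_iff
    proof
      fix y
      show "smooth_at M (a b) y"
      proof (cases "y \<in> K")
        case True
        then have "y \<in> U" using \<phi>(9) by blast
        then show ?thesis unfolding a_def using \<phi>(1) smf_lfun[OF lfun_co sm_sec_chart[OF \<Gamma>D[OF A(1)] U(1)]]
          by (intro smooth_at_mult smooth_at_of_real) (auto simp: smooth_iff)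
      next
        case False
        show ?thesis
        proof (rule smooth_at_cong[OF smooth_at_const])
          show "open (- K)" using \<phi>(8) by blast
        qed (use False \<phi>(10) in \<open>auto simp: a_def\<close>)
      qed
    qed
    show "a b x = 0" for b
      using A(2) by (simp add: a_def lin_zero[OF lie_aut_lin[OF T_aut[OF U]]] lfun_zero[OF lfun_co])
    show "E b \<in> \<Gamma>" for b unfolding E_def
      by (rule cutoff_in_\<Gamma>[OF \<phi>(1,8,9,10) sm_sec_const[OF U(1)]])
    show "A = (\<lambda>y. sc (c y) (A y) + (\<Sum>b\<in>basis. sc (a b y) (E b y)))"
    proof
      fix y
      have "(\<Sum>b\<in>basis. sc (a b y) (E b y)) = sc (of_real (\<phi> y * \<phi> y)) (A y)"
      proof (cases "y \<in> U")
        case True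
        have "A y = inv (g y) (g y (A y))" using lie_aut_inv_apply[OF T_aut[OF U(1) True]] by simp
        also have "\<dots> = (\<Sum>b\<in>basis. sc (co b (g y (A y))) (inv (g y) b))"
          by (rule lin_expand[OF lie_aut_lin[OF lie_aut_inv[OF T_aut[OF U(1) True]]]])
        finally have "sc (of_real (\<phi> y * \<phi> y)) (A y)
            = sc (of_real (\<phi> y * \<phi> y)) (\<Sum>b\<in>basis. sc (co b (g y (A y))) (inv (g y) b))" by simp
        then show ?thesis by (simp add: a_def E_def V.scale_sum_right mult_ac)
      next
        case False
        then have "\<phi> y = 0" using \<phi>(9,10) by blast
        then show ?thesis by (simp add: a_def)
      qed
      then show "A y = sc (c y) (A y) + (\<Sum>b\<in>basis. sc (a b y) (E b y))"
        by (simp add: c_def V.scale_left_diff_distrib)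
    qed
  qed
qed

section \<open>Maps of sections that are linear over smooth functions\<close>

definition fun_linear :: "(('m \<Rightarrow> 'f) \<Rightarrow> 'm \<Rightarrow> 'f) \<Rightarrow> bool" where
  "fun_linear f \<longleftrightarrow> (\<forall>A\<in>\<Gamma>. \<forall>B\<in>\<Gamma>. \<forall>x. f (\<lambda>y. A y + B y) x = f A x + f B x) \<and>
     (\<forall>A\<in>\<Gamma>. \<forall>a. smooth a \<longrightarrow> (\<forall>x. f (\<lambda>y. sc (a y) (A y)) x = sc (a x) (f A x)))"

lemma fun_linear_add: "fun_linear f \<Longrightarrow> A \<in> \<Gamma> \<Longrightarrow> B \<in> \<Gamma> \<Longrightarrow> f (\<lambda>y. A y + B y) x = f A x + f B x"
  and fun_linear_scale: "fun_linear f \<Longrightarrow> A \<in> \<Gamma> \<Longrightarrow> smooth a \<Longrightarrow> f (\<lambda>y. sc (a y) (A y)) x = sc (a x) (f A x)"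
  by (simp_all add: fun_linear_def)

lemma fun_linear_zero: "fun_linear f \<Longrightarrow> f (\<lambda>_. 0) x = 0"
  using fun_linear_add[OF _ \<Gamma>_zero \<Gamma>_zero] by simp

lemma fun_linear_sum:
  assumes "fun_linear f" "\<And>i. i \<in> I \<Longrightarrow> A i \<in> \<Gamma>"
  shows "f (\<lambda>y. \<Sum>i\<in>I. A i y) x = (\<Sum>i\<in>I. f (A i) x)"
  using assms(2)
proof (induction I rule: infinite_finite_induct)
  case (insert i I)
  then have "A i \<in> \<Gamma>" "(\<lambda>y. \<Sum>i\<in>I. A i y) \<in> \<Gamma>" by (auto intro: \<Gamma>_sum)
  from fun_linear_add[OF assms(1) this] insert show ?case by simp
qed (simp_all add: fun_linear_zero[OF assms(1)])

text \<open>Every summand of the decomposition of \<open>A\<close> has a scalar factor that vanishes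
  at \<open>x\<close>, and \<open>f\<close> lets scalar factors out.\<close>

lemma fun_linear_vanish:
  assumes f: "fun_linear f" and A: "A \<in> \<Gamma>" "A x = 0"
  shows "f A x = 0"
proof -
  from A obtain c a E where c: "smooth c" "c x = 0" "\<And>b. smooth (a b)" "\<And>b. a b x = 0" "\<And>b. E b \<in> \<Gamma>"
    "A = (\<lambda>y. sc (c y) (A y) + (\<Sum>b\<in>basis. sc (a b y) (E b y)))" by (rule \<Gamma>_vanishing) blast
  have E: "(\<lambda>y. sc (a b y) (E b y)) \<in> \<Gamma>" for b by (rule \<Gamma>_scale[OF c(3,5)])
  have "f A x = f (\<lambda>y. sc (c y) (A y) + (\<Sum>b\<in>basis. sc (a b y) (E b y))) x"
    using c(6) by (rule arg_cong2[OF _ refl])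
  also have "\<dots> = f (\<lambda>y. sc (c y) (A y)) x + (\<Sum>b\<in>basis. f (\<lambda>y. sc (a b y) (E b y)) x)"
    unfolding fun_linear_sum[OF f E, symmetric]
    by (rule fun_linear_add[OF f \<Gamma>_scale[OF c(1) A(1)] \<Gamma>_sum[OF E]])
  also have "\<dots> = 0"
    using fun_linear_scale[OF f A(1) c(1)] fun_linear_scale[OF f c(5,3)] c(2,4) by simp
  finally show ?thesis .
qed

lemma fun_linear_tensorial:
  assumes f: "fun_linear f" and "A \<in> \<Gamma>" "B \<in> \<Gamma>" "A x = B x"
  shows "f A x = f B x"
proof -
  let ?C = "\<lambda>y. sc (- 1) (B y)"
  have C: "?C \<in> \<Gamma>" by (rule \<Gamma>_scale_const[OF assms(3)])
  have "f (\<lambda>y. A y + ?C y) x = 0"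
    using assms by (intro fun_linear_vanish[OF f \<Gamma>_add[OF assms(2) C]]) (simp add: V.scale_minus_left)
  moreover have "f (\<lambda>y. A y + ?C y) x = f A x + f ?C x" by (rule fun_linear_add[OF f assms(2) C])
  moreover have "f ?C x = sc (- 1) (f B x)" by (rule fun_linear_scale[OF f assms(3) smooth_const])
  ultimately show ?thesis by (simp add: V.scale_minus_left)
qed


subsection \<open>Perfectness of the Lie algebra of sections\<close>

text \<open>
  On each of the finitely many open sets \<open>P i\<close> the bundle is trivial, so a section supported in
  \<open>P i\<close> is a sum of as many brackets as elements of the fibre need.
\<close>

lemma perfect_sections:
  assumes perf: "perfect_lie G" and A: "A \<in> \<Gamma>"
  obtains I :: "(('e set \<times> nat) \<times> 'f) set" and B C where "finite I"
    "\<And>i. i \<in> I \<Longrightarrow> B i \<in> \<Gamma>" "\<And>i. i \<in> I \<Longrightarrow> C i \<in> \<Gamma>"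
    "A = (\<lambda>x. \<Sum>i\<in>I. br (B i x) (C i x))"
proof -
  obtain Bs p q where Bs: "V.independent Bs" "V.span Bs = UNIV" "\<And>b. b \<in> Bs \<Longrightarrow> b = br (p b) (q b)"
    using perfect_basis[OF perf] by blast
  have finBs: "finite Bs" by (rule V.finiteI_independent[OF Bs(1)])
  have "\<And>W. W \<in> fst ` T \<Longrightarrow> open W" using T_open by auto
  moreover have "\<Union>(fst ` T) = UNIV" using T_cover by force
  ultimately obtain I :: "('e set \<times> nat) set" and b :: "'e set \<times> nat \<Rightarrow> 'm \<Rightarrow> real" and P K w where
    I: "finite I" "\<And>i. i \<in> I \<Longrightarrow> smooth (b i)" "\<And>i. i \<in> I \<Longrightarrow> open (P i)"
    "\<And>i. i \<in> I \<Longrightarrow> closed (K i)" "\<And>i. i \<in> I \<Longrightarrow> K i \<subseteq> P i"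
    "\<And>i x. i \<in> I \<Longrightarrow> x \<notin> K i \<Longrightarrow> b i x = 0"
    "\<And>i x. i \<in> I \<Longrightarrow> x \<in> P i \<Longrightarrow> w i x \<in> fst ` T \<and> x \<in> w i x \<and>
       (\<exists>N. open N \<and> x \<in> N \<and> N \<subseteq> P i \<and> (\<forall>y\<in>N. w i y = w i x))"
    "\<And>x. \<exists>i\<in>I. b i x \<noteq> 0" by (rule ex_finite_locally_constant_cover) blast+
  define G' where "G' W = (SOME g. (W, g) \<in> T)" for W
  have G': "(W, G' W) \<in> T" if "W \<in> fst ` T" for W
  proof -
    from that obtain g where "(W, g) \<in> T" by auto
    then show ?thesis unfolding G'_def by (rule someI[of "\<lambda>g. (W, g) \<in> T"])
  qed
  define g where "g i x = G' (w i x) x" for i x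
  have aut: "g i x \<in> lie_aut G" if "i \<in> I" "x \<in> P i" for i x
    unfolding g_def using I(7)[OF that] by (intro T_aut[OF G']) auto
  have loc: "\<exists>N W. open N \<and> x \<in> N \<and> (W, G' W) \<in> T \<and> x \<in> W \<and> (\<forall>y\<in>N. g i y = G' W y)"
    if "i \<in> I" "x \<in> P i" for i x
  proof -
    from I(7)[OF that] obtain N where "open N" "x \<in> N" "\<forall>y\<in>N. w i y = w i x" by blast
    moreover have "(w i x, G' (w i x)) \<in> T" "x \<in> w i x" using I(7)[OF that] G' by blast+
    moreover from calculation(3) have "\<forall>y\<in>N. g i y = G' (w i x) y" by (simp add: g_def)
    ultimately show ?thesis by blast
  qed
  have sm_const: "sm_sec (\<lambda>y. inv (g i y) u) x" if ix: "i \<in> I" "x \<in> P i" for i x u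
  proof -
    obtain N W where N: "open N" "x \<in> N" "(W, G' W) \<in> T" "x \<in> W" "\<forall>y\<in>N. g i y = G' W y"
      using loc[OF ix] by blast
    show ?thesis by (rule sm_sec_cong[OF sm_sec_const[OF N(3,4), of u] N(1,2)]) (use N(5) in auto)
  qed
  have sm_coeff: "smooth_at M (\<lambda>y. V.representation Bs (g i y (A y)) c) x" if ix: "i \<in> I" "x \<in> P i" for i x c
  proof -
    obtain N W where N: "open N" "x \<in> N" "(W, G' W) \<in> T" "x \<in> W" "\<forall>y\<in>N. g i y = G' W y"
      using loc[OF ix] by blast
    have "smooth_at M (\<lambda>y. V.representation Bs (G' W y (A y)) c) x"
      using smf_lfun[OF lfun_representation[OF Bs(1,2)] sm_sec_chart[OF \<Gamma>D[OF A] N(3,4)]] .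
    then show ?thesis by (rule smooth_at_cong[OF _ N(1,2)]) (use N(5) in auto)
  qed
  \<comment> \<open>The \<open>b i\<close> merely have no common zero; dividing by \<open>s\<close>
    turns their squares into a partition of unity. Squares occur because both sides of a bracket
    need a factor \<open>b i\<close> to be globally defined.\<close>
  define s where "s x = (\<Sum>i\<in>I. b i x * b i x)" for x
  have s: "s x \<noteq> 0" for x
  proof -
    obtain i where "i \<in> I" "b i x \<noteq> 0" using I(8) by blast
    then have "0 < s x" unfolding s_def using I(1)
      by (intro sum_pos2[of I i]) (auto simp: zero_less_mult_iff linorder_neq_iff)
    then show ?thesis by simp
  qed
  have "smooth_at M s x" for x
    using I(2) unfolding s_def smooth_iff by (intro smooth_at_sum smooth_at_mult) auto
  then have ss: "smooth_at M (\<lambda>y. inverse (s y)) x" for x using s by (intro smooth_at_inverse)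
  define B where "B = (\<lambda>(i, c) y. sc (of_real (b i y))
    (sc (of_real (inverse (s y)) * V.representation Bs (g i y (A y)) c) (inv (g i y) (p c))))"
  define C where "C = (\<lambda>(i, c) y. sc (of_real (b i y)) (inv (g i y) (q c)))"
  show ?thesis
  proof (rule that[of "I \<times> Bs" B C])
    show "finite (I \<times> Bs)" using I(1) finBs by simp
  next
    fix j assume "j \<in> I \<times> Bs"
    then obtain i c where j: "j = (i, c)" "i \<in> I" by auto
    show "C j \<in> \<Gamma>" unfolding j C_def prod.case
      by (rule cutoff_in_\<Gamma>[OF I(2)[OF j(2)] I(4)[OF j(2)] I(5)[OF j(2)] I(6)[OF j(2)] sm_const[OF j(2)]])
    show "B j \<in> \<Gamma>" unfolding j B_def prod.case
    proof (rule cutoff_in_\<Gamma>[OF I(2)[OF j(2)] I(4)[OF j(2)] I(5)[OF j(2)] I(6)[OF j(2)]])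
      fix y assume "y \<in> P i"
      then show "sm_sec (\<lambda>y. sc (of_real (inverse (s y)) * V.representation Bs (g i y (A y)) c) (inv (g i y) (p c))) y"
        using j(2) by (intro sm_sec_scale sm_const smooth_at_mult smooth_at_of_real ss sm_coeff)
    qed
  next
    show "A = (\<lambda>x. \<Sum>j\<in>I \<times> Bs. br (B j x) (C j x))"
    proof
      fix x
      have "(\<Sum>c\<in>Bs. br (B (i, c) x) (C (i, c) x)) = sc (of_real (b i x * b i x * inverse (s x))) (A x)"
        if i: "i \<in> I" for i
      proof (cases "x \<in> P i")
        case True
        note au = aut[OF i True] and la = lie_aut_lin[OF lie_aut_inv[OF aut[OF i True]]]
        have "(\<Sum>c\<in>Bs. br (B (i, c) x) (C (i, c) x))
            = (\<Sum>c\<in>Bs. sc (of_real (b i x * b i x * inverse (s x)))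
                (inv (g i x) (sc (V.representation Bs (g i x (A x)) c) (br (p c) (q c)))))"
          by (simp add: B_def C_def br_scale_left br_scale_right lin_scale[OF la]
              lie_aut_br[OF lie_aut_inv[OF au]] mult_ac)
        also have "\<dots> = (\<Sum>c\<in>Bs. sc (of_real (b i x * b i x * inverse (s x)))
                (inv (g i x) (sc (V.representation Bs (g i x (A x)) c) c)))"
          using Bs(3) by (intro sum.cong) auto
        also have "\<dots> = sc (of_real (b i x * b i x * inverse (s x)))
            (inv (g i x) (\<Sum>c\<in>Bs. sc (V.representation Bs (g i x (A x)) c) c))"
          by (simp add: lin_sum[OF la] V.scale_sum_right)
        finally show ?thesis
          by (simp add: representation_expand[OF Bs(1,2)] lie_aut_inv_apply[OF au])
      next
        case False
        then have "b i x = 0" using I(5,6) i by blast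
        then show ?thesis by (simp add: B_def C_def br_zero_left)
      qed
      then have "(\<Sum>j\<in>I \<times> Bs. br (B j x) (C j x))
          = (\<Sum>i\<in>I. sc (of_real (b i x * b i x * inverse (s x))) (A x))"
        by (simp add: sum.cartesian_product')
      also have "\<dots> = sc (of_real (s x * inverse (s x))) (A x)"
        by (simp add: V.scale_sum_left[symmetric] s_def sum_distrib_right)
      finally show "A x = (\<Sum>j\<in>I \<times> Bs. br (B j x) (C j x))" using s by simp
    qed
  qed
qed


subsection \<open>Centroid\<close>

text \<open>Only additivity is demanded; homogeneity, for constants too, comes out of
  \<open>centroid_fun_linear\<close>.\<close>

definition centroid :: "(('m \<Rightarrow> 'f) \<Rightarrow> 'm \<Rightarrow> 'f) \<Rightarrow> bool" where
  "centroid f \<longleftrightarrow> (\<forall>A\<in>\<Gamma>. f A \<in> \<Gamma>) \<and>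
     (\<forall>A\<in>\<Gamma>. \<forall>B\<in>\<Gamma>. \<forall>x. f (\<lambda>y. A y + B y) x = f A x + f B x) \<and>
     (\<forall>A\<in>\<Gamma>. \<forall>B\<in>\<Gamma>. \<forall>x. f (\<lambda>y. br (A y) (B y)) x = br (f A x) (B x)) \<and>
     (\<forall>A\<in>\<Gamma>. \<forall>B\<in>\<Gamma>. \<forall>x. f (\<lambda>y. br (A y) (B y)) x = br (A x) (f B x))"

lemma centroid_sum:
  assumes f: "centroid f" and "\<And>i. i \<in> I \<Longrightarrow> A i \<in> \<Gamma>"
  shows "f (\<lambda>y. \<Sum>i\<in>I. A i y) x = (\<Sum>i\<in>I. f (A i) x)"
proof -
  have add: "f (\<lambda>y. A y + B y) x = f A x + f B x" if "A \<in> \<Gamma>" "B \<in> \<Gamma>" for A B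
    using f that by (simp add: centroid_def)
  have zero: "f (\<lambda>_. 0) x = 0" using add[OF \<Gamma>_zero \<Gamma>_zero] by simp
  show ?thesis using assms(2)
  proof (induction I rule: infinite_finite_induct)
    case (insert i I)
    then have "A i \<in> \<Gamma>" "(\<lambda>y. \<Sum>i\<in>I. A i y) \<in> \<Gamma>" by (auto intro: \<Gamma>_sum)
    from add[OF this] insert show ?case by simp
  qed (simp_all add: zero)
qed

text \<open>Both cases rest on moving \<open>f\<close> to the other factor and back: [f(aA), B] =
  f[aA, B] = [aA, f(B)] = a[A, f(B)] = a[f(A), B]. If the fibre is centerfree, f(aA) - a f(A) has
  zero bracket with everything and vanishes; if it is perfect, \<open>A\<close> is a sum of brackets
  whose left factors absorb \<open>a\<close>.\<close>

lemma centroid_fun_linear: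
  assumes G: "perfect_lie G \<or> centerfree_lie G" and f: "centroid f"
  shows "fun_linear f"
  unfolding fun_linear_def
proof (intro conjI ballI allI impI)
  note f1 = f[unfolded centroid_def, THEN conjunct2, THEN conjunct2, THEN conjunct1, rule_format]
  note f2 = f[unfolded centroid_def, THEN conjunct2, THEN conjunct2, THEN conjunct2, rule_format]
  show "f (\<lambda>y. A y + B y) x = f A x + f B x" if "A \<in> \<Gamma>" "B \<in> \<Gamma>" for A B x
    using f that by (simp add: centroid_def)
  fix A x and a :: "'m \<Rightarrow> 'k" assume A: "A \<in> \<Gamma>" and a: "smooth a"
  have br_swap_scalar: "br (f (\<lambda>y. sc (a y) (A y)) x) (B x) = sc (a x) (br (f A x) (B x))"
    if A: "A \<in> \<Gamma>" and B: "B \<in> \<Gamma>" for A B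
  proof -
    have "br (f (\<lambda>y. sc (a y) (A y)) x) (B x) = sc (a x) (br (A x) (f B x))"
      using f1[OF \<Gamma>_scale[OF a A] B, of x] f2[OF \<Gamma>_scale[OF a A] B, of x] by (simp add: br_scale_left)
    then show ?thesis using f1[OF A B, of x] f2[OF A B, of x] by simp
  qed
  from G show "f (\<lambda>y. sc (a y) (A y)) x = sc (a x) (f A x)"
  proof
    assume "perfect_lie G"
    from this A obtain I :: "(('e set \<times> nat) \<times> 'f) set" and B C where BC: "finite I"
      "\<And>i. i \<in> I \<Longrightarrow> B i \<in> \<Gamma>" "\<And>i. i \<in> I \<Longrightarrow> C i \<in> \<Gamma>"
      "A = (\<lambda>x. \<Sum>i\<in>I. br (B i x) (C i x))" by (rule perfect_sections) blast
    have "f (\<lambda>y. sc (a y) (A y)) x = f (\<lambda>y. \<Sum>i\<in>I. br (sc (a y) (B i y)) (C i y)) x"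
      by (simp add: BC(4) V.scale_sum_right br_scale_left)
    also have "\<dots> = (\<Sum>i\<in>I. f (\<lambda>y. br (sc (a y) (B i y)) (C i y)) x)"
      using BC(2,3) by (intro centroid_sum[OF f] \<Gamma>_br \<Gamma>_scale[OF a])
    also have "\<dots> = (\<Sum>i\<in>I. br (f (\<lambda>y. sc (a y) (B i y)) x) (C i x))"
      using BC(2,3) by (intro sum.cong refl f1 \<Gamma>_scale[OF a])
    also have "\<dots> = (\<Sum>i\<in>I. sc (a x) (br (f (B i) x) (C i x)))"
      using BC(2,3) by (intro sum.cong refl br_swap_scalar)
    also have "\<dots> = (\<Sum>i\<in>I. sc (a x) (f (\<lambda>y. br (B i y) (C i y)) x))"
      using BC(2,3) f1 by (intro sum.cong refl) simp
    also have "\<dots> = sc (a x) (f (\<lambda>y. \<Sum>i\<in>I. br (B i y) (C i y)) x)"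
      using BC(2,3) \<Gamma>_br by (subst centroid_sum[OF f]) (simp_all add: V.scale_sum_right)
    also have "\<dots> = sc (a x) (f A x)" by (simp add: BC(4))
    finally show ?thesis .
  next
    assume cf: "centerfree_lie G"
    have "br (f (\<lambda>y. sc (a y) (A y)) x - sc (a x) (f A x)) u = 0" for u
    proof -
      obtain B where "B \<in> \<Gamma>" "B x = u" by (rule ex_\<Gamma>_through)
      then show ?thesis using br_swap_scalar[OF A] by (auto simp: br_diff_left br_scale_left)
    qed
    then have "f (\<lambda>y. sc (a y) (A y)) x - sc (a x) (f A x) = 0"
      using cf unfolding centerfree_lie_def by blast
    then show ?thesis by simp
  qed
qed

end


section \<open>Symbols of derivations\<close>

text \<open>\<open>vf_act\<close> at one point, where only the value of the field there
  matters.\<close>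

definition tv_act :: "'m tvec \<Rightarrow> ('m \<Rightarrow> 'k::euclidean_space) \<Rightarrow> 'k" where
  "tv_act v a = (\<Sum>b\<in>Basis. v (\<lambda>y. a y \<bullet> b) *\<^sub>R b)"

lemma vf_act_eq: "vf_act X a x = tv_act (X x) a"
  by (simp add: vf_act_def tv_act_def)

context smooth_mfd
begin

lemma tv_act_of_real:
  assumes v: "v \<in> tangent_space M x" and f: "smooth f"
  shows "tv_act v (\<lambda>y. of_real (f y) :: 'k::{real_normed_field,euclidean_space}) = of_real (v f)"
proof -
  have "v (\<lambda>y. of_real (f y) \<bullet> b) = v f * (1 \<bullet> b)" for b :: 'k
  proof -
    have "(\<lambda>y. of_real (f y) \<bullet> b) = (\<lambda>y. (1 \<bullet> b) * f y)" by (simp add: of_real_def mult.commute)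
    then show ?thesis using tangent_scale[OF v f, of "1 \<bullet> b"] by simp
  qed
  then have "tv_act v (\<lambda>y. of_real (f y) :: 'k) = v f *\<^sub>R (\<Sum>b\<in>Basis. (1 \<bullet> b) *\<^sub>R (b :: 'k))"
    by (simp add: tv_act_def scaleR_sum_right)
  also have "\<dots> = of_real (v f)" by (simp only: euclidean_representation of_real_def)
  finally show ?thesis .
qed

end

context twisted
begin

definition derivation :: "(('m \<Rightarrow> 'f) \<Rightarrow> 'm \<Rightarrow> 'f) \<Rightarrow> bool" where
  "derivation D \<longleftrightarrow> (\<forall>A\<in>\<Gamma>. D A \<in> \<Gamma>) \<and>
     (\<forall>A\<in>\<Gamma>. \<forall>B\<in>\<Gamma>. \<forall>x. D (\<lambda>y. A y + B y) x = D A x + D B x) \<and>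
     (\<forall>c. \<forall>A\<in>\<Gamma>. \<forall>x. D (\<lambda>y. sc c (A y)) x = sc c (D A x)) \<and>
     (\<forall>A\<in>\<Gamma>. \<forall>B\<in>\<Gamma>. \<forall>x. D (\<lambda>y. br (A y) (B y)) x = br (D A x) (B x) + br (A x) (D B x))"

definition delta :: "(('m \<Rightarrow> 'f) \<Rightarrow> 'm \<Rightarrow> 'f) \<Rightarrow> ('m \<Rightarrow> 'k) \<Rightarrow> ('m \<Rightarrow> 'f) \<Rightarrow> 'm \<Rightarrow> 'f" where
  "delta D a A x = D (\<lambda>y. sc (a y) (A y)) x - sc (a x) (D A x)"

end

locale twisted_derivation = twisted M G T
  for M :: "('m::t2_space, 'e::real_inner) manifold_data"
    and G :: "('k::{real_normed_field,euclidean_space}, 'f::ab_group_add) lie_algebra_data" and T +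
  fixes D :: "('m \<Rightarrow> 'f) \<Rightarrow> 'm \<Rightarrow> 'f"
  assumes deriv: "derivation D"
    and perfect_or_centerfree: "perfect_lie G \<or> centerfree_lie G"
begin

lemma D_\<Gamma>: "A \<in> \<Gamma> \<Longrightarrow> D A \<in> \<Gamma>"
  and D_add: "A \<in> \<Gamma> \<Longrightarrow> B \<in> \<Gamma> \<Longrightarrow> D (\<lambda>y. A y + B y) x = D A x + D B x"
  and D_scale: "A \<in> \<Gamma> \<Longrightarrow> D (\<lambda>y. sc c (A y)) x = sc c (D A x)"
  and D_br: "A \<in> \<Gamma> \<Longrightarrow> B \<in> \<Gamma> \<Longrightarrow> D (\<lambda>y. br (A y) (B y)) x = br (D A x) (B x) + br (A x) (D B x)"
  using deriv by (simp_all add: derivation_def)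

lemma delta_\<Gamma>: "smooth a \<Longrightarrow> A \<in> \<Gamma> \<Longrightarrow> delta D a A \<in> \<Gamma>"
  unfolding delta_def[abs_def] by (intro \<Gamma>_diff D_\<Gamma> \<Gamma>_scale)

text \<open>In D(a[A, B]) the scalar can be put into either factor before the product rule is used;
  the term in which \<open>D\<close> hits the other factor cancels against the same term of a
  D[A, B].\<close>

lemma delta_centroid:
  assumes a: "smooth a"
  shows "centroid (delta D a)"
  unfolding centroid_def
proof (intro conjI ballI allI)
  fix A assume A: "A \<in> \<Gamma>"
  note aA = \<Gamma>_scale[OF a A]
  show "delta D a A \<in> \<Gamma>" by (rule delta_\<Gamma>[OF a A])
  fix B x assume B: "B \<in> \<Gamma>"
  note aB = \<Gamma>_scale[OF a B]
  show "delta D a (\<lambda>y. A y + B y) x = delta D a A x + delta D a B x"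
    by (simp add: delta_def V.scale_right_distrib D_add[OF A B] D_add[OF aA aB])
  have "D (\<lambda>y. sc (a y) (br (A y) (B y))) x = br (D (\<lambda>y. sc (a y) (A y)) x) (B x) + sc (a x) (br (A x) (D B x))"
    using D_br[OF aA B] by (simp add: br_scale_left)
  then show "delta D a (\<lambda>y. br (A y) (B y)) x = br (delta D a A x) (B x)"
    by (simp add: delta_def D_br[OF A B] br_diff_left br_scale_left V.scale_right_distrib)
  have "D (\<lambda>y. sc (a y) (br (A y) (B y))) x = sc (a x) (br (D A x) (B x)) + br (A x) (D (\<lambda>y. sc (a y) (B y)) x)"
    using D_br[OF A aB] by (simp add: br_scale_right)
  then show "delta D a (\<lambda>y. br (A y) (B y)) x = br (A x) (delta D a B x)"
    by (simp add: delta_def D_br[OF A B] br_diff_right br_scale_right V.scale_right_distrib)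
qed

lemma delta_fun_linear: "smooth a \<Longrightarrow> fun_linear (delta D a)"
  by (rule centroid_fun_linear[OF perfect_or_centerfree delta_centroid])

lemma delta_add:
  assumes "smooth a" "smooth b" "A \<in> \<Gamma>"
  shows "delta D (\<lambda>y. a y + b y) A x = delta D a A x + delta D b A x"
  using D_add[OF \<Gamma>_scale[OF assms(1,3)] \<Gamma>_scale[OF assms(2,3)], of x]
  by (simp add: delta_def V.scale_left_distrib)

lemma delta_const: "A \<in> \<Gamma> \<Longrightarrow> delta D (\<lambda>_. c) A x = 0"
  by (simp add: delta_def D_scale)

text \<open>The commutator identity [D, ab] = [D, a]b + a[D, b], after which linearity of [D, a]
  over functions takes \<open>b\<close> out.\<close>

lemma delta_mult:
  assumes a: "smooth a" and b: "smooth b" and A: "A \<in> \<Gamma>"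
  shows "delta D (\<lambda>y. a y * b y) A x = sc (a x) (delta D b A x) + sc (b x) (delta D a A x)"
proof -
  have "delta D (\<lambda>y. a y * b y) A x
      = delta D a (\<lambda>y. sc (b y) (A y)) x + sc (a x) (delta D b A x)"
    by (simp add: delta_def V.scale_right_diff_distrib)
  then show ?thesis using fun_linear_scale[OF delta_fun_linear[OF a] A b] by simp
qed

lemma delta_cmult: "smooth a \<Longrightarrow> A \<in> \<Gamma> \<Longrightarrow> delta D (\<lambda>y. c * a y) A x = sc c (delta D a A x)"
  using delta_mult[OF smooth_const] delta_const by simp

lemma delta_sum:
  assumes "\<And>i. i \<in> I \<Longrightarrow> smooth (a i)" "A \<in> \<Gamma>"
  shows "delta D (\<lambda>y. \<Sum>i\<in>I. a i y) A x = (\<Sum>i\<in>I. delta D (a i) A x)"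
  using assms(1)
proof (induction I rule: infinite_finite_induct)
  case (insert i I)
  then have "smooth (a i)" "smooth (\<lambda>y. \<Sum>i\<in>I. a i y)"
    unfolding smooth_iff by (auto intro: smooth_at_sum)
  from delta_add[OF this assms(2)] insert show ?case by simp
qed (simp_all add: delta_const[OF assms(2), of 0])

abbreviation delta_real :: "('m \<Rightarrow> real) \<Rightarrow> ('m \<Rightarrow> 'f) \<Rightarrow> 'm \<Rightarrow> 'f" where
  "delta_real f \<equiv> delta D (\<lambda>y. of_real (f y))"

lemma smooth_of_real: "smooth f \<Longrightarrow> smooth (\<lambda>y. of_real (f y) :: 'k)"
  by (simp add: smooth_iff smooth_at_of_real)

text \<open>Makes the locality and the coordinate expansion of tangent vectors available for
  \<open>delta\<close>; \<open>eq_by_functionals\<close> then returns from real components to values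
  in the fibre.\<close>

lemma delta_tangent:
  assumes l: "lfun l" and A: "A \<in> \<Gamma>"
  shows "(\<lambda>f. if smooth f then l (delta_real f A x) \<bullet> b else 0) \<in> tangent_space M x"
  unfolding tangent_space_def mem_Collect_eq
proof (intro conjI allI impI)
  fix f g :: "'m \<Rightarrow> real" assume f: "smooth f" and g: "smooth g"
  have sm: "smooth (\<lambda>y. f y + g y)" "smooth (\<lambda>y. f y * g y)"
    using f g by (auto simp: smooth_iff intro!: smooth_at_intros)
  show "(if smooth (\<lambda>y. f y + g y) then l (delta_real (\<lambda>y. f y + g y) A x) \<bullet> b else 0)
      = (if smooth f then l (delta_real f A x) \<bullet> b else 0) + (if smooth g then l (delta_real g A x) \<bullet> b else 0)"
    using f g sm delta_add[OF smooth_of_real[OF f] smooth_of_real[OF g] A]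
    by (simp add: lfun_add[OF l] inner_add_left)
  show "(if smooth (\<lambda>y. f y * g y) then l (delta_real (\<lambda>y. f y * g y) A x) \<bullet> b else 0)
      = (if smooth f then l (delta_real f A x) \<bullet> b else 0) * g x
        + f x * (if smooth g then l (delta_real g A x) \<bullet> b else 0)"
    using f g sm delta_mult[OF smooth_of_real[OF f] smooth_of_real[OF g] A]
    by (simp add: lfun_add[OF l] lfun_scale[OF l] inner_add_left of_real_def mult.commute)
next
  fix f :: "'m \<Rightarrow> real" and c assume f: "smooth f"
  have sm: "smooth (\<lambda>y. c * f y)"
    using f by (auto simp: smooth_iff intro!: smooth_at_intros)
  show "(if smooth (\<lambda>y. c * f y) then l (delta_real (\<lambda>y. c * f y) A x) \<bullet> b else 0)
      = c * (if smooth f then l (delta_real f A x) \<bullet> b else 0)"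
  proof -
    have "delta_real (\<lambda>y. c * f y) A x = sc (of_real c) (delta_real f A x)"
      using delta_cmult[OF smooth_of_real[OF f] A, of "of_real c"] by simp
    moreover have "(of_real c * z) \<bullet> b = c * (z \<bullet> b)" for z :: 'k
      by (simp add: of_real_def)
    ultimately show ?thesis using f sm by (simp add: lfun_scale[OF l])
  qed
qed simp

lemma eq_by_functionals:
  assumes "\<And>l b. lfun l \<Longrightarrow> l u \<bullet> b = l v \<bullet> b"
  shows "u = v"
proof (rule co_eqI)
  show "co c u = co c v" for c by (rule euclidean_eqI) (rule assms[OF lfun_co])
qed

lemma delta_local:
  assumes A: "A \<in> \<Gamma>" and f: "smooth f" "smooth g" "open N" "x \<in> N" "\<And>y. y \<in> N \<Longrightarrow> f y = g y"
  shows "delta_real f A x = delta_real g A x"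
proof (rule eq_by_functionals)
  fix l and b :: 'k assume l: "lfun l"
  from tangent_local[OF delta_tangent[OF l A] f] f(1,2)
  show "l (delta_real f A x) \<bullet> b = l (delta_real g A x) \<bullet> b" by simp
qed

lemma delta_real_expand:
  assumes U: "(U, \<xi>) \<in> charts M" and \<zeta>: "coordinates_near U \<xi> N \<zeta>" "x \<in> N"
    and f: "smooth f" and A: "A \<in> \<Gamma>"
  shows "delta_real f A x
    = (\<Sum>e\<in>frame M. sc (of_real (coord_field M U \<xi> e x f)) (delta_real (\<zeta> e) A x))"
proof (rule eq_by_functionals)
  fix l and b :: 'k assume l: "lfun l"
  have s: "smooth (\<zeta> e)" for e using \<zeta>(1) by (simp add: coordinates_near_def)
  have "l (delta_real f A x) \<bullet> b
      = (\<Sum>e\<in>frame M. l (delta_real (\<zeta> e) A x) \<bullet> b * coord_field M U \<xi> e x f)"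
    using fun_cong[OF tangent_expand[OF U \<zeta> delta_tangent[OF l A]], of f] f s by simp
  also have "\<dots> = l (\<Sum>e\<in>frame M. sc (of_real (coord_field M U \<xi> e x f)) (delta_real (\<zeta> e) A x)) \<bullet> b"
    by (simp add: lfun_sum[OF l] lfun_scale[OF l] inner_sum_left of_real_def mult.commute)
  finally show "l (delta_real f A x) \<bullet> b
      = l (\<Sum>e\<in>frame M. sc (of_real (coord_field M U \<xi> e x f)) (delta_real (\<zeta> e) A x)) \<bullet> b" .
qed

text \<open>A \<open>'k\<close>-valued function is a sum of basis elements of \<open>'k\<close>
  times real functions, and the basis elements come out as constants because \<open>D\<close> is
  linear over \<open>'k\<close>.\<close>

lemma delta_expand:
  assumes U: "(U, \<xi>) \<in> charts M" and \<zeta>: "coordinates_near U \<xi> N \<zeta>" "x \<in> N"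
    and a: "smooth a" and A: "A \<in> \<Gamma>"
  shows "delta D a A x
    = (\<Sum>e\<in>frame M. sc (tv_act (coord_field M U \<xi> e x) a) (delta_real (\<zeta> e) A x))"
proof -
  have sa: "smooth (\<lambda>y. a y \<bullet> b)" for b
    using a by (simp add: smooth_iff smooth_at_inner)
  have eq: "a = (\<lambda>y. \<Sum>b\<in>Basis. b * of_real (a y \<bullet> b))"
    by (simp add: fun_eq_iff of_real_def euclidean_representation)
  have "delta D a A x = delta D (\<lambda>y. \<Sum>b\<in>Basis. b * of_real (a y \<bullet> b)) A x"
    using eq by simp
  also have "\<dots> = (\<Sum>b\<in>Basis. delta D (\<lambda>y. b * of_real (a y \<bullet> b)) A x)"
    using a by (intro delta_sum[OF _ A]) (auto simp: smooth_iff intro!: smooth_at_intros)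
  also have "\<dots> = (\<Sum>b\<in>Basis. sc b (delta_real (\<lambda>y. a y \<bullet> b) A x))"
    by (intro sum.cong refl delta_cmult[OF smooth_of_real[OF sa] A])
  also have "\<dots> = (\<Sum>b\<in>Basis. sc b (\<Sum>e\<in>frame M.
      sc (of_real (coord_field M U \<xi> e x (\<lambda>y. a y \<bullet> b))) (delta_real (\<zeta> e) A x)))"
    by (simp only: delta_real_expand[OF U \<zeta> sa A])
  also have "\<dots> = (\<Sum>e\<in>frame M. \<Sum>b\<in>Basis.
      sc (of_real (coord_field M U \<xi> e x (\<lambda>y. a y \<bullet> b)) * b) (delta_real (\<zeta> e) A x))"
    by (subst sum.swap) (simp add: V.scale_sum_right mult.commute)
  also have "\<dots> = (\<Sum>e\<in>frame M. sc (tv_act (coord_field M U \<xi> e x) a) (delta_real (\<zeta> e) A x))"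
    by (simp add: tv_act_def V.scale_sum_left of_real_def)
  finally show ?thesis .
qed

section \<open>Components of the symbol in a chart\<close>

definition through :: "'m \<Rightarrow> 'f \<Rightarrow> 'm \<Rightarrow> 'f" where
  "through x u = (SOME A. A \<in> \<Gamma> \<and> A x = u)"

lemma through: "through x u \<in> \<Gamma>" "through x u x = u"
proof -
  have "\<exists>A. A \<in> \<Gamma> \<and> A x = u" by (rule ex_\<Gamma>_through) blast
  then have "through x u \<in> \<Gamma> \<and> through x u x = u"
    unfolding through_def by (rule someI_ex)
  then show "through x u \<in> \<Gamma>" "through x u x = u" by auto
qed

text \<open>The component \<open>S\<^sup>e\<close> of the symbol of \<open>D\<close> in a chart is its value on the \<open>e\<close>-th coordinate function.\<close>

definition comp :: "'m set \<Rightarrow> ('m \<Rightarrow> 'e) \<Rightarrow> 'e \<Rightarrow> 'm \<Rightarrow> 'f \<Rightarrow> 'f" where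
  "comp U \<xi> e x u = delta_real ((SOME \<zeta>. \<exists>N. coordinates_near U \<xi> N \<zeta> \<and> x \<in> N) e) (through x u) x"

text \<open>Neither choice inside \<open>comp\<close> matters: the section can be exchanged by
  linearity over functions, the cut-off coordinates by locality.\<close>

lemma comp_eq:
  assumes U: "(U, \<xi>) \<in> charts M" and \<zeta>: "coordinates_near U \<xi> N \<zeta>" "x \<in> N" and A: "A \<in> \<Gamma>"
  shows "comp U \<xi> e x (A x) = delta_real (\<zeta> e) A x"
proof -
  define \<zeta>' where "\<zeta>' = (SOME \<zeta>. \<exists>N. coordinates_near U \<xi> N \<zeta> \<and> x \<in> N)"
  have "\<exists>N. coordinates_near U \<xi> N \<zeta>' \<and> x \<in> N"
    unfolding \<zeta>'_def by (rule someI[of "\<lambda>\<zeta>. \<exists>N. coordinates_near U \<xi> N \<zeta> \<and> x \<in> N"]) (use \<zeta> in blast)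
  then obtain N' where \<zeta>': "coordinates_near U \<xi> N' \<zeta>'" "x \<in> N'" by blast
  have s: "smooth (\<zeta> e)" "smooth (\<zeta>' e)" using \<zeta>(1) \<zeta>'(1) by (auto simp: coordinates_near_def)
  have "comp U \<xi> e x (A x) = delta_real (\<zeta>' e) (through x (A x)) x"
    by (simp add: comp_def \<zeta>'_def)
  also have "\<dots> = delta_real (\<zeta>' e) A x"
    by (rule fun_linear_tensorial[OF delta_fun_linear[OF smooth_of_real[OF s(2)]] through(1) A through(2)])
  also have "\<dots> = delta_real (\<zeta> e) A x"
  proof (rule delta_local[OF A s(2,1)])
    show "open (N \<inter> N')" "x \<in> N \<inter> N'" using \<zeta> \<zeta>' by (auto simp: coordinates_near_def)
  qed (use \<zeta>(1) \<zeta>'(1) in \<open>auto simp: coordinates_near_def\<close>)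
  finally show ?thesis .
qed

lemma comp_lin:
  assumes U: "(U, \<xi>) \<in> charts M" "x \<in> U"
  shows "lin (comp U \<xi> e x)"
  unfolding lin_def
proof (intro conjI allI)
  obtain \<zeta> N where \<zeta>: "coordinates_near U \<xi> N \<zeta>" "x \<in> N" using ex_coordinates[OF U] by blast
  have "smooth (\<zeta> e)" using \<zeta>(1) by (simp add: coordinates_near_def)
  then have f: "fun_linear (delta_real (\<zeta> e))" by (intro delta_fun_linear smooth_of_real)
  fix u v
  obtain A B where A: "A \<in> \<Gamma>" "A x = u" and B: "B \<in> \<Gamma>" "B x = v" by (metis ex_\<Gamma>_through)
  show "comp U \<xi> e x (u + v) = comp U \<xi> e x u + comp U \<xi> e x v"
    using comp_eq[OF U(1) \<zeta> A(1)] comp_eq[OF U(1) \<zeta> B(1)] comp_eq[OF U(1) \<zeta> \<Gamma>_add[OF A(1) B(1)]]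
      fun_linear_add[OF f A(1) B(1)] A(2) B(2) by simp
  fix c
  show "comp U \<xi> e x (sc c u) = sc c (comp U \<xi> e x u)"
    using comp_eq[OF U(1) \<zeta> A(1)] comp_eq[OF U(1) \<zeta> \<Gamma>_scale_const[OF A(1)]]
      fun_linear_scale[OF f A(1) smooth_const] A(2) by simp
qed

lemma comp_br:
  assumes U: "(U, \<xi>) \<in> charts M" "x \<in> U"
  shows "comp U \<xi> e x (br u v) = br u (comp U \<xi> e x v)"
proof -
  obtain \<zeta> N where \<zeta>: "coordinates_near U \<xi> N \<zeta>" "x \<in> N" using ex_coordinates[OF U] by blast
  have "smooth (\<zeta> e)" using \<zeta>(1) by (simp add: coordinates_near_def)
  then have f: "centroid (delta_real (\<zeta> e))" by (intro delta_centroid smooth_of_real)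
  obtain A B where A: "A \<in> \<Gamma>" "A x = u" and B: "B \<in> \<Gamma>" "B x = v" by (metis ex_\<Gamma>_through)
  have "delta_real (\<zeta> e) (\<lambda>y. br (A y) (B y)) x = br (A x) (delta_real (\<zeta> e) B x)"
    using f A(1) B(1) unfolding centroid_def by blast
  then show ?thesis
    using comp_eq[OF U(1) \<zeta> B(1), of e] comp_eq[OF U(1) \<zeta> \<Gamma>_br[OF A(1) B(1)], of e] A(2) B(2)
    by simp
qed

lemma comp_smooth:
  assumes U: "(U, \<xi>) \<in> charts M" "x \<in> U" and A: "A \<in> \<Gamma>"
  shows "sm_sec (\<lambda>y. comp U \<xi> e y (A y)) x"
proof -
  obtain \<zeta> N where \<zeta>: "coordinates_near U \<xi> N \<zeta>" "x \<in> N" using ex_coordinates[OF U] by blast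
  have s: "smooth (\<zeta> e)" "open N" using \<zeta>(1) by (auto simp: coordinates_near_def)
  have "sm_sec (delta_real (\<zeta> e) A) x" by (intro \<Gamma>D delta_\<Gamma> smooth_of_real s A)
  then show ?thesis
    by (rule sm_sec_cong[OF _ s(2) \<zeta>(2)]) (simp add: comp_eq[OF U(1) \<zeta>(1) _ A])
qed

lemma delta_comp:
  assumes U: "(U, \<xi>) \<in> charts M" "x \<in> U" and a: "smooth a" and A: "A \<in> \<Gamma>"
  shows "delta D a A x = (\<Sum>e\<in>frame M. sc (tv_act (coord_field M U \<xi> e x) a) (comp U \<xi> e x (A x)))"
proof -
  obtain \<zeta> N where \<zeta>: "coordinates_near U \<xi> N \<zeta>" "x \<in> N" using ex_coordinates[OF U] by blast
  show ?thesis by (simp add: delta_expand[OF U(1) \<zeta> a A] comp_eq[OF U(1) \<zeta> A])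
qed

text \<open>The transformation law of contravariant components: \<open>delta\<close> of the
  coordinate \<open>\<zeta> e\<close> of one chart is expanded in the other chart, with the Jacobian
  entries as coefficients.\<close>

lemma comp_change:
  assumes U: "(U, \<xi>) \<in> charts M" and \<zeta>: "coordinates_near U \<xi> N \<zeta>" "x \<in> N"
    and V: "(V, \<eta>) \<in> charts M" "x \<in> V"
  shows "comp U \<xi> e x u = (\<Sum>e'\<in>frame M. sc (of_real (coord_field M V \<eta> e' x (\<zeta> e))) (comp V \<eta> e' x u))"
proof -
  obtain \<theta> N' where \<theta>: "coordinates_near V \<eta> N' \<theta>" "x \<in> N'" using ex_coordinates[OF V] by blast
  have s: "smooth (\<zeta> e)" using \<zeta>(1) by (simp add: coordinates_near_def)
  show ?thesis
    using delta_real_expand[OF V(1) \<theta> s through(1), of x u] through(2)[of x u]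
      comp_eq[OF U \<zeta> through(1), of e x u] comp_eq[OF V(1) \<theta> through(1), of _ x u] by simp
qed

end


section \<open>Connections\<close>

locale twisted_connection = twisted M G T
  for M :: "('m::t2_space, 'e::real_inner) manifold_data"
    and G :: "('k::{real_normed_field,euclidean_space}, 'f::ab_group_add) lie_algebra_data" and T +
  fixes nab :: "('m \<Rightarrow> 'm tvec) \<Rightarrow> ('m \<Rightarrow> 'f) \<Rightarrow> 'm \<Rightarrow> 'f"
  assumes nab_\<Gamma>: "X \<in> vector_fields M \<Longrightarrow> A \<in> \<Gamma> \<Longrightarrow> nab X A \<in> \<Gamma>"
    and nab_add: "X \<in> vector_fields M \<Longrightarrow> A \<in> \<Gamma> \<Longrightarrow> B \<in> \<Gamma> \<Longrightarrow>
      nab X (\<lambda>y. A y + B y) x = nab X A x + nab X B x"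
    and nab_Leibniz: "X \<in> vector_fields M \<Longrightarrow> A \<in> \<Gamma> \<Longrightarrow> smooth a \<Longrightarrow>
      nab X (\<lambda>y. sc (a y) (A y)) x = sc (vf_act X a x) (A x) + sc (a x) (nab X A x)"
    and nab_lincomb: "X \<in> vector_fields M \<Longrightarrow> Y \<in> vector_fields M \<Longrightarrow> A \<in> \<Gamma> \<Longrightarrow>
      smooth f \<Longrightarrow> smooth g \<Longrightarrow> nab (\<lambda>y h. f y * X y h + g y * Y y h) A x
        = sc (of_real (f x)) (nab X A x) + sc (of_real (g x)) (nab Y A x)"
    and nab_br: "X \<in> vector_fields M \<Longrightarrow> A \<in> \<Gamma> \<Longrightarrow> B \<in> \<Gamma> \<Longrightarrow>
      nab X (\<lambda>y. br (A y) (B y)) x = br (nab X A x) (B x) + br (A x) (nab X B x)"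
begin

lemma nab_sum:
  assumes "finite I" "\<And>i. i \<in> I \<Longrightarrow> X i \<in> vector_fields M" "\<And>i. i \<in> I \<Longrightarrow> smooth (f i)" "A \<in> \<Gamma>"
  shows "nab (\<lambda>y h. \<Sum>i\<in>I. f i y * X i y h) A x = (\<Sum>i\<in>I. sc (of_real (f i x)) (nab (X i) A x))"
  using assms(1-3)
proof induction
  case empty
  have Z: "(\<lambda>y h. 0) \<in> vector_fields M" using vector_field_sum[of "{}"] by simp
  show ?case using nab_lincomb[OF Z Z assms(4) smooth_const smooth_const, of 0 0 x] by simp
next
  case (insert i I)
  have S: "(\<lambda>y h. \<Sum>i\<in>I. f i y * X i y h) \<in> vector_fields M"
    using insert by (intro vector_field_sum) auto
  have "nab (\<lambda>y h. f i y * X i y h + 1 * (\<Sum>i\<in>I. f i y * X i y h)) A x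
      = sc (of_real (f i x)) (nab (X i) A x) + sc (of_real 1) (nab (\<lambda>y h. \<Sum>i\<in>I. f i y * X i y h) A x)"
    using insert by (intro nab_lincomb S assms(4) smooth_const) auto
  then show ?case using insert by simp
qed

lemma nab_vanish:
  assumes X: "X \<in> vector_fields M" "X x = (\<lambda>f. 0)" and A: "A \<in> \<Gamma>"
  shows "nab X A x = 0"
proof -
  from X obtain b a Z where b: "smooth b" "b x = 0" "\<And>e. smooth (a e)" "\<And>e. a e x = 0"
    "\<And>e. Z e \<in> vector_fields M"
    "X = (\<lambda>y f. b y * X y f + (\<Sum>e\<in>frame M. a e y * Z e y f))" by (rule vector_field_vanishing) blast
  have S: "(\<lambda>y f. \<Sum>e\<in>frame M. a e y * Z e y f) \<in> vector_fields M"
    using b by (intro vector_field_sum finite_frame)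
  have "nab X A x = nab (\<lambda>y f. b y * X y f + 1 * (\<Sum>e\<in>frame M. a e y * Z e y f)) A x"
    using b(6) by simp
  also have "\<dots> = sc (of_real (b x)) (nab X A x)
      + sc (of_real 1) (nab (\<lambda>y f. \<Sum>e\<in>frame M. a e y * Z e y f) A x)"
    by (intro nab_lincomb X S A b(1) smooth_const)
  also have "\<dots> = 0" using b(2,4) nab_sum[OF finite_frame b(5,3) A] by simp
  finally show ?thesis .
qed

lemma nab_tensorial:
  assumes X: "X \<in> vector_fields M" and Y: "Y \<in> vector_fields M" and "X x = Y x" and A: "A \<in> \<Gamma>"
  shows "nab X A x = nab Y A x"
proof -
  have "nab (\<lambda>y h. 1 * X y h + (- 1) * Y y h) A x = 0"
    using assms(3) by (intro nab_vanish[OF vector_field_lincomb[OF X Y smooth_const smooth_const] _ A]) simp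
  moreover have "nab (\<lambda>y h. 1 * X y h + (- 1) * Y y h) A x
      = sc (of_real 1) (nab X A x) + sc (of_real (- 1)) (nab Y A x)"
    by (rule nab_lincomb[OF X Y A smooth_const smooth_const])
  ultimately show ?thesis by (simp add: V.scale_minus_left)
qed

text \<open>The covariant derivative along a single tangent vector, independent of the chosen
  extension by \<open>nab_tensorial\<close>. It makes coordinate fields usable although they are not
  global.\<close>

definition nabv :: "'m tvec \<Rightarrow> ('m \<Rightarrow> 'f) \<Rightarrow> 'm \<Rightarrow> 'f" where
  "nabv v A x = nab (SOME X. X \<in> vector_fields M \<and> X x = v) A x"

lemma nabv_eq:
  assumes "X \<in> vector_fields M" "A \<in> \<Gamma>"
  shows "nabv (X x) A x = nab X A x"
proof -
  have "(SOME Y. Y \<in> vector_fields M \<and> Y x = X x) \<in> vector_fields M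
      \<and> (SOME Y. Y \<in> vector_fields M \<and> Y x = X x) x = X x"
    by (rule someI[of "\<lambda>Y. Y \<in> vector_fields M \<and> Y x = X x" X]) (use assms in simp)
  then show ?thesis unfolding nabv_def using assms by (intro nab_tensorial) auto
qed

context
  fixes v x assumes v: "v \<in> tangent_space M x"
begin

lemma nabv_lincomb:
  assumes w: "w \<in> tangent_space M x" and A: "A \<in> \<Gamma>"
  shows "nabv (\<lambda>f. a * v f + b * w f) A x = sc (of_real a) (nabv v A x) + sc (of_real b) (nabv w A x)"
proof -
  obtain X where X: "X \<in> vector_fields M" "X x = v" by (rule ex_vector_field_through[OF v])
  obtain Y where Y: "Y \<in> vector_fields M" "Y x = w" by (rule ex_vector_field_through[OF w])
  show ?thesis
    using nab_lincomb[OF X(1) Y(1) A smooth_const smooth_const, of a b x] nabv_eq[OF X(1) A, of x]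
      nabv_eq[OF Y(1) A, of x]
      nabv_eq[OF vector_field_lincomb[OF X(1) Y(1) smooth_const[of a] smooth_const[of b]] A, of x]
    by (simp add: X(2) Y(2))
qed

lemma nabv_add:
  assumes A: "A \<in> \<Gamma>" and B: "B \<in> \<Gamma>"
  shows "nabv v (\<lambda>y. A y + B y) x = nabv v A x + nabv v B x"
proof -
  obtain X where X: "X \<in> vector_fields M" "X x = v" by (rule ex_vector_field_through[OF v])
  show ?thesis
    using nab_add[OF X(1) A B, of x] nabv_eq[OF X(1) A, of x] nabv_eq[OF X(1) B, of x]
      nabv_eq[OF X(1) \<Gamma>_add[OF A B], of x] X(2) by simp
qed

lemma nabv_br:
  assumes A: "A \<in> \<Gamma>" and B: "B \<in> \<Gamma>"
  shows "nabv v (\<lambda>y. br (A y) (B y)) x = br (nabv v A x) (B x) + br (A x) (nabv v B x)"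
proof -
  obtain X where X: "X \<in> vector_fields M" "X x = v" by (rule ex_vector_field_through[OF v])
  show ?thesis
    using nab_br[OF X(1) A B, of x] nabv_eq[OF X(1) A, of x] nabv_eq[OF X(1) B, of x]
      nabv_eq[OF X(1) \<Gamma>_br[OF A B], of x] X(2) by simp
qed

lemma nabv_Leibniz:
  assumes A: "A \<in> \<Gamma>" and a: "smooth a"
  shows "nabv v (\<lambda>y. sc (a y) (A y)) x = sc (tv_act v a) (A x) + sc (a x) (nabv v A x)"
proof -
  obtain X where X: "X \<in> vector_fields M" "X x = v" by (rule ex_vector_field_through[OF v])
  show ?thesis
    using nab_Leibniz[OF X(1) A a, of x] nabv_eq[OF X(1) A, of x]
      nabv_eq[OF X(1) \<Gamma>_scale[OF a A], of x] vf_act_eq[of X a x] X(2) by simp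
qed

end

lemma nabv_sum:
  assumes "finite I" "\<And>i. i \<in> I \<Longrightarrow> v i \<in> tangent_space M x" and A: "A \<in> \<Gamma>"
  shows "nabv (\<lambda>f. \<Sum>i\<in>I. c i * v i f) A x = (\<Sum>i\<in>I. sc (of_real (c i)) (nabv (v i) A x))"
  using assms(1,2)
proof induction
  case empty
  show ?case using nabv_lincomb[OF tangent_zero tangent_zero A, of 0 0 x] by simp
next
  case (insert i I)
  have S: "(\<lambda>f. \<Sum>i\<in>I. c i * v i f) \<in> tangent_space M x"
    using insert by (intro tangent_sum_in) auto
  have "nabv (\<lambda>f. c i * v i f + 1 * (\<Sum>i\<in>I. c i * v i f)) A x
      = sc (of_real (c i)) (nabv (v i) A x) + sc (of_real 1) (nabv (\<lambda>f. \<Sum>i\<in>I. c i * v i f) A x)"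
    using insert by (intro nabv_lincomb S A) auto
  then show ?case using insert by simp
qed

text \<open>In the commutator of \<open>D\<close> with the coordinate \<open>\<zeta> e\<close> the
  order-zero part \<open>D0\<close> cancels, and the Leibniz rule leaves the derivatives of
  \<open>\<zeta> e\<close> along the coordinate fields, which are 0 or 1. So the components of any
  decomposition at \<open>x\<close> are fixed by \<open>D\<close>; this is the source of
  uniqueness.\<close>

lemma component_eq_delta:
  assumes U: "(U, \<xi>) \<in> charts M" and \<zeta>: "coordinates_near U \<xi> N \<zeta>" "x \<in> N"
    and S: "\<And>e. e \<in> frame M \<Longrightarrow> lin (S e)" and D0: "lin D0"
    and D: "\<And>A. A \<in> \<Gamma> \<Longrightarrow> D A x = (\<Sum>e\<in>frame M. S e (nabv (coord_field M U \<xi> e x) A x)) + D0 (A x)"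
    and e: "e \<in> frame M" and A: "A \<in> \<Gamma>"
  shows "delta D (\<lambda>y. of_real (\<zeta> e y)) A x = S e (A x)"
proof -
  have s: "smooth (\<zeta> e)" and xU: "x \<in> U" using \<zeta> by (auto simp: coordinates_near_def)
  have s': "smooth (\<lambda>y. of_real (\<zeta> e y) :: 'k)" using s by (simp add: smooth_iff smooth_at_of_real)
  note t = coord_field_tangent[OF U xU]
  have "S e' (nabv (coord_field M U \<xi> e' x) (\<lambda>y. sc (of_real (\<zeta> e y)) (A y)) x)
      = (if e' = e then S e (A x) else 0) + sc (of_real (\<zeta> e x)) (S e' (nabv (coord_field M U \<xi> e' x) A x))"
    if e': "e' \<in> frame M" for e'
    using coord_field_coordinates[OF U \<zeta> e' e]
    by (simp add: nabv_Leibniz[OF t A s'] tv_act_of_real[OF t s] lin_add[OF S[OF e']] lin_scale[OF S[OF e']])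
  then have "D (\<lambda>y. sc (of_real (\<zeta> e y)) (A y)) x = S e (A x) + sc (of_real (\<zeta> e x)) (D A x)"
    using e finite_frame
    by (simp add: D[OF \<Gamma>_scale[OF s' A]] D[OF A] sum.distrib V.scale_sum_right V.scale_right_distrib
        lin_scale[OF D0] add.assoc)
  then show ?thesis by (simp add: delta_def)
qed

end

section \<open>Splitting off the first-order part of a derivation\<close>

locale twisted_decomposition = twisted_derivation M G T D + twisted_connection M G T nab
  for M :: "('m::t2_space, 'e::real_inner) manifold_data"
    and G :: "('k::{real_normed_field,euclidean_space}, 'f::ab_group_add) lie_algebra_data" and T D nab
begin

definition nab_comp :: "'m set \<Rightarrow> ('m \<Rightarrow> 'e) \<Rightarrow> ('m \<Rightarrow> 'f) \<Rightarrow> 'm \<Rightarrow> 'f" where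
  "nab_comp U \<xi> A x = (\<Sum>e\<in>frame M. comp U \<xi> e x (nabv (coord_field M U \<xi> e x) A x))"

text \<open>The same matrix \<open>?c\<close> expresses the components in the first chart by those
  in the second and the coordinate fields of the second chart by those of the first; exchanging the
  sums moves it from one factor to the other.\<close>

lemma nab_comp_change:
  assumes U: "(U, \<xi>) \<in> charts M" "x \<in> U" and V: "(V, \<eta>) \<in> charts M" "x \<in> V" and A: "A \<in> \<Gamma>"
  shows "nab_comp U \<xi> A x = nab_comp V \<eta> A x"
proof -
  obtain \<zeta> N where \<zeta>: "coordinates_near U \<xi> N \<zeta>" "x \<in> N" using ex_coordinates[OF U] by blast
  let ?c = "\<lambda>e' e. coord_field M V \<eta> e' x (\<zeta> e)"
  note t = coord_field_tangent[OF U] coord_field_tangent[OF V]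
  have "nabv (coord_field M V \<eta> e' x) A x
      = (\<Sum>e\<in>frame M. sc (of_real (?c e' e)) (nabv (coord_field M U \<xi> e x) A x))" for e'
  proof -
    have "nabv (coord_field M V \<eta> e' x) A x
        = nabv (\<lambda>f. \<Sum>e\<in>frame M. ?c e' e * coord_field M U \<xi> e x f) A x"
      using tangent_expand[OF U(1) \<zeta> t(2)[of e']] by simp
    also have "\<dots> = (\<Sum>e\<in>frame M. sc (of_real (?c e' e)) (nabv (coord_field M U \<xi> e x) A x))"
      by (rule nabv_sum[OF finite_frame t(1) A])
    finally show ?thesis .
  qed
  then have "nab_comp V \<eta> A x
      = (\<Sum>e'\<in>frame M. \<Sum>e\<in>frame M. sc (of_real (?c e' e)) (comp V \<eta> e' x (nabv (coord_field M U \<xi> e x) A x)))"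
    by (simp add: nab_comp_def lin_sum[OF comp_lin[OF V]] lin_scale[OF comp_lin[OF V]])
  also have "\<dots> = (\<Sum>e\<in>frame M. \<Sum>e'\<in>frame M. sc (of_real (?c e' e)) (comp V \<eta> e' x (nabv (coord_field M U \<xi> e x) A x)))"
    by (rule sum.swap)
  also have "\<dots> = nab_comp U \<xi> A x"
    unfolding nab_comp_def by (intro sum.cong refl comp_change[OF U(1) \<zeta> V, symmetric])
  finally show ?thesis by simp
qed

definition chart_at :: "'m \<Rightarrow> 'm set \<times> ('m \<Rightarrow> 'e)" where
  "chart_at x = (SOME c. c \<in> charts M \<and> x \<in> fst c)"

lemma chart_at: "(fst (chart_at x), snd (chart_at x)) \<in> charts M" "x \<in> fst (chart_at x)"
proof -
  obtain U \<xi> where "(U, \<xi>) \<in> charts M" "x \<in> U" by (rule ex_chart)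
  then have "chart_at x \<in> charts M \<and> x \<in> fst (chart_at x)"
    unfolding chart_at_def by (intro someI[of "\<lambda>c. c \<in> charts M \<and> x \<in> fst c" "(U, \<xi>)"]) simp
  then show "(fst (chart_at x), snd (chart_at x)) \<in> charts M" "x \<in> fst (chart_at x)" by auto
qed

definition rest :: "('m \<Rightarrow> 'f) \<Rightarrow> 'm \<Rightarrow> 'f" where
  "rest A x = D A x - nab_comp (fst (chart_at x)) (snd (chart_at x)) A x"

lemma rest_eq:
  assumes "(U, \<xi>) \<in> charts M" "x \<in> U" "A \<in> \<Gamma>"
  shows "rest A x = D A x - nab_comp U \<xi> A x"
  unfolding rest_def by (simp only: nab_comp_change[OF chart_at assms])

lemma nab_comp_smooth:
  assumes U: "(U, \<xi>) \<in> charts M" "x \<in> U" and A: "A \<in> \<Gamma>"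
  shows "sm_sec (nab_comp U \<xi> A) x"
proof -
  have "sm_sec (\<lambda>y. comp U \<xi> e y (nabv (coord_field M U \<xi> e y) A y)) x" for e
  proof -
    obtain X N where X: "X \<in> vector_fields M" "open N" "x \<in> N" "N \<subseteq> U"
      "\<And>y. y \<in> N \<Longrightarrow> X y = coord_field M U \<xi> e y" using ex_local_vector_field[OF U] by metis
    have "sm_sec (\<lambda>y. comp U \<xi> e y (nab X A y)) x" by (rule comp_smooth[OF U nab_\<Gamma>[OF X(1) A]])
    then show ?thesis
      by (rule sm_sec_cong[OF _ X(2,3)]) (simp add: nabv_eq[OF X(1) A, symmetric] X(5))
  qed
  then show ?thesis unfolding nab_comp_def[abs_def] by (rule sm_sec_sum)
qed

lemma rest_\<Gamma>:
  assumes A: "A \<in> \<Gamma>"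
  shows "rest A \<in> \<Gamma>"
proof (rule \<Gamma>I)
  fix x
  obtain U \<xi> where U: "(U, \<xi>) \<in> charts M" "x \<in> U" by (rule ex_chart)
  have "sm_sec (\<lambda>y. D A y + sc (- 1) (nab_comp U \<xi> A y)) x"
    by (intro sm_sec_add sm_sec_scale smooth_at_const nab_comp_smooth[OF U A] \<Gamma>D[OF D_\<Gamma>[OF A]])
  then show "sm_sec (rest A) x"
    by (rule sm_sec_cong[OF _ chart_homeomorphism(1)[OF U(1)] U(2)])
      (simp add: rest_eq[OF U(1) _ A] V.scale_minus_left)
qed

lemma rest_fun_linear: "fun_linear rest"
  unfolding fun_linear_def
proof (intro conjI ballI allI impI)
  fix A x assume A: "A \<in> \<Gamma>"
  obtain U \<xi> where U: "(U, \<xi>) \<in> charts M" "x \<in> U" by (rule ex_chart)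
  note t = coord_field_tangent[OF U] and cl = comp_lin[OF U]
  show "rest (\<lambda>y. A y + B y) x = rest A x + rest B x" if B: "B \<in> \<Gamma>" for B
    by (simp add: rest_eq[OF U A] rest_eq[OF U B] rest_eq[OF U \<Gamma>_add[OF A B]] D_add[OF A B]
        nab_comp_def nabv_add[OF t A B] lin_add[OF cl] sum.distrib)
  fix a :: "'m \<Rightarrow> 'k" assume a: "smooth a"
  \<comment> \<open>The commutator of \<open>nab_comp\<close> with \<open>a\<close> consists of the
    derivatives of \<open>a\<close> times the components, which is exactly the commutator of
    \<open>D\<close> with \<open>a\<close>; the two cancel in \<open>rest\<close>.\<close>
  have "nab_comp U \<xi> (\<lambda>y. sc (a y) (A y)) x = delta D a A x + sc (a x) (nab_comp U \<xi> A x)"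
    by (simp add: nab_comp_def nabv_Leibniz[OF t A a] lin_add[OF cl] lin_scale[OF cl] sum.distrib
        delta_comp[OF U a A] V.scale_sum_right)
  then show "rest (\<lambda>y. sc (a y) (A y)) x = sc (a x) (rest A x)"
    by (simp add: rest_eq[OF U A] rest_eq[OF U \<Gamma>_scale[OF a A]] delta_def V.scale_right_diff_distrib)
qed

lemma rest_br:
  assumes A: "A \<in> \<Gamma>" and B: "B \<in> \<Gamma>"
  shows "rest (\<lambda>y. br (A y) (B y)) x = br (rest A x) (B x) + br (A x) (rest B x)"
proof -
  obtain U \<xi> where U: "(U, \<xi>) \<in> charts M" "x \<in> U" by (rule ex_chart)
  note t = coord_field_tangent[OF U] and cl = comp_lin[OF U]
  \<comment> \<open>\<open>comp_br\<close> moves the component into the right factor; antisymmetry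
    moves it into the left one. The product rule needs both.\<close>
  have cb: "comp U \<xi> e x (br u v) = br (comp U \<xi> e x u) v" for e u v
    using comp_br[OF U, of e v u] br_swap[of u v] br_swap[of "comp U \<xi> e x u" v]
    by (simp add: lin_minus[OF cl])
  have "comp U \<xi> e x (nabv (coord_field M U \<xi> e x) (\<lambda>y. br (A y) (B y)) x)
      = br (comp U \<xi> e x (nabv (coord_field M U \<xi> e x) A x)) (B x)
        + br (A x) (comp U \<xi> e x (nabv (coord_field M U \<xi> e x) B x))" for e
    unfolding nabv_br[OF t A B] lin_add[OF cl] by (simp only: cb[of e _ "B x"] comp_br[OF U, of e "A x"])
  then have "nab_comp U \<xi> (\<lambda>y. br (A y) (B y)) x
      = br (nab_comp U \<xi> A x) (B x) + br (A x) (nab_comp U \<xi> B x)"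
    by (simp add: nab_comp_def sum.distrib br_sum_left br_sum_right)
  then show ?thesis
    by (simp add: rest_eq[OF U A] rest_eq[OF U B] rest_eq[OF U \<Gamma>_br[OF A B]] D_br[OF A B]
        br_diff_left br_diff_right)
qed

definition rest_at :: "'m \<Rightarrow> 'f \<Rightarrow> 'f" where "rest_at x u = rest (through x u) x"

lemma rest_at_eq: "A \<in> \<Gamma> \<Longrightarrow> rest_at x (A x) = rest A x"
  unfolding rest_at_def by (rule fun_linear_tensorial[OF rest_fun_linear through(1) _ through(2)])

lemma rest_at_lin: "lin (rest_at x)"
  unfolding lin_def
proof (intro conjI allI)
  fix u v
  obtain A B where A: "A \<in> \<Gamma>" "A x = u" and B: "B \<in> \<Gamma>" "B x = v" by (metis ex_\<Gamma>_through)
  show "rest_at x (u + v) = rest_at x u + rest_at x v"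
    using rest_at_eq[OF A(1)] rest_at_eq[OF B(1)] rest_at_eq[OF \<Gamma>_add[OF A(1) B(1)]]
      fun_linear_add[OF rest_fun_linear A(1) B(1)] A(2) B(2) by metis
  show "rest_at x (sc c u) = sc c (rest_at x u)" for c
    using rest_at_eq[OF A(1)] rest_at_eq[OF \<Gamma>_scale_const[OF A(1)]]
      fun_linear_scale[OF rest_fun_linear A(1) smooth_const] A(2) by metis
qed

lemma rest_at_br: "rest_at x (br u v) = br (rest_at x u) v + br u (rest_at x v)"
proof -
  obtain A B where A: "A \<in> \<Gamma>" "A x = u" and B: "B \<in> \<Gamma>" "B x = v" by (metis ex_\<Gamma>_through)
  show ?thesis
    using rest_at_eq[OF A(1)] rest_at_eq[OF B(1)] rest_at_eq[OF \<Gamma>_br[OF A(1) B(1)]]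
      rest_br[OF A(1) B(1)] A(2) B(2) by metis
qed

lemma decomposition:
  assumes "(U, \<xi>) \<in> charts M" "x \<in> U" "A \<in> \<Gamma>"
  shows "D A x = nab_comp U \<xi> A x + rest_at x (A x)"
  using rest_eq[OF assms] rest_at_eq[OF assms(3)] by simp

end


section \<open>Bundles of Lie algebras with a Lie connection\<close>

locale lie_bdl =
  fixes L :: "('m::t2_space, 'e::real_inner, 'k::{real_normed_field,euclidean_space},
                'f::ab_group_add, 'l) lie_bundle_data"
  assumes is_bundle: "lie_bundle L"

sublocale lie_bdl \<subseteq> fibre_smooth "base L" "fiber L"
  using is_bundle by unfold_locales (simp_all add: lie_bundle_def)

context lie_bdl
begin

lemma ex_bchart: obtains U \<psi> where "(U, \<psi>) \<in> bcharts L" "x \<in> U"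
proof -
  have "x \<in> (\<Union>(U, \<psi>)\<in>bcharts L. U)" using is_bundle by (simp add: lie_bundle_def)
  then show ?thesis using that by blast
qed

lemma bchart: "(U, \<psi>) \<in> bcharts L \<Longrightarrow> open U"
  "(U, \<psi>) \<in> bcharts L \<Longrightarrow> x \<in> U \<Longrightarrow> bij_betw \<psi> (fib L x) UNIV"
  using is_bundle by (auto simp: lie_bundle_def)

lemma btransition:
  assumes "(U, \<psi>) \<in> bcharts L" "(V, \<theta>) \<in> bcharts L"
  shows "x \<in> U \<Longrightarrow> x \<in> V \<Longrightarrow> \<theta> \<circ> inv_into (fib L x) \<psi> \<in> lie_aut (fiber L)"
    "smooth_fib_on L (U \<inter> V) (\<lambda>x. \<theta> (inv_into (fib L x) \<psi> w))"
  using is_bundle assms unfolding lie_bundle_def by fast+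

lemma triv_chart: "\<exists>U. (U, triv L x) \<in> bcharts L \<and> x \<in> U"
proof -
  obtain U \<psi> where "(U, \<psi>) \<in> bcharts L" "x \<in> U" by (rule ex_bchart)
  then have "\<exists>\<psi> U. (U, \<psi>) \<in> bcharts L \<and> x \<in> U" by blast
  then show ?thesis unfolding triv_def by (rule someI_ex)
qed

lemma triv_bij: "bij_betw (triv L x) (fib L x) UNIV"
  using triv_chart bchart(2) by blast

lemma triv_untriv [simp]: "triv L x (untriv L x u) = u"
  unfolding untriv_def using triv_bij[of x] by (simp add: bij_betw_inv_into_right)

lemma untriv_fib [simp]: "untriv L x u \<in> fib L x"
  unfolding untriv_def using triv_bij[of x] by (metis UNIV_I bij_betw_def inv_into_into)

lemma untriv_triv: "p \<in> fib L x \<Longrightarrow> untriv L x (triv L x p) = p"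
  unfolding untriv_def using triv_bij[of x] by (simp add: bij_betw_inv_into_left)

lemma fib_eqI: "p \<in> fib L x \<Longrightarrow> q \<in> fib L x \<Longrightarrow> triv L x p = triv L x q \<Longrightarrow> p = q"
  using untriv_triv by metis

lemma smooth_fib_on_iff:
  assumes "open W"
  shows "smooth_fib_on L W s \<longleftrightarrow> (\<forall>x\<in>W. smf s x)"
  unfolding smooth_fib_on_def linear_iff_lfun smf_iff_lfun smooth_fun_on_iff[OF assms] by blast

definition trivs :: "('m set \<times> ('m \<Rightarrow> 'f \<Rightarrow> 'f)) set" where
  "trivs = {(U, \<lambda>x u. \<psi> (untriv L x u)) | U \<psi>. (U, \<psi>) \<in> bcharts L}"

lemma trivs_aut:
  assumes "(U, \<psi>) \<in> bcharts L" "x \<in> U"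
  shows "(\<lambda>u. \<psi> (untriv L x u)) \<in> lie_aut (fiber L)"
  using triv_chart[of x] btransition(1)[OF _ assms(1) _ assms(2)] by (auto simp: untriv_def comp_def)

lemma inv_into_chart:
  assumes "(U, \<psi>) \<in> bcharts L" "x \<in> U"
  shows "inv_into (fib L x) \<psi> w = untriv L x (inv (\<lambda>u. \<psi> (untriv L x u)) w)"
proof -
  note b = bchart(2)[OF assms]
  have "\<psi> (untriv L x (inv (\<lambda>u. \<psi> (untriv L x u)) w)) = w"
    by (rule lie_aut_apply_inv[OF trivs_aut[OF assms]])
  then show ?thesis using b untriv_fib by (metis bij_betw_inv_into_left)
qed

end

sublocale lie_bdl \<subseteq> twisted "base L" "fiber L" trivs
proof
  fix x
  obtain U \<psi> where U: "(U, \<psi>) \<in> bcharts L" "x \<in> U" by (rule ex_bchart)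
  then show "\<exists>U g. (U, g) \<in> trivs \<and> x \<in> U" unfolding trivs_def by blast
next
  fix U g assume "(U, g) \<in> trivs"
  then show "open U" using bchart(1) by (auto simp: trivs_def)
next
  fix U g x assume "(U, g) \<in> trivs" "x \<in> U"
  then show "g x \<in> lie_aut (fiber L)" using trivs_aut by (auto simp: trivs_def)
next
  fix U g V h x w assume U: "(U, g) \<in> trivs" and V: "(V, h) \<in> trivs" and x: "x \<in> U" "x \<in> V"
  from U obtain \<psi> where \<psi>: "(U, \<psi>) \<in> bcharts L" "g = (\<lambda>x u. \<psi> (untriv L x u))" by (auto simp: trivs_def)
  from V obtain \<theta> where \<theta>: "(V, \<theta>) \<in> bcharts L" "h = (\<lambda>x u. \<theta> (untriv L x u))" by (auto simp: trivs_def)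
  have op: "open (U \<inter> V)" using bchart(1)[OF \<psi>(1)] bchart(1)[OF \<theta>(1)] by blast
  have "smf (\<lambda>y. \<theta> (inv_into (fib L y) \<psi> w)) x"
    using btransition(2)[OF \<psi>(1) \<theta>(1)] x unfolding smooth_fib_on_iff[OF op] by blast
  then show "smf (\<lambda>y. h y (inv (g y) w)) x"
    by (rule smf_cong[OF _ op]) (use x in \<open>auto simp: \<psi>(2) \<theta>(2) inv_into_chart[OF \<psi>(1)]\<close>)
qed

context lie_bdl
begin

definition hat :: "('m \<Rightarrow> 'l) \<Rightarrow> 'm \<Rightarrow> 'f" where "hat A = (\<lambda>x. triv L x (A x))"
definition unhat :: "('m \<Rightarrow> 'f) \<Rightarrow> 'm \<Rightarrow> 'l" where "unhat A = (\<lambda>x. untriv L x (A x))"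

lemma hat_unhat [simp]: "hat (unhat A) = A"
  by (simp add: hat_def unhat_def)

lemma sections_iff: "A \<in> sections L \<longleftrightarrow> (\<forall>x. A x \<in> fib L x) \<and> hat A \<in> \<Gamma>"
proof
  assume A: "A \<in> sections L"
  then have f: "A x \<in> fib L x" for x by (simp add: sections_def)
  have "sm_sec (hat A) x" for x
  proof -
    obtain U \<psi> where U: "(U, \<psi>) \<in> bcharts L" "x \<in> U" by (rule ex_bchart)
    have "smooth_fib_on L U (\<lambda>x. \<psi> (A x))" using A U(1) unfolding sections_def by blast
    then have "smf (\<lambda>y. \<psi> (untriv L y (hat A y))) x"
      using U(2) untriv_triv[OF f] by (simp add: hat_def smooth_fib_on_iff[OF bchart(1)[OF U(1)]])
    moreover have "(U, \<lambda>x u. \<psi> (untriv L x u)) \<in> trivs" using U(1) by (auto simp: trivs_def)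
    ultimately show ?thesis using U(2) unfolding sm_sec_def by blast
  qed
  then show "(\<forall>x. A x \<in> fib L x) \<and> hat A \<in> \<Gamma>" using f by (auto intro: \<Gamma>I)
next
  assume A: "(\<forall>x. A x \<in> fib L x) \<and> hat A \<in> \<Gamma>"
  have "smooth_fib_on L U (\<lambda>x. \<psi> (A x))" if U: "(U, \<psi>) \<in> bcharts L" for U \<psi>
    unfolding smooth_fib_on_iff[OF bchart(1)[OF U]]
  proof
    fix x assume x: "x \<in> U"
    have "(U, \<lambda>x u. \<psi> (untriv L x u)) \<in> trivs" using U by (auto simp: trivs_def)
    from sm_sec_chart[OF \<Gamma>D[OF conjunct2[OF A]] this x]
    show "smf (\<lambda>x. \<psi> (A x)) x" using A untriv_triv by (simp add: hat_def)
  qed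
  then show "A \<in> sections L" using A by (auto simp: sections_def)
qed

lemma section_fib: "A \<in> sections L \<Longrightarrow> A x \<in> fib L x"
  and section_hat: "A \<in> sections L \<Longrightarrow> hat A \<in> \<Gamma>"
  by (simp_all add: sections_iff)

lemma unhat_section: "A \<in> \<Gamma> \<Longrightarrow> unhat A \<in> sections L"
  unfolding sections_iff by (simp add: unhat_def hat_def)

lemma unhat_hat: "A \<in> sections L \<Longrightarrow> unhat (hat A) = A"
  by (simp add: unhat_def hat_def untriv_triv[OF section_fib])

lemma hat_sadd: "hat (sadd L A B) = (\<lambda>x. hat A x + hat B x)"
  and hat_sscl: "hat (sscl L a A) = (\<lambda>x. sc (a x) (hat A x))"
  and hat_sbrk: "hat (sbrk L A B) = (\<lambda>x. br (hat A x) (hat B x))"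
  by (simp_all add: hat_def sadd_def sscl_def sbrk_def fadd_def fscl_def fbrk_def)

lemma unhat_add: "unhat (\<lambda>x. A x + B x) = sadd L (unhat A) (unhat B)"
  and unhat_scale: "unhat (\<lambda>x. sc (a x) (A x)) = sscl L a (unhat A)"
  and unhat_br: "unhat (\<lambda>x. br (A x) (B x)) = sbrk L (unhat A) (unhat B)"
  by (simp_all add: unhat_def sadd_def sscl_def sbrk_def fadd_def fscl_def fbrk_def)

lemma op_fib [simp]: "fadd L x p q \<in> fib L x" "fscl L x c p \<in> fib L x" "fbrk L x p q \<in> fib L x"
  by (simp_all add: fadd_def fscl_def fbrk_def)

lemma triv_op [simp]: "triv L x (fadd L x p q) = triv L x p + triv L x q"
  "triv L x (fscl L x c p) = sc c (triv L x p)"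
  "triv L x (fbrk L x p q) = br (triv L x p) (triv L x q)"
  by (simp_all add: fadd_def fscl_def fbrk_def)


subsection \<open>Endomorphisms of the fibres\<close>

definition low :: "'m \<Rightarrow> ('l \<Rightarrow> 'l) \<Rightarrow> 'f \<Rightarrow> 'f" where
  "low x f u = triv L x (f (untriv L x u))"
text \<open>The restriction to the fibre makes \<open>lift\<close> inverse to \<open>low\<close> on
  \<open>End_fib\<close>, whose elements are extensional.\<close>

definition lift :: "'m \<Rightarrow> ('f \<Rightarrow> 'f) \<Rightarrow> 'l \<Rightarrow> 'l" where
  "lift x h = (\<lambda>p\<in>fib L x. untriv L x (h (triv L x p)))"

lemma low_lift [simp]: "low x (lift x h) = h"
  by (simp add: low_def lift_def fun_eq_iff)

lemma lift_low: "f \<in> End_fib L x \<Longrightarrow> lift x (low x f) = f"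
  by (auto simp: lift_def low_def End_fib_def untriv_triv PiE_iff extensional_def fun_eq_iff)

lemma triv_End: "p \<in> fib L x \<Longrightarrow> triv L x (f p) = low x f (triv L x p)"
  by (simp add: low_def untriv_triv)

lemma low_lin:
  assumes f: "f \<in> End_fib L x"
  shows "lin (low x f)"
  unfolding lin_def
proof (intro conjI allI)
  fix u v c
  have "untriv L x (u + v) = fadd L x (untriv L x u) (untriv L x v)" by (simp add: fadd_def)
  then show "low x f (u + v) = low x f u + low x f v"
    using f by (simp add: low_def End_fib_def)
  have "untriv L x (sc c u) = fscl L x c (untriv L x u)" by (simp add: fscl_def)
  then show "low x f (sc c u) = sc c (low x f u)"
    using f by (simp add: low_def End_fib_def)
qed

lemma low_Cent:
  assumes f: "f \<in> Cent_fib L x"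
  shows "low x f (br u v) = br u (low x f v)"
proof -
  have "untriv L x (br u v) = fbrk L x (untriv L x u) (untriv L x v)" by (simp add: fbrk_def)
  then show ?thesis using f by (simp add: low_def Cent_fib_def)
qed

lemma low_Der:
  assumes f: "f \<in> Der_fib L x"
  shows "low x f (br u v) = br (low x f u) v + br u (low x f v)"
proof -
  have "untriv L x (br u v) = fbrk L x (untriv L x u) (untriv L x v)" by (simp add: fbrk_def)
  then show ?thesis using f by (simp add: low_def Der_fib_def)
qed

lemma lift_End: "lin h \<Longrightarrow> lift x h \<in> End_fib L x"
  by (auto simp: End_fib_def lift_def lin_add lin_scale fadd_def fscl_def)

lemma lift_Cent:
  assumes "lin h" "\<And>u v. h (br u v) = br u (h v)"
  shows "lift x h \<in> Cent_fib L x"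
  using lift_End[OF assms(1)] by (auto simp: Cent_fib_def lift_def assms(2) fbrk_def)

lemma lift_Der:
  assumes "lin h" "\<And>u v. h (br u v) = br (h u) v + br u (h v)"
  shows "lift x h \<in> Der_fib L x"
  using lift_End[OF assms(1)] by (auto simp: Der_fib_def lift_def assms(2) fbrk_def fadd_def)

text \<open>The matrix entries in a bundle chart are the values on sections constant in that chart;
  near each point these extend to elements of \<Gamma>, so testing on global sections is
  enough.\<close>

lemma hom_sectionI:
  assumes W: "open W" and S: "\<And>x. x \<in> W \<Longrightarrow> lin (h x)"
    and sm: "\<And>x A. x \<in> W \<Longrightarrow> A \<in> \<Gamma> \<Longrightarrow> sm_sec (\<lambda>y. h y (A y)) x"
  shows "(\<lambda>x. lift x (h x)) \<in> hom_sections_on L W"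
  unfolding hom_sections_on_def mem_Collect_eq
proof (intro conjI ballI)
  show "lift x (h x) \<in> End_fib L x" if "x \<in> W" for x by (rule lift_End[OF S[OF that]])
  fix c assume "c \<in> bcharts L"
  moreover obtain U \<psi> where c: "c = (U, \<psi>)" by fastforce
  ultimately have U: "(U, \<psi>) \<in> bcharts L" by simp
  define g where "g x u = \<psi> (untriv L x u)" for x u
  have T: "(U, g) \<in> trivs" using U by (auto simp: trivs_def g_def[abs_def])
  have op: "open (U \<inter> W)" using bchart(1)[OF U] W by blast
  have "smf (\<lambda>y. \<psi> (lift y (h y) (inv_into (fib L y) \<psi> w))) x" if x: "x \<in> U \<inter> W" for x w
  proof -
    have xU: "x \<in> U" using x by blast
    obtain A N where A: "A \<in> \<Gamma>" "open N" "x \<in> N" "\<And>y. y \<in> N \<Longrightarrow> A y = inv (g y) w"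
      using ex_\<Gamma>_extension[OF bchart(1)[OF U] xU sm_sec_const[OF T]] by metis
    have "smf (\<lambda>y. g y (h y (A y))) x"
      using sm_sec_chart[OF sm T] x A(1) by blast
    then show ?thesis
    proof (rule smf_cong)
      show "open (N \<inter> U)" "x \<in> N \<inter> U" using A bchart(1)[OF U] xU by auto
      show "g y (h y (A y)) = \<psi> (lift y (h y) (inv_into (fib L y) \<psi> w))" if "y \<in> N \<inter> U" for y
        using that A(4) inv_into_chart[OF U, of y w] by (simp add: g_def[abs_def] lift_def)
    qed
  qed
  then have "smooth_fib_on L (U \<inter> W) (\<lambda>y. \<psi> (lift y (h y) (inv_into (fib L y) \<psi> w)))" for w
    unfolding smooth_fib_on_iff[OF op] by blast
  then show "case c of (U, \<psi>) \<Rightarrow> \<forall>w. smooth_fib_on L (U \<inter> W) (\<lambda>x. \<psi> (lift x (h x) (inv_into (fib L x) \<psi> w)))"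
    by (simp add: c)
qed


subsection \<open>Bilinear forms\<close>

lemma bilinear_form_sum_left:
  assumes \<beta>: "bilinear_form L x \<beta>" and "finite I" "\<And>i. i \<in> I \<Longrightarrow> v i \<in> tangent_space (base L) x"
    and S: "S \<in> Cent_fib L x"
  shows "\<beta> (\<lambda>f. \<Sum>i\<in>I. c i * v i f) S = (\<Sum>i\<in>I. c i * \<beta> (v i) S)"
  using assms(2,3)
proof induction
  case empty
  from \<beta>[unfolded bilinear_form_def, THEN conjunct2, THEN conjunct1, rule_format, OF tangent_zero S, of 0]
  show ?case by simp
next
  case (insert i I)
  have t: "v i \<in> tangent_space (base L) x" "(\<lambda>f. c i * v i f) \<in> tangent_space (base L) x"
    "(\<lambda>f. \<Sum>i\<in>I. c i * v i f) \<in> tangent_space (base L) x"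
    using insert tangent_lincomb[of "v i" x "v i" "c i" 0] by (auto intro!: tangent_sum_in)
  have "\<beta> (\<lambda>f. c i * v i f + (\<Sum>i\<in>I. c i * v i f)) S
      = \<beta> (\<lambda>f. c i * v i f) S + \<beta> (\<lambda>f. \<Sum>i\<in>I. c i * v i f) S"
    by (rule \<beta>[unfolded bilinear_form_def, THEN conjunct1, rule_format, OF t(2,3) S])
  moreover have "\<beta> (\<lambda>f. c i * v i f) S = c i * \<beta> (v i) S"
    by (rule \<beta>[unfolded bilinear_form_def, THEN conjunct2, THEN conjunct1, rule_format, OF t(1) S])
  ultimately show ?case using insert by simp
qed

lemma bilinear_form_sum_right:
  assumes \<beta>: "bilinear_form L x \<beta>" and v: "v \<in> tangent_space (base L) x" and "finite I"
    and h: "\<And>i. i \<in> I \<Longrightarrow> lin (h i)" "\<And>i u w. i \<in> I \<Longrightarrow> h i (br u w) = br u (h i w)"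
  shows "\<beta> v (lift x (\<lambda>u. \<Sum>i\<in>I. sc (of_real (c i)) (h i u))) = (\<Sum>i\<in>I. c i * \<beta> v (lift x (h i)))"
  using assms(3) h
proof induction
  case empty
  \<comment> \<open>The zero endomorphism is 0 times itself, so bilinearity sends it to 0.\<close>
  have C: "lift x (\<lambda>u. 0) \<in> Cent_fib L x" by (rule lift_Cent) (simp_all add: lin_def br_zero_right)
  have "\<beta> v (\<lambda>p\<in>fib L x. fscl L x (of_real 0) (lift x (\<lambda>u. 0) p)) = 0 * \<beta> v (lift x (\<lambda>u. 0))"
    using \<beta> v C unfolding bilinear_form_def by blast
  moreover have "(\<lambda>p\<in>fib L x. fscl L x (of_real 0) (lift x (\<lambda>u. 0) p)) = lift x (\<lambda>u. 0)"
    by (simp add: lift_def fscl_def)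
  ultimately show ?case by simp
next
  case (insert i I)
  let ?s = "\<lambda>u. \<Sum>i\<in>I. sc (of_real (c i)) (h i u)" and ?t = "\<lambda>u. sc (of_real (c i)) (h i u)"
  have li: "lin (h i)" and ci: "\<And>u w. h i (br u w) = br u (h i w)" using insert.prems by auto
  have Ci: "lift x (h i) \<in> Cent_fib L x" by (rule lift_Cent[OF li ci])
  have Ct: "lift x ?t \<in> Cent_fib L x"
    by (rule lift_Cent) (simp_all add: lin_def lin_add[OF li] lin_scale[OF li] V.scale_right_distrib
        ci br_scale_right mult.commute)
  have Cs: "lift x ?s \<in> Cent_fib L x"
  proof (rule lift_Cent)
    have "lin (h j)" if "j \<in> I" for j using insert.prems(1) that by simp
    then show "lin ?s"
      unfolding lin_def by (simp add: lin_add lin_scale V.scale_right_distrib sum.distrib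
          V.scale_sum_right mult.commute)
    show "?s (br u w) = br u (?s w)" for u w
      using insert.prems(2) by (simp add: br_sum_right br_scale_right)
  qed
  have "(\<lambda>p\<in>fib L x. fscl L x (of_real (c i)) (lift x (h i) p)) = lift x ?t"
    by (auto simp: lift_def fscl_def fun_eq_iff)
  moreover have "\<beta> v (\<lambda>p\<in>fib L x. fscl L x (of_real (c i)) (lift x (h i) p)) = c i * \<beta> v (lift x (h i))"
    using \<beta> v Ci unfolding bilinear_form_def by blast
  ultimately have 1: "\<beta> v (lift x ?t) = c i * \<beta> v (lift x (h i))" by simp
  have "(\<lambda>p\<in>fib L x. fadd L x (lift x ?t p) (lift x ?s p)) = lift x (\<lambda>u. ?t u + ?s u)"
    by (auto simp: lift_def fadd_def fun_eq_iff)
  moreover have "\<beta> v (\<lambda>p\<in>fib L x. fadd L x (lift x ?t p) (lift x ?s p)) = \<beta> v (lift x ?t) + \<beta> v (lift x ?s)"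
    using \<beta> v Ct Cs unfolding bilinear_form_def by blast
  ultimately have "\<beta> v (lift x (\<lambda>u. ?t u + ?s u)) = c i * \<beta> v (lift x (h i)) + \<beta> v (lift x ?s)"
    using 1 by simp
  moreover have "\<beta> v (lift x ?s) = (\<Sum>i\<in>I. c i * \<beta> v (lift x (h i)))"
    using insert.prems by (intro insert.IH) auto
  ultimately show ?case using insert.hyps by simp
qed

end


subsection \<open>The extended connection\<close>

locale lie_bdl_connection = lie_bdl L
  for L :: "('m::t2_space, 'e::real_inner, 'k::{real_normed_field,euclidean_space},
                'f::ab_group_add, 'l) lie_bundle_data" +
  fixes nabla :: "('m \<Rightarrow> 'm tvec) \<Rightarrow> ('m \<Rightarrow> 'l) \<Rightarrow> 'm \<Rightarrow> 'l"
  assumes connection: "lie_connection L nabla"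
begin

definition nab :: "('m \<Rightarrow> 'm tvec) \<Rightarrow> ('m \<Rightarrow> 'f) \<Rightarrow> 'm \<Rightarrow> 'f" where
  "nab X A = hat (nabla X (unhat A))"

lemma nabla_section: "X \<in> vector_fields (base L) \<Longrightarrow> A \<in> sections L \<Longrightarrow> nabla X A \<in> sections L"
  using connection unfolding lie_connection_def covariant_derivative_def linear_op_def by blast

end

sublocale lie_bdl_connection \<subseteq> twisted_connection "base L" "fiber L" trivs nab
proof
  fix X :: "'m \<Rightarrow> 'm tvec" and A x assume X: "X \<in> vector_fields (base L)" and A: "A \<in> \<Gamma>"
  note cd = connection[unfolded lie_connection_def covariant_derivative_def linear_op_def]
  note uA = unhat_section[OF A]
  show "nab X A \<in> \<Gamma>" unfolding nab_def by (rule section_hat[OF nabla_section[OF X uA]])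
  show "nab X (\<lambda>y. A y + B y) x = nab X A x + nab X B x" if B: "B \<in> \<Gamma>" for B
  proof -
    have "nabla X (sadd L (unhat A) (unhat B)) = sadd L (nabla X (unhat A)) (nabla X (unhat B))"
      using cd X uA unhat_section[OF B] by blast
    then show ?thesis by (simp add: nab_def unhat_add hat_sadd)
  qed
  show "nab X (\<lambda>y. br (A y) (B y)) x = br (nab X A x) (B x) + br (A x) (nab X B x)"
    if B: "B \<in> \<Gamma>" for B
  proof -
    have "nabla X (sbrk L (unhat A) (unhat B))
        = sadd L (sbrk L (nabla X (unhat A)) (unhat B)) (sbrk L (unhat A) (nabla X (unhat B)))"
      using cd X uA unhat_section[OF B] by blast
    then show ?thesis by (simp add: nab_def unhat_br hat_sadd hat_sbrk)
  qed
  show "nab X (\<lambda>y. sc (a y) (A y)) x = sc (vf_act X a x) (A x) + sc (a x) (nab X A x)"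
    if a: "smooth a" for a
  proof -
    have "nabla X (sscl L a (unhat A)) = sadd L (sscl L (vf_act X a) (unhat A)) (sscl L a (nabla X (unhat A)))"
      using cd X uA a by blast
    then show ?thesis by (simp add: nab_def unhat_scale hat_sadd hat_sscl)
  qed
  show "nab (\<lambda>y h. f y * X y h + g y * Y y h) A x
        = sc (of_real (f x)) (nab X A x) + sc (of_real (g x)) (nab Y A x)"
    if Y: "Y \<in> vector_fields (base L)" and f: "smooth f" and g: "smooth g" for Y f g
  proof -
    have "nabla (\<lambda>x h. f x * X x h + g x * Y x h) (unhat A)
        = sadd L (sscl L (\<lambda>x. of_real (f x)) (nabla X (unhat A))) (sscl L (\<lambda>x. of_real (g x)) (nabla Y (unhat A)))"
      using cd X Y uA f g by blast
    then show ?thesis by (simp add: nab_def hat_sadd hat_sscl)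
  qed
qed

context lie_bdl_connection
begin

text \<open>Whatever field \<open>SOME\<close> picks, it has the right value at \<open>x\<close>,
  and by tensoriality the connection depends on that value only.\<close>

lemma local_nabla_eq:
  assumes U: "(U, \<xi>) \<in> charts (base L)" "x \<in> U" and A: "A \<in> sections L"
  shows "local_nabla L nabla (coord_field (base L) U \<xi> e) A x
    = untriv L x (nabv (coord_field (base L) U \<xi> e x) (hat A) x)"
proof -
  define X where "X = (SOME X'. X' \<in> vector_fields (base L) \<and>
    (\<forall>\<^sub>F y in nhds x. X' y = coord_field (base L) U \<xi> e y))"
  obtain X' N where X': "X' \<in> vector_fields (base L)" "open N" "x \<in> N"
    "\<And>y. y \<in> N \<Longrightarrow> X' y = coord_field (base L) U \<xi> e y" using ex_local_vector_field[OF U] by metis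
  then have "\<forall>\<^sub>F y in nhds x. X' y = coord_field (base L) U \<xi> e y"
    using eventually_nhds by blast
  with X'(1) have "\<exists>X'. X' \<in> vector_fields (base L) \<and>
      (\<forall>\<^sub>F y in nhds x. X' y = coord_field (base L) U \<xi> e y)" by blast
  then have "X \<in> vector_fields (base L) \<and> (\<forall>\<^sub>F y in nhds x. X y = coord_field (base L) U \<xi> e y)"
    unfolding X_def by (rule someI_ex)
  then have X: "X \<in> vector_fields (base L)" "X x = coord_field (base L) U \<xi> e x"
    using eventually_nhds_x_imp_x by blast+
  have "untriv L x (nab X (hat A) x) = nabla X A x"
    by (simp add: nab_def hat_def[of "nabla X _"] unhat_hat[OF A] untriv_triv section_fib[OF nabla_section[OF X(1) A]])
  then show ?thesis
    using nabv_eq[OF X(1) section_hat[OF A], of x] X(2)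
    by (simp add: local_nabla_def X_def[symmetric])
qed

definition component_sum where
  "component_sum U \<xi> S A x
    = (\<Sum>e\<in>frame (base L). low x (S e x) (nabv (coord_field (base L) U \<xi> e x) (hat A) x))"

text \<open>
  Evaluating a tensor at the bilinear form \<open>(v, S) \<mapsto> l(S(\<nabla>\<^sub>v A))\<close> recovers the functional \<open>l\<close> of
  \<open>\<nabla>\<^sub>Y A\<close>, without reference to a chart.
\<close>

lemma component_sum_unique:
  assumes U: "(U, \<xi>) \<in> charts (base L)" "x \<in> U" "local_components L U \<xi> Y S"
    and V: "(V, \<eta>) \<in> charts (base L)" "x \<in> V" "local_components L V \<eta> Y S'"
    and A: "A \<in> sections L"
  shows "component_sum U \<xi> S A x = component_sum V \<eta> S' A x"
proof (rule co_eqI, rule euclidean_eqI)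
  fix c and b :: 'k
  note hA = section_hat[OF A] and l = lfun_co[of c]
  define \<beta> where "\<beta> v f = co c (low x f (nabv v (hat A) x)) \<bullet> b" for v f
  have \<beta>: "bilinear_form L x \<beta>"
    unfolding bilinear_form_def
  proof (intro conjI ballI allI)
    fix v f assume v: "v \<in> tangent_space (base L) x" and f: "f \<in> Cent_fib L x"
    have lf: "lin (low x f)" using f by (intro low_lin) (simp add: Cent_fib_def)
    show "\<beta> (\<lambda>h. v h + w h) f = \<beta> v f + \<beta> w f" if w: "w \<in> tangent_space (base L) x" for w
      using nabv_lincomb[OF v w hA, of 1 1]
      by (simp add: \<beta>_def lin_add[OF lf] lfun_add[OF l] inner_add_left)
    show "\<beta> (\<lambda>h. r * v h) f = r * \<beta> v f" for r
      using nabv_lincomb[OF v v hA, of r 0]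
      by (simp add: \<beta>_def lin_scale[OF lf] lfun_scale[OF l] of_real_def)
    show "\<beta> v (\<lambda>p\<in>fib L x. fadd L x (f p) (f' p)) = \<beta> v f + \<beta> v f'" for f'
      by (simp add: \<beta>_def low_def lfun_add[OF l] inner_add_left)
    show "\<beta> v (\<lambda>p\<in>fib L x. fscl L x (of_real r) (f p)) = r * \<beta> v f" for r
      by (simp add: \<beta>_def low_def lfun_scale[OF l] of_real_def)
  qed
  have "Y x \<beta> = co c (component_sum U \<xi> S A x) \<bullet> b"
    if "local_components L U \<xi> Y S" "x \<in> U" for U \<xi> S
    using that \<beta> by (simp add: local_components_def tens_def \<beta>_def component_sum_def
        lfun_sum[OF l] inner_sum_left)
  from this[OF U(3,2)] this[OF V(3,2)]
  show "co c (component_sum U \<xi> S A x) \<bullet> b = co c (component_sum V \<eta> S' A x) \<bullet> b" by simp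
qed

lemma Cent_section_End: "S \<in> Cent_sections_on L U \<Longrightarrow> x \<in> U \<Longrightarrow> S x \<in> End_fib L x"
  by (simp add: Cent_sections_on_def Cent_fib_def)

text \<open>Discharges the \<open>THE\<close> in \<open>nabla_ext\<close>: the given chart supplies
  existence, \<open>component_sum_unique\<close> uniqueness.\<close>

lemma nabla_ext_eq:
  assumes U: "(U, \<xi>) \<in> charts (base L)" "x \<in> U" "local_components L U \<xi> Y S" and A: "A \<in> sections L"
  shows "nabla_ext L nabla Y A x = untriv L x (component_sum U \<xi> S A x)"
proof -
  have val: "fsum L x (\<lambda>e. S e x (local_nabla L nabla (coord_field (base L) U \<xi> e) A x)) (frame (base L))
      = untriv L x (component_sum U \<xi> S A x)"
    if "(U, \<xi>) \<in> charts (base L)" "x \<in> U" for U \<xi> S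
    using local_nabla_eq[OF that A] by (simp add: fsum_def component_sum_def low_def)
  show ?thesis
    unfolding nabla_ext_def
  proof (rule the_equality)
    show "\<exists>V \<eta> S'. (V, \<eta>) \<in> charts (base L) \<and> x \<in> V \<and> local_components L V \<eta> Y S' \<and>
      untriv L x (component_sum U \<xi> S A x)
        = fsum L x (\<lambda>e. S' e x (local_nabla L nabla (coord_field (base L) V \<eta> e) A x)) (frame (base L))"
      by (intro exI[of _ U] exI[of _ \<xi>] exI[of _ S] conjI U val[OF U(1,2), symmetric])
  next
    fix p
    assume "\<exists>U \<xi> S. (U, \<xi>) \<in> charts (base L) \<and> x \<in> U \<and> local_components L U \<xi> Y S \<and>
      p = fsum L x (\<lambda>e. S e x (local_nabla L nabla (coord_field (base L) U \<xi> e) A x)) (frame (base L))"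
    then obtain V \<eta> S' where V: "(V, \<eta>) \<in> charts (base L)" "x \<in> V" "local_components L V \<eta> Y S'"
      and "p = fsum L x (\<lambda>e. S' e x (local_nabla L nabla (coord_field (base L) V \<eta> e) A x)) (frame (base L))"
      by blast
    then have "p = untriv L x (component_sum V \<eta> S' A x)" by (simp only: val[OF V(1,2)])
    then show "p = untriv L x (component_sum U \<xi> S A x)" by (simp only: component_sum_unique[OF V U A])
  qed
qed

definition decomposes where
  "decomposes D Y D0 \<longleftrightarrow> (\<forall>A\<in>sections L. D A = sadd L (nabla_ext L nabla Y A) (iop D0 A))"

definition hat_op :: "(('m \<Rightarrow> 'l) \<Rightarrow> 'm \<Rightarrow> 'l) \<Rightarrow> ('m \<Rightarrow> 'f) \<Rightarrow> 'm \<Rightarrow> 'f" where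
  "hat_op D A = hat (D (unhat A))"

lemma decomposes_at:
  assumes D: "decomposes D Y D0" and U: "(U, \<xi>) \<in> charts (base L)" "x \<in> U" "local_components L U \<xi> Y S"
    and A: "A \<in> sections L"
  shows "triv L x (D A x) = component_sum U \<xi> S A x + low x (D0 x) (hat A x)"
proof -
  have "D A = sadd L (nabla_ext L nabla Y A) (iop D0 A)" using D A by (simp add: decomposes_def)
  then have "triv L x (D A x) = triv L x (nabla_ext L nabla Y A x) + triv L x (D0 x (A x))"
    by (simp add: sadd_def iop_def)
  then show ?thesis
    by (simp add: nabla_ext_eq[OF U A] hat_def triv_End[OF section_fib[OF A]])
qed

lemma tensor_section_components:
  assumes "Y \<in> tensor_sections L" "(U, \<xi>) \<in> charts (base L)"
  obtains S where "local_components L U \<xi> Y S"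
  using assms by (auto simp: tensor_sections_def)

section \<open>From decompositions to derivations and back\<close>

lemma decomposes_imp_derivation:
  assumes lin: "linear_op L D" and Y: "Y \<in> tensor_sections L" and D0: "D0 \<in> Der_sections L"
    and D: "decomposes D Y D0"
  shows "derivation_op L D"
  unfolding derivation_op_def
proof (intro conjI ballI lin)
  fix A B assume A: "A \<in> sections L" and B: "B \<in> sections L"
  have AB: "sbrk L A B \<in> sections L"
    using \<Gamma>_br[OF section_hat[OF A] section_hat[OF B]] unfolding sections_iff hat_sbrk
    by (simp add: sbrk_def)
  show "D (sbrk L A B) = sadd L (sbrk L (D A) B) (sbrk L A (D B))"
  proof
    fix x
    obtain U \<xi> where U: "(U, \<xi>) \<in> charts (base L)" "x \<in> U" by (rule ex_chart)
    obtain S where S: "local_components L U \<xi> Y S" by (rule tensor_section_components[OF Y U(1)])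
    have C: "S e x \<in> Cent_fib L x" if "e \<in> frame (base L)" for e
      using S U(2) that by (auto simp: local_components_def Cent_sections_on_def)
    \<comment> \<open>\<open>Cent_fib\<close> speaks of the right factor. Once \<open>S e\<close>
      passes into the left factor too, composing it with the product rule of the connection gives a
      product rule again.\<close>
    have E: "low x (S e x) (br u v) = br (low x (S e x) u) v" if "e \<in> frame (base L)" for e u v
    proof -
      have "lin (low x (S e x))" using C[OF that] by (intro low_lin) (simp add: Cent_fib_def)
      then show ?thesis
        using low_Cent[OF C[OF that], of v u] br_swap[of u v] br_swap[of "low x (S e x) u" v]
        by (simp add: lin_minus)
    qed
    have "component_sum U \<xi> S (sbrk L A B) x
        = br (component_sum U \<xi> S A x) (hat B x) + br (hat A x) (component_sum U \<xi> S B x)"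
    proof -
      have "low x (S e x) (nabv (coord_field (base L) U \<xi> e x) (hat (sbrk L A B)) x)
          = br (low x (S e x) (nabv (coord_field (base L) U \<xi> e x) (hat A) x)) (hat B x)
            + br (hat A x) (low x (S e x) (nabv (coord_field (base L) U \<xi> e x) (hat B) x))"
        if e: "e \<in> frame (base L)" for e
      proof -
        have l: "lin (low x (S e x))" using C[OF e] by (intro low_lin) (simp add: Cent_fib_def)
        show ?thesis
          unfolding hat_sbrk nabv_br[OF coord_field_tangent[OF U] section_hat[OF A] section_hat[OF B]]
            lin_add[OF l] by (simp only: E[OF e, of _ "hat B x"] low_Cent[OF C[OF e], of "hat A x"])
      qed
      then show ?thesis by (simp add: component_sum_def sum.distrib br_sum_left br_sum_right)
    qed
    moreover have "low x (D0 x) (br u v) = br (low x (D0 x) u) v + br u (low x (D0 x) v)" for u v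
      using D0 by (intro low_Der) (simp add: Der_sections_def)
    ultimately have "triv L x (D (sbrk L A B) x)
        = br (triv L x (D A x)) (hat B x) + br (hat A x) (triv L x (D B x))"
      by (simp add: decomposes_at[OF D U S] A B AB hat_sbrk br_add_left br_add_right)
    moreover have "D (sbrk L A B) x \<in> fib L x"
      using lin AB section_fib unfolding linear_op_def by blast
    ultimately show "D (sbrk L A B) x = sadd L (sbrk L (D A) B) (sbrk L A (D B)) x"
      by (intro fib_eqI[of _ x]) (simp_all add: sadd_def sbrk_def hat_def)
  qed
qed

lemma decomposition_unique:
  assumes Y: "Y \<in> tensor_sections L" "Y' \<in> tensor_sections L"
    and D0: "D0 \<in> Der_sections L" "D0' \<in> Der_sections L"
    and D: "decomposes D Y D0" "decomposes D Y' D0'"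
  shows "Y = Y' \<and> D0 = D0'"
proof -
  have "Y x = Y' x \<and> D0 x = D0' x" for x
  proof -
    obtain U \<xi> where U: "(U, \<xi>) \<in> charts (base L)" "x \<in> U" by (rule ex_chart)
    obtain \<zeta> N where \<zeta>: "coordinates_near U \<xi> N \<zeta>" "x \<in> N" using ex_coordinates[OF U] by blast
    obtain S where S: "local_components L U \<xi> Y S" by (rule tensor_section_components[OF Y(1) U(1)])
    obtain S' where S': "local_components L U \<xi> Y' S'" by (rule tensor_section_components[OF Y(2) U(1)])
    \<comment> \<open>Stated for an arbitrary decomposition so that both can be compared with the
      same left-hand side, which involves \<open>D\<close> only.\<close>
    have at: "delta (hat_op D) (\<lambda>y. of_real (\<zeta> e y)) A x = low x (S e x) (A x)"
      if S: "local_components L U \<xi> Y S" and D0: "D0 \<in> Der_sections L" and D: "decomposes D Y D0"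
        and e: "e \<in> frame (base L)" and A: "A \<in> \<Gamma>" for S Y D0 e A
    proof (rule component_eq_delta[OF U(1) \<zeta> _ _ _ e A])
      show "lin (low x (S e x))" if "e \<in> frame (base L)" for e
        using S U(2) that Cent_section_End by (intro low_lin) (auto simp: local_components_def)
      show "lin (low x (D0 x))" using D0 by (intro low_lin) (simp add: Der_sections_def Der_fib_def)
      show "hat_op D A x = (\<Sum>e\<in>frame (base L). low x (S e x) (nabv (coord_field (base L) U \<xi> e x) A x))
          + low x (D0 x) (A x)" if "A \<in> \<Gamma>" for A
        using decomposes_at[OF D U S unhat_section[OF that]]
        by (simp add: hat_op_def component_sum_def hat_def[of "D _"])
    qed
    have SS: "S e x = S' e x" if e: "e \<in> frame (base L)" for e
    proof -
      have "low x (S e x) u = low x (S' e x) u" for u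
      proof -
        obtain A where A: "A \<in> \<Gamma>" "A x = u" by (rule ex_\<Gamma>_through)
        then show ?thesis using at[OF S D0(1) D(1) e A(1)] at[OF S' D0(2) D(2) e A(1)] by simp
      qed
      then have "low x (S e x) = low x (S' e x)" by blast
      moreover have "S e x \<in> End_fib L x" "S' e x \<in> End_fib L x"
        using S S' U(2) e Cent_section_End by (auto simp: local_components_def)
      ultimately show ?thesis using lift_low by metis
    qed
    then have "Y x = Y' x" using S S' U(2) by (simp add: local_components_def)
    \<comment> \<open>With equal components the connection parts agree, so the order-zero parts do
      as well.\<close>
    moreover have "low x (D0 x) u = low x (D0' x) u" for u
    proof -
      obtain A where A: "A \<in> \<Gamma>" "A x = u" by (rule ex_\<Gamma>_through)
      have "component_sum U \<xi> S (unhat A) x = component_sum U \<xi> S' (unhat A) x"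
        by (simp add: component_sum_def SS)
      then show ?thesis
        using decomposes_at[OF D(1) U S unhat_section[OF A(1)]]
          decomposes_at[OF D(2) U S' unhat_section[OF A(1)]] A(2) by simp
    qed
    then have "low x (D0 x) = low x (D0' x)" by blast
    moreover have "D0 x \<in> End_fib L x" "D0' x \<in> End_fib L x"
      using D0 by (simp_all add: Der_sections_def Der_fib_def)
    ultimately show ?thesis using lift_low by metis
  qed
  then show ?thesis by blast
qed

lemma derivation_imp_decomposes:
  assumes G: "perfect_lie (fiber L) \<or> centerfree_lie (fiber L)" and D: "derivation_op L D"
  shows "\<exists>Y\<in>tensor_sections L. \<exists>D0\<in>Der_sections L. decomposes D Y D0"
proof -
  have D_sec: "D A \<in> sections L" if "A \<in> sections L" for A
    using D that unfolding derivation_op_def linear_op_def by blast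
  \<comment> \<open>Transported to \<open>'f\<close>-valued functions, \<open>D\<close> fits the
    locale in which the components and the remainder were constructed.\<close>
  have "derivation (hat_op D)"
    unfolding derivation_def
  proof (intro conjI ballI allI)
    fix A assume A: "A \<in> \<Gamma>"
    note uA = unhat_section[OF A] and d = D[unfolded derivation_op_def linear_op_def]
    show "hat_op D A \<in> \<Gamma>" unfolding hat_op_def by (intro section_hat D_sec uA)
    show "hat_op D (\<lambda>y. sc c (A y)) x = sc c (hat_op D A x)" for c x
    proof -
      have "D (sscl L (\<lambda>_. c) (unhat A)) = sscl L (\<lambda>_. c) (D (unhat A))" using d uA by blast
      then show ?thesis by (simp add: hat_op_def unhat_scale[of "\<lambda>_. c"] hat_sscl)
    qed
    fix B x assume B: "B \<in> \<Gamma>"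
    note uB = unhat_section[OF B]
    have "D (sadd L (unhat A) (unhat B)) = sadd L (D (unhat A)) (D (unhat B))" using d uA uB by blast
    then show "hat_op D (\<lambda>y. A y + B y) x = hat_op D A x + hat_op D B x"
      by (simp add: hat_op_def unhat_add hat_sadd)
    have "D (sbrk L (unhat A) (unhat B)) = sadd L (sbrk L (D (unhat A)) (unhat B)) (sbrk L (unhat A) (D (unhat B)))"
      using d uA uB by blast
    then show "hat_op D (\<lambda>y. br (A y) (B y)) x = br (hat_op D A x) (B x) + br (A x) (hat_op D B x)"
      by (simp add: hat_op_def unhat_br hat_sadd hat_sbrk)
  qed
  then interpret dec: twisted_decomposition "base L" "fiber L" trivs "hat_op D" nab
    by unfold_locales (use G in auto)
  define S where "S U \<xi> e x = lift x (dec.comp U \<xi> e x)" for U \<xi> e x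
  define D0 where "D0 x = lift x (dec.rest_at x)" for x
  \<comment> \<open>\<open>Y\<close> is defined point by point in an arbitrarily chosen chart;
    \<open>comps\<close> then shows that in every chart its components are the smooth sections
    \<open>S\<close>.\<close>
  define Y where "Y x \<beta> = (\<Sum>e\<in>frame (base L).
    tens L x (coord_field (base L) (fst (dec.chart_at x)) (snd (dec.chart_at x)) e x)
      (S (fst (dec.chart_at x)) (snd (dec.chart_at x)) e x) \<beta>)" for x \<beta>
  have S_Cent: "S U \<xi> e x \<in> Cent_fib L x" if "(U, \<xi>) \<in> charts (base L)" "x \<in> U" for U \<xi> e x
    unfolding S_def by (rule lift_Cent[OF dec.comp_lin[OF that] dec.comp_br[OF that]])
  have comps: "local_components L V \<eta> Y (S V \<eta>)" if V: "(V, \<eta>) \<in> charts (base L)" for V \<eta>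
    unfolding local_components_def
  proof (intro conjI ballI)
    fix e
    have "S V \<eta> e = (\<lambda>x. lift x (dec.comp V \<eta> e x))" by (simp add: S_def[abs_def])
    then have "S V \<eta> e \<in> hom_sections_on L V"
      using hom_sectionI[OF chart_homeomorphism(1)[OF V] dec.comp_lin[OF V] dec.comp_smooth[OF V]] by simp
    then show "S V \<eta> e \<in> Cent_sections_on L V" using S_Cent[OF V] by (simp add: Cent_sections_on_def)
  next
    fix x assume x: "x \<in> V"
    define U \<xi> where "U = fst (dec.chart_at x)" and "\<xi> = snd (dec.chart_at x)"
    have U: "(U, \<xi>) \<in> charts (base L)" "x \<in> U" using dec.chart_at[of x] by (auto simp: U_def \<xi>_def)
    obtain \<zeta> N where \<zeta>: "coordinates_near U \<xi> N \<zeta>" "x \<in> N" using ex_coordinates[OF U] by blast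
    let ?c = "\<lambda>e' e. coord_field (base L) V \<eta> e' x (\<zeta> e)"
    note tU = coord_field_tangent[OF U] and tV = coord_field_tangent[OF V x]
    show "Y x = (\<lambda>\<beta>. \<Sum>e\<in>frame (base L). tens L x (coord_field (base L) V \<eta> e x) (S V \<eta> e x) \<beta>)"
    proof
      fix \<beta>
      show "Y x \<beta> = (\<Sum>e\<in>frame (base L). tens L x (coord_field (base L) V \<eta> e x) (S V \<eta> e x) \<beta>)"
      proof (cases "bilinear_form L x \<beta>")
        case False
        then show ?thesis by (simp add: Y_def tens_def)
      next
        case \<beta>: True
        have "Y x \<beta> = (\<Sum>e\<in>frame (base L). \<beta> (coord_field (base L) U \<xi> e x) (S U \<xi> e x))"
          using \<beta> by (simp add: Y_def tens_def U_def \<xi>_def)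
        \<comment> \<open>The Jacobian produced by the components passes through the bilinear form
          to the coordinate fields, which makes the tensor independent of the chart.\<close>
        also have "\<dots> = (\<Sum>e\<in>frame (base L). \<Sum>e'\<in>frame (base L).
            ?c e' e * \<beta> (coord_field (base L) U \<xi> e x) (S V \<eta> e' x))"
        proof (rule sum.cong[OF refl])
          fix e
          have "S U \<xi> e x = lift x (\<lambda>u. \<Sum>e'\<in>frame (base L). sc (of_real (?c e' e)) (dec.comp V \<eta> e' x u))"
            unfolding S_def by (rule arg_cong[of _ _ "lift x"], rule ext, rule dec.comp_change[OF U(1) \<zeta> V x])
          then show "\<beta> (coord_field (base L) U \<xi> e x) (S U \<xi> e x)
              = (\<Sum>e'\<in>frame (base L). ?c e' e * \<beta> (coord_field (base L) U \<xi> e x) (S V \<eta> e' x))"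
            using bilinear_form_sum_right[OF \<beta> tU finite_frame dec.comp_lin[OF V x] dec.comp_br[OF V x]]
            by (simp add: S_def)
        qed
        also have "\<dots> = (\<Sum>e'\<in>frame (base L). \<Sum>e\<in>frame (base L).
            ?c e' e * \<beta> (coord_field (base L) U \<xi> e x) (S V \<eta> e' x))" by (rule sum.swap)
        also have "\<dots> = (\<Sum>e'\<in>frame (base L). \<beta> (coord_field (base L) V \<eta> e' x) (S V \<eta> e' x))"
        proof (rule sum.cong[OF refl])
          fix e'
          have "coord_field (base L) V \<eta> e' x
              = (\<lambda>f. \<Sum>e\<in>frame (base L). ?c e' e * coord_field (base L) U \<xi> e x f)"
            by (rule tangent_expand[OF U(1) \<zeta> tV])
          then have "\<beta> (coord_field (base L) V \<eta> e' x) (S V \<eta> e' x)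
              = \<beta> (\<lambda>f. \<Sum>e\<in>frame (base L). ?c e' e * coord_field (base L) U \<xi> e x f) (S V \<eta> e' x)"
            by (rule arg_cong)
          also have "\<dots> = (\<Sum>e\<in>frame (base L). ?c e' e * \<beta> (coord_field (base L) U \<xi> e x) (S V \<eta> e' x))"
            by (rule bilinear_form_sum_left[OF \<beta> finite_frame tU S_Cent[OF V x]])
          finally show "(\<Sum>e\<in>frame (base L). ?c e' e * \<beta> (coord_field (base L) U \<xi> e x) (S V \<eta> e' x))
              = \<beta> (coord_field (base L) V \<eta> e' x) (S V \<eta> e' x)" by (rule sym)
        qed
        finally show ?thesis using \<beta> by (simp add: tens_def)
      qed
    qed
  qed
  have "Y x \<in> tensor_fib L x" for x
  proof -
    define U \<xi> where "U = fst (dec.chart_at x)" and "\<xi> = snd (dec.chart_at x)"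
    have U: "(U, \<xi>) \<in> charts (base L)" "x \<in> U" using dec.chart_at[of x] by (auto simp: U_def \<xi>_def)
    \<comment> \<open>\<open>tensor_fib\<close> indexes its sums by natural numbers, hence an
      enumeration of the frame.\<close>
    obtain h where h: "bij_betw h {0..<card (frame (base L))} (frame (base L))"
      using ex_bij_betw_nat_finite[OF finite_frame] by blast
    have "Y x = (\<lambda>\<beta>. \<Sum>i<card (frame (base L)).
        tens L x (coord_field (base L) U \<xi> (h i) x) (S U \<xi> (h i) x) \<beta>)"
      unfolding Y_def[abs_def] U_def[symmetric] \<xi>_def[symmetric]
      by (rule ext, rule sum.reindex_bij_betw[symmetric]) (use h in \<open>simp add: atLeast0LessThan\<close>)
    then show ?thesis unfolding tensor_fib_def mem_Collect_eq
      by (intro exI[of _ "card (frame (base L))"] exI[of _ "\<lambda>i. coord_field (base L) U \<xi> (h i) x"]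
          exI[of _ "\<lambda>i. S U \<xi> (h i) x"] conjI allI impI coord_field_tangent[OF U] S_Cent[OF U])
  qed
  then have Y_sec: "Y \<in> tensor_sections L" using comps by (auto simp: tensor_sections_def)
  have "D0 \<in> hom_sections_on L UNIV"
    unfolding D0_def[abs_def]
  proof (rule hom_sectionI[OF open_UNIV dec.rest_at_lin])
    fix x A assume A: "A \<in> \<Gamma>"
    show "sm_sec (\<lambda>y. dec.rest_at y (A y)) x"
      using \<Gamma>D[OF dec.rest_\<Gamma>[OF A]] dec.rest_at_eq[OF A] by simp
  qed
  moreover have "D0 x \<in> Der_fib L x" for x
    unfolding D0_def by (rule lift_Der[OF dec.rest_at_lin dec.rest_at_br])
  ultimately have D0_sec: "D0 \<in> Der_sections L" by (simp add: Der_sections_def)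
  have "decomposes D Y D0"
    unfolding decomposes_def
  proof (intro ballI ext)
    fix A x assume A: "A \<in> sections L"
    obtain U \<xi> where U: "(U, \<xi>) \<in> charts (base L)" "x \<in> U" by (rule ex_chart)
    have "triv L x (D A x) = hat_op D (hat A) x"
      by (simp add: hat_op_def hat_def[of "D _"] unhat_hat[OF A])
    also have "\<dots> = dec.nab_comp U \<xi> (hat A) x + dec.rest_at x (hat A x)"
      by (rule dec.decomposition[OF U section_hat[OF A]])
    also have "dec.nab_comp U \<xi> (hat A) x = component_sum U \<xi> (S U \<xi>) A x"
      by (simp add: dec.nab_comp_def component_sum_def S_def)
    also have "dec.rest_at x (hat A x) = triv L x (D0 x (A x))"
      by (simp add: D0_def hat_def triv_End[OF section_fib[OF A]])
    finally show "D A x = sadd L (nabla_ext L nabla Y A) (iop D0 A) x"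
      using section_fib[OF D_sec[OF A]]
      by (intro fib_eqI[of _ x]) (simp_all add: sadd_def iop_def nabla_ext_eq[OF U comps[OF U(1)] A])
  qed
  then show ?thesis using Y_sec D0_sec by blast
qed

end

theorem theorem2p83:
  fixes L :: "('m::t2_space, 'e::real_inner, 'k::{real_normed_field,euclidean_space},
                'f::ab_group_add, 'l) lie_bundle_data"
    and nabla :: "('m \<Rightarrow> 'm tvec) \<Rightarrow> ('m \<Rightarrow> 'l) \<Rightarrow> 'm \<Rightarrow> 'l"
    and D :: "('m \<Rightarrow> 'l) \<Rightarrow> 'm \<Rightarrow> 'l"
  assumes "lie_bundle L"
    and "lie_connection L nabla"
    and "perfect_lie (fiber L) \<or> centerfree_lie (fiber L)"
    and "linear_op L D"
  shows "(derivation_op L D \<longleftrightarrow>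
           (\<exists>Y\<in>tensor_sections L. \<exists>D0\<in>Der_sections L.
              \<forall>A\<in>sections L. D A = sadd L (nabla_ext L nabla Y A) (iop D0 A))) \<and>
         (\<forall>Y\<in>tensor_sections L. \<forall>D0\<in>Der_sections L.
          \<forall>Y'\<in>tensor_sections L. \<forall>D0'\<in>Der_sections L.
            (\<forall>A\<in>sections L. D A = sadd L (nabla_ext L nabla Y A) (iop D0 A)) \<and>
            (\<forall>A\<in>sections L. D A = sadd L (nabla_ext L nabla Y' A) (iop D0' A)) \<longrightarrow>
            Y = Y' \<and> D0 = D0')"
proof -
  interpret lie_bdl_connection L nabla
    using assms(1,2) by unfold_locales
  show ?thesis
    unfolding decomposes_def[symmetric]
    using derivation_imp_decomposes[OF assms(3)] decomposes_imp_derivation[OF assms(4)]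
      decomposition_unique by blast
qed

end
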